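(* Let $\mathfrak{g}$ be a semisimple Lie algebra of finite dimension over $\mathbb{C}$ and let $V$ be a finite-dimensional left $\mathfrak{g}$-module. Then the Taylor spectrum of $V$ is $$\sigma_{\mathfrak{g}}(V) = \{S \in \hat{\mathfrak{g}} : S \text{ is isomorphic to a submodule of } V\}.$$
   Context: All Lie algebras are over $\mathbb{C}$. For a finite-dimensional Lie algebra $\mathfrak{g}$, $U\mathfrak{g}$ is its universal enveloping algebra and $\hat{\mathfrak{g}}$ is the set of isomorphism classes of simple finite-dimensional left $\mathfrak{g}$-modules (a simple module and its class are denoted by the same letter). The Taylor spectrum of a left $\mathfrak{g}$-module $V$ is $$\sigma_{\mathfrak{g}}(V)=\{ S\in \hat{\mathfrak{g}} : \operatorname{Tor}^{U\mathfrak{g}}_k(S^*,V)\neq 0 \text{ for some } k\geq 0 \},$$ where $S^*$ is the dual vector space of $S$ with the right $\mathfrak{g}$-action $(f\cdot x)(s)=f(x\cdot s)$ for $f\in S^*$, $x\in\mathfrak{g}$, $s\in S$. *)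

theory Defs
  imports
    Complex_Main
    "HOL-Library.Function_Algebras"
    "HOL-Library.Poly_Mapping"
    "HOL-Algebra.Free_Abelian_Groups"
begin

section \<open>Complex vector spaces and Lie algebras\<close>

class complex_vs = ab_group_add +
  fixes scaleC :: "complex \<Rightarrow> 'a \<Rightarrow> 'a" (infixr \<open>*\<^sub>C\<close> 75)
  assumes scaleC_add_right: "c *\<^sub>C (x + y) = c *\<^sub>C x + c *\<^sub>C y"
    and scaleC_add_left: "(b + c) *\<^sub>C x = b *\<^sub>C x + c *\<^sub>C x"
    and scaleC_scaleC: "b *\<^sub>C (c *\<^sub>C x) = (b * c) *\<^sub>C x"
    and scaleC_one: "1 *\<^sub>C x = x"

global_interpretation complex_vs: vector_space "scaleC :: complex \<Rightarrow> 'a \<Rightarrow> 'a::complex_vs"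
  defines csubspace = complex_vs.subspace
    and cspan = complex_vs.span
  by unfold_locales (simp_all add: scaleC_add_right scaleC_add_left scaleC_scaleC scaleC_one)

definition fin_dim :: "'a::complex_vs set \<Rightarrow> bool" where
  "fin_dim W \<longleftrightarrow> (\<exists>B. finite B \<and> W = cspan B)"

instantiation complex :: complex_vs
begin
definition "scaleC_complex (c::complex) (x::complex) = c * x"
instance by standard (simp_all add: scaleC_complex_def algebra_simps)
end

instantiation "fun" :: (type, complex_vs) complex_vs
begin
definition "scaleC_fun c (f :: 'a \<Rightarrow> 'b) = (\<lambda>x. c *\<^sub>C f x)"
instance
  by standard
    (simp_all add: scaleC_fun_def fun_eq_iff scaleC_add_right scaleC_add_left scaleC_scaleC scaleC_one)
end

class lie_algebra = complex_vs +
  fixes lie_bracket :: "'a \<Rightarrow> 'a \<Rightarrow> 'a"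
  assumes lie_bracket_add_left: "lie_bracket (x + y) z = lie_bracket x z + lie_bracket y z"
    and lie_bracket_add_right: "lie_bracket z (x + y) = lie_bracket z x + lie_bracket z y"
    and lie_bracket_scale_left: "lie_bracket (c *\<^sub>C x) y = c *\<^sub>C lie_bracket x y"
    and lie_bracket_scale_right: "lie_bracket x (c *\<^sub>C y) = c *\<^sub>C lie_bracket x y"
    and lie_bracket_self: "lie_bracket x x = 0"
    and lie_bracket_jacobi:
      "lie_bracket x (lie_bracket y z) + lie_bracket y (lie_bracket z x)
        + lie_bracket z (lie_bracket x y) = 0"

definition lie_ideal :: "'g::lie_algebra set \<Rightarrow> bool" where
  "lie_ideal I \<longleftrightarrow> csubspace I \<and> (\<forall>x. \<forall>y\<in>I. lie_bracket x y \<in> I)"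

primrec derived_series :: "'g::lie_algebra set \<Rightarrow> nat \<Rightarrow> 'g set" where
  "derived_series I 0 = I"
| "derived_series I (Suc n) =
     cspan {lie_bracket x y | x y. x \<in> derived_series I n \<and> y \<in> derived_series I n}"

definition lie_solvable :: "'g::lie_algebra set \<Rightarrow> bool" where
  "lie_solvable I \<longleftrightarrow> (\<exists>n. derived_series I n = {0})"

text \<open>A finite-dimensional Lie algebra is semisimple if its radical, the largest solvable ideal,
  is zero; the zero Lie algebra counts as semisimple.\<close>

definition semisimple_lie_algebra :: "'g::lie_algebra itself \<Rightarrow> bool" where
  "semisimple_lie_algebra _ \<longleftrightarrow>
     fin_dim (UNIV :: 'g set) \<and> (\<forall>I :: 'g set. lie_ideal I \<and> lie_solvable I \<longrightarrow> I = {0})"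


section \<open>Modules over a Lie algebra\<close>

text \<open>The carrier is a linear subspace of the ambient type; the values of the action outside the
  carrier are irrelevant.\<close>

record ('g, 'v) lmodule = "'v partial_object" +
  act :: "'g \<Rightarrow> 'v \<Rightarrow> 'v"

definition lie_module :: "('g::lie_algebra, 'v::complex_vs) lmodule \<Rightarrow> bool" where
  "lie_module V \<longleftrightarrow>
     csubspace (carrier V) \<and>
     (\<forall>x. \<forall>v\<in>carrier V. act V x v \<in> carrier V) \<and>
     (\<forall>x. \<forall>v\<in>carrier V. \<forall>w\<in>carrier V. act V x (v + w) = act V x v + act V x w) \<and>
     (\<forall>x c. \<forall>v\<in>carrier V. act V x (c *\<^sub>C v) = c *\<^sub>C act V x v) \<and>
     (\<forall>x y. \<forall>v\<in>carrier V. act V (x + y) v = act V x v + act V y v) \<and>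
     (\<forall>c x. \<forall>v\<in>carrier V. act V (c *\<^sub>C x) v = c *\<^sub>C act V x v) \<and>
     (\<forall>x y. \<forall>v\<in>carrier V.
        act V (lie_bracket x y) v = act V x (act V y v) - act V y (act V x v))"

definition lie_submodule :: "'v::complex_vs set \<Rightarrow> ('g::lie_algebra, 'v) lmodule \<Rightarrow> bool" where
  "lie_submodule W V \<longleftrightarrow>
     csubspace W \<and> W \<subseteq> carrier V \<and> (\<forall>x. \<forall>w\<in>W. act V x w \<in> W)"

definition lie_simple :: "('g::lie_algebra, 'v::complex_vs) lmodule \<Rightarrow> bool" where
  "lie_simple V \<longleftrightarrow>
     lie_module V \<and> carrier V \<noteq> {0} \<and> (\<forall>W. lie_submodule W V \<longrightarrow> W = {0} \<or> W = carrier V)"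

definition lie_isomorphic ::
  "('g::lie_algebra, 'v::complex_vs) lmodule \<Rightarrow> ('g, 'w::complex_vs) lmodule \<Rightarrow> bool"
  (infix \<open>\<simeq>\<close> 50) where
  "V \<simeq> W \<longleftrightarrow>
     (\<exists>f. bij_betw f (carrier V) (carrier W) \<and>
        (\<forall>v\<in>carrier V. \<forall>w\<in>carrier V. f (v + w) = f v + f w) \<and>
        (\<forall>c. \<forall>v\<in>carrier V. f (c *\<^sub>C v) = c *\<^sub>C f v) \<and>
        (\<forall>x. \<forall>v\<in>carrier V. f (act V x v) = act W x (f v)))"

text \<open>Isomorphism classes of simple finite-dimensional modules carried by subspaces of the
  ambient type \<open>'s\<close>. Every finite-dimensional module is isomorphic to one carried by a subspace of
  \<open>nat \<Rightarrow> complex\<close>, so at \<open>'s = nat \<Rightarrow> complex\<close> all isomorphism classes are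
  present; \<open>'s\<close> is kept arbitrary.\<close>

definition simple_fd_modules :: "('g::lie_algebra, 's::complex_vs) lmodule set" where
  "simple_fd_modules = {S. lie_simple S \<and> fin_dim (carrier S)}"

definition simple_classes :: "('g::lie_algebra, 's::complex_vs) lmodule set set" where
  "simple_classes =
     simple_fd_modules // {(S, T). S \<in> simple_fd_modules \<and> T \<in> simple_fd_modules \<and> S \<simeq> T}"

text \<open>A right module uses \<open>ract m a\<close> for \<open>m \<cdot> a\<close>; the same record serves
  for right modules over a Lie algebra and over a ring.\<close>

record ('a, 'm) rmodule = "'m partial_object" +
  ract :: "'m \<Rightarrow> 'a \<Rightarrow> 'm"

text \<open>Linear functionals on the carrier are represented by functions that vanish outside it.\<close>

definition dual_module ::
  "('g::lie_algebra, 's::complex_vs) lmodule \<Rightarrow> ('g, 's \<Rightarrow> complex) rmodule" where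
  "dual_module S =
     \<lparr>carrier = {f. (\<forall>s\<in>carrier S. \<forall>t\<in>carrier S. f (s + t) = f s + f t) \<and>
                  (\<forall>c. \<forall>s\<in>carrier S. f (c *\<^sub>C s) = c * f s) \<and>
                  (\<forall>s. s \<notin> carrier S \<longrightarrow> f s = 0)},
      ract = (\<lambda>f x s. if s \<in> carrier S then f (act S x s) else 0)\<rparr>"


section \<open>The universal enveloping algebra\<close>

text \<open>The free monoid on \<open>'g\<close>, written additively so that
  \<open>'g fword \<Rightarrow>\<^sub>0 complex\<close> is its monoid algebra, i.e. the free associative unital
  algebra on the set \<open>'g\<close>.\<close>

datatype 'g fword = FWord (letters: "'g list")

instantiation fword :: (type) monoid_add
begin
definition "0 = FWord []"
definition "v + w = FWord (letters v @ letters w)"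
instance by standard (simp_all add: zero_fword_def plus_fword_def)
end

abbreviation letter :: "'g \<Rightarrow> 'g fword \<Rightarrow>\<^sub>0 complex" where
  "letter x \<equiv> Poly_Mapping.single (FWord [x]) 1"

text \<open>The two-sided ideal generated by the relations of the universal enveloping algebra. The first
  two families make \<open>letter\<close> linear, so that the quotient by them alone is the tensor algebra;
  a scalar \<open>c\<close> is \<open>Poly_Mapping.single 0 c\<close>.\<close>

inductive_set uea_ideal :: "('g::lie_algebra fword \<Rightarrow>\<^sub>0 complex) set" where
  rel_add: "letter (x + y) - letter x - letter y \<in> uea_ideal"
| rel_scale: "letter (c *\<^sub>C x) - Poly_Mapping.single 0 c * letter x \<in> uea_ideal"
| rel_bracket: "letter x * letter y - letter y * letter x - letter (lie_bracket x y) \<in> uea_ideal"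
| zero: "0 \<in> uea_ideal"
| add: "p \<in> uea_ideal \<Longrightarrow> q \<in> uea_ideal \<Longrightarrow> p + q \<in> uea_ideal"
| mult_left: "p \<in> uea_ideal \<Longrightarrow> r * p \<in> uea_ideal"
| mult_right: "p \<in> uea_ideal \<Longrightarrow> p * r \<in> uea_ideal"

lemma uea_ideal_uminus: "p \<in> uea_ideal \<Longrightarrow> - p \<in> uea_ideal"
  using uea_ideal.mult_left[of p "- 1"] by simp

lemma uea_ideal_diff: "p \<in> uea_ideal \<Longrightarrow> q \<in> uea_ideal \<Longrightarrow> p - q \<in> uea_ideal"
  using uea_ideal.add[of p "- q"] uea_ideal_uminus[of q] by simp

definition uea_rel :: "('g::lie_algebra fword \<Rightarrow>\<^sub>0 complex) \<Rightarrow> ('g fword \<Rightarrow>\<^sub>0 complex) \<Rightarrow> bool" where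
  "uea_rel p q \<longleftrightarrow> p - q \<in> uea_ideal"

lemma equivp_uea_rel: "equivp uea_rel"
proof (rule equivpI)
  show "reflp uea_rel"
    by (auto simp: reflp_def uea_rel_def uea_ideal.zero)
  show "symp uea_rel"
  proof (rule sympI)
    fix p q
    assume "uea_rel p q"
    then show "uea_rel q p"
      using uea_ideal_uminus[of "p - q"] by (simp add: uea_rel_def)
  qed
  show "transp uea_rel"
  proof (rule transpI)
    fix p q r
    assume "uea_rel p q" and "uea_rel q r"
    then show "uea_rel p r"
      using uea_ideal.add[of "p - q" "q - r"] by (simp add: uea_rel_def)
  qed
qed

lemma lookup_fword_times_0:
  fixes p q :: "'g fword \<Rightarrow>\<^sub>0 complex"
  shows "Poly_Mapping.lookup (p * q) 0 = Poly_Mapping.lookup p 0 * Poly_Mapping.lookup q 0"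
proof -
  have *: "(0 = v + w) = (v = 0 \<and> w = 0)" for v w :: "'g fword"
    by (cases v; cases w) (auto simp: zero_fword_def plus_fword_def)
  have "(\<Sum>w. Poly_Mapping.lookup q w when 0 = v + w) = (Poly_Mapping.lookup q 0 when v = 0)" for v
    by (cases "v = 0") (simp_all add: * )
  then show ?thesis
    by (simp add: lookup_mult when_mult mult_when)
qed

lemma uea_ideal_lookup_0: "p \<in> uea_ideal \<Longrightarrow> Poly_Mapping.lookup p 0 = 0"
  by (induction rule: uea_ideal.induct)
    (simp_all add: lookup_add lookup_minus lookup_fword_times_0 lookup_single, simp_all add: zero_fword_def)

quotient_type (overloaded) 'g uea = "'g::lie_algebra fword \<Rightarrow>\<^sub>0 complex" / uea_rel
  by (rule equivp_uea_rel)

instantiation uea :: (lie_algebra) ring_1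
begin

lift_definition zero_uea :: "'a uea" is 0 .

lift_definition one_uea :: "'a uea" is 1 .

lift_definition plus_uea :: "'a uea \<Rightarrow> 'a uea \<Rightarrow> 'a uea" is "(+)"
proof -
  fix p p' q q' :: "'a fword \<Rightarrow>\<^sub>0 complex"
  assume "uea_rel p p'" "uea_rel q q'"
  then show "uea_rel (p + q) (p' + q')"
    using uea_ideal.add[of "p - p'" "q - q'"] by (simp add: uea_rel_def algebra_simps)
qed

lift_definition uminus_uea :: "'a uea \<Rightarrow> 'a uea" is uminus
proof -
  fix p p' :: "'a fword \<Rightarrow>\<^sub>0 complex"
  assume "uea_rel p p'"
  then show "uea_rel (- p) (- p')"
    using uea_ideal_uminus[of "p - p'"] by (simp add: uea_rel_def)
qed

lift_definition minus_uea :: "'a uea \<Rightarrow> 'a uea \<Rightarrow> 'a uea" is "(-)"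
proof -
  fix p p' q q' :: "'a fword \<Rightarrow>\<^sub>0 complex"
  assume "uea_rel p p'" "uea_rel q q'"
  then show "uea_rel (p - q) (p' - q')"
    using uea_ideal_diff[of "p - p'" "q - q'"] by (simp add: uea_rel_def algebra_simps)
qed

lift_definition times_uea :: "'a uea \<Rightarrow> 'a uea \<Rightarrow> 'a uea" is "(*)"
proof -
  fix p p' q q' :: "'a fword \<Rightarrow>\<^sub>0 complex"
  assume "uea_rel p p'" "uea_rel q q'"
  then have "(p - p') * q + p' * (q - q') \<in> uea_ideal"
    by (auto simp: uea_rel_def intro: uea_ideal.intros)
  then show "uea_rel (p * q) (p' * q')"
    by (simp add: uea_rel_def algebra_simps)
qed

instance
proof
  show "(0::'a uea) \<noteq> 1"
    by transfer (auto simp: uea_rel_def lookup_minus dest: uea_ideal_lookup_0)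
qed (transfer; simp add: uea_rel_def uea_ideal.zero algebra_simps)+

end

text \<open>The \<open>U\<close>-module structures extending an action of the Lie algebra: the word
  \<open>x\<^sub>1 \<dots> x\<^sub>n\<close> acts by \<open>v \<mapsto> x\<^sub>1 \<cdot> (\<dots> (x\<^sub>n \<cdot> v))\<close> on
  a left module and by \<open>m \<mapsto> ((m \<cdot> x\<^sub>1) \<dots>) \<cdot> x\<^sub>n\<close> on a right module. On
  modules over the Lie algebra these do not depend on the representative chosen by
  \<open>rep_uea\<close>.\<close>

definition uea_lmodule :: "('g::lie_algebra, 'v::complex_vs) lmodule \<Rightarrow> ('g uea, 'v) lmodule" where
  "uea_lmodule V =
     \<lparr>carrier = carrier V,
      act = (\<lambda>u v. \<Sum>w\<in>Poly_Mapping.keys (rep_uea u).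
               Poly_Mapping.lookup (rep_uea u) w *\<^sub>C foldr (act V) (letters w) v)\<rparr>"

definition uea_rmodule :: "('g::lie_algebra, 'm::complex_vs) rmodule \<Rightarrow> ('g uea, 'm) rmodule" where
  "uea_rmodule M =
     \<lparr>carrier = carrier M,
      ract = (\<lambda>m u. \<Sum>w\<in>Poly_Mapping.keys (rep_uea u).
                Poly_Mapping.lookup (rep_uea u) w *\<^sub>C foldl (ract M) m (letters w))\<rparr>"


section \<open>Tor over a ring\<close>

definition right_module :: "('a::ring_1, 'm::ab_group_add) rmodule \<Rightarrow> bool" where
  "right_module M \<longleftrightarrow>
     0 \<in> carrier M \<and>
     (\<forall>m\<in>carrier M. \<forall>n\<in>carrier M. m + n \<in> carrier M) \<and>
     (\<forall>m\<in>carrier M. - m \<in> carrier M) \<and>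
     (\<forall>m\<in>carrier M. \<forall>a. ract M m a \<in> carrier M) \<and>
     (\<forall>m\<in>carrier M. \<forall>n\<in>carrier M. \<forall>a. ract M (m + n) a = ract M m a + ract M n a) \<and>
     (\<forall>m\<in>carrier M. \<forall>a b. ract M m (a + b) = ract M m a + ract M m b) \<and>
     (\<forall>m\<in>carrier M. \<forall>a b. ract M m (a * b) = ract M (ract M m a) b) \<and>
     (\<forall>m\<in>carrier M. ract M m 1 = m)"

definition rmodule_hom ::
  "('a::ring_1, 'm::ab_group_add) rmodule \<Rightarrow> ('a, 'n::ab_group_add) rmodule \<Rightarrow> ('m \<Rightarrow> 'n) set" where
  "rmodule_hom M N =
     {f. (\<forall>m\<in>carrier M. f m \<in> carrier N) \<and>
         (\<forall>m\<in>carrier M. \<forall>n\<in>carrier M. f (m + n) = f m + f n) \<and>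
         (\<forall>m\<in>carrier M. \<forall>a. f (ract M m a) = ract N (f m) a)}"

definition free_rmodule :: "'i set \<Rightarrow> ('a::ring_1, 'i \<Rightarrow>\<^sub>0 'a) rmodule" where
  "free_rmodule I =
     \<lparr>carrier = {p. Poly_Mapping.keys p \<subseteq> I},
      ract = (\<lambda>p a. Poly_Mapping.map (\<lambda>b. b * a) p)\<rparr>"

text \<open>A free resolution
  \<open>\<dots> \<rightarrow> F (I 1) \<rightarrow> F (I 0) \<rightarrow> M \<rightarrow> 0\<close>
  with \<open>F (I n)\<close> the free right module on \<open>I n\<close>, differentials
  \<open>d n : F (I (Suc n)) \<rightarrow> F (I n)\<close> and augmentation \<open>e\<close>.\<close>

definition free_resolution ::
  "('a::ring_1, 'm::ab_group_add) rmodule \<Rightarrow> (nat \<Rightarrow> 'i set) \<Rightarrow>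
     (nat \<Rightarrow> ('i \<Rightarrow>\<^sub>0 'a) \<Rightarrow> ('i \<Rightarrow>\<^sub>0 'a)) \<Rightarrow> (('i \<Rightarrow>\<^sub>0 'a) \<Rightarrow> 'm) \<Rightarrow> bool" where
  "free_resolution M I d e \<longleftrightarrow>
     e \<in> rmodule_hom (free_rmodule (I 0)) M \<and>
     (\<forall>n. d n \<in> rmodule_hom (free_rmodule (I (Suc n))) (free_rmodule (I n))) \<and>
     e ` carrier (free_rmodule (I 0)) = carrier M \<and>
     d 0 ` carrier (free_rmodule (I (Suc 0))) = {p \<in> carrier (free_rmodule (I 0)). e p = 0} \<and>
     (\<forall>n. d (Suc n) ` carrier (free_rmodule (I (Suc (Suc n)))) =
            {p \<in> carrier (free_rmodule (I (Suc n))). d n p = 0})"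

text \<open>The tensor product of a right and a left module: the free abelian group on the product of
  the carriers modulo the usual relations.\<close>

definition tensor_rels ::
  "('a::ring_1, 'm::ab_group_add) rmodule \<Rightarrow> ('a, 'n::ab_group_add) lmodule \<Rightarrow> ('m \<times> 'n \<Rightarrow>\<^sub>0 int) set" where
  "tensor_rels M N =
     generate (free_Abelian_group (carrier M \<times> carrier N))
      ({frag_of (m + m', n) - frag_of (m, n) - frag_of (m', n) | m m' n.
          m \<in> carrier M \<and> m' \<in> carrier M \<and> n \<in> carrier N} \<union>
       {frag_of (m, n + n') - frag_of (m, n) - frag_of (m, n') | m n n'.
          m \<in> carrier M \<and> n \<in> carrier N \<and> n' \<in> carrier N} \<union>
       {frag_of (ract M m a, n) - frag_of (m, act N a n) | m a n.
          m \<in> carrier M \<and> n \<in> carrier N})"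

definition tensor ::
  "('a::ring_1, 'm::ab_group_add) rmodule \<Rightarrow> ('a, 'n::ab_group_add) lmodule \<Rightarrow>
     ('m \<times> 'n \<Rightarrow>\<^sub>0 int) set monoid" where
  "tensor M N = free_Abelian_group (carrier M \<times> carrier N) Mod tensor_rels M N"

text \<open>The homomorphism \<open>f \<otimes> id\<close> from \<open>tensor M N\<close> to
  \<open>tensor M' N\<close>, on cosets.\<close>

definition tensor_map ::
  "('a::ring_1, 'm'::ab_group_add) rmodule \<Rightarrow> ('a, 'n::ab_group_add) lmodule \<Rightarrow> ('m \<Rightarrow> 'm') \<Rightarrow>
     ('m \<times> 'n \<Rightarrow>\<^sub>0 int) set \<Rightarrow> ('m' \<times> 'n \<Rightarrow>\<^sub>0 int) set" where
  "tensor_map M' N f =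
     (\<lambda>X. the_elem ((\<lambda>c. tensor_rels M' N #>\<^bsub>free_Abelian_group (carrier M' \<times> carrier N)\<^esub>
                          frag_extend (\<lambda>(m, n). frag_of (f m, n)) c) ` X))"

text \<open>The \<open>k\<close>-th homology group of the complex \<open>F (I \<bullet>) \<otimes> N\<close>.\<close>

definition tensor_homology ::
  "(nat \<Rightarrow> 'i set) \<Rightarrow> (nat \<Rightarrow> ('i \<Rightarrow>\<^sub>0 'a) \<Rightarrow> ('i \<Rightarrow>\<^sub>0 'a)) \<Rightarrow>
     ('a::ring_1, 'n::ab_group_add) lmodule \<Rightarrow> nat \<Rightarrow> (('i \<Rightarrow>\<^sub>0 'a) \<times> 'n \<Rightarrow>\<^sub>0 int) set set monoid" where
  "tensor_homology I d N k =
     (let C = (\<lambda>n. tensor (free_rmodule (I n)) N);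
          \<delta> = (\<lambda>n. tensor_map (free_rmodule (I n)) N (d n));
          Z = (case k of 0 \<Rightarrow> carrier (C 0) | Suc n \<Rightarrow> kernel (C (Suc n)) (C n) (\<delta> n))
      in subgroup_generated (C k) Z Mod (\<delta> k ` carrier (C (Suc k))))"

text \<open>\<open>Tor\<close> is computed from some free resolution with basis elements in
  \<open>('m \<times> 'a) list\<close>. This type is infinite and not smaller than \<open>'m\<close> and
  \<open>'a\<close>, so such a resolution exists for every right module; see
  \<open>free_resolution_exists\<close> below.\<close>

definition Tor ::
  "('a::ring_1, 'm::ab_group_add) rmodule \<Rightarrow> ('a, 'n::ab_group_add) lmodule \<Rightarrow> nat \<Rightarrow>
     ((('m \<times> 'a) list \<Rightarrow>\<^sub>0 'a) \<times> 'n \<Rightarrow>\<^sub>0 int) set set monoid" where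
  "Tor M N k =
     (let (I, d) = (SOME (I :: nat \<Rightarrow> ('m \<times> 'a) list set, d). \<exists>e. free_resolution M I d e)
      in tensor_homology I d N k)"

lemma right_module_free: "right_module (free_rmodule I :: ('a::ring_1, 'i \<Rightarrow>\<^sub>0 'a) rmodule)"
proof -
  have l: "Poly_Mapping.lookup (Poly_Mapping.map (\<lambda>b. b * a) p) i = Poly_Mapping.lookup p i * a"
    for p :: "'i \<Rightarrow>\<^sub>0 'a" and a i
    by (auto simp: map.rep_eq when_def)
  have k: "Poly_Mapping.keys (Poly_Mapping.map (\<lambda>b. b * a) p) \<subseteq> Poly_Mapping.keys p"
    for p :: "'i \<Rightarrow>\<^sub>0 'a" and a
    by (auto simp: in_keys_iff l)
  have "Poly_Mapping.keys (Poly_Mapping.map (\<lambda>b. b * a) p) \<subseteq> I"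
    if "Poly_Mapping.keys p \<subseteq> I" for p :: "'i \<Rightarrow>\<^sub>0 'a" and a
    using k that by (rule subset_trans)
  moreover have "Poly_Mapping.keys (p + q) \<subseteq> I"
    if "Poly_Mapping.keys p \<subseteq> I" "Poly_Mapping.keys q \<subseteq> I" for p q :: "'i \<Rightarrow>\<^sub>0 'a"
    using keys_add[of p q] that by blast
  ultimately show ?thesis
    by (simp add: right_module_def free_rmodule_def poly_mapping_eq_iff fun_eq_iff l lookup_add)
      (simp add: algebra_simps map.rep_eq when_def)
qed

lemma rmodule_hom_zero:
  assumes "right_module M" "f \<in> rmodule_hom M N"
  shows "f 0 = 0"
proof -
  have "0 \<in> carrier M" using assms by (simp add: right_module_def)
  then have "f (0 + 0) = f 0 + f 0" using assms(2) unfolding rmodule_hom_def by blast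
  then show ?thesis by simp
qed

lemma right_module_zero_act:
  assumes "right_module M"
  shows "ract M 0 a = 0"
proof -
  have "0 \<in> carrier M" using assms by (simp add: right_module_def)
  then have "ract M (0 + 0) a = ract M 0 a + ract M 0 a" using assms unfolding right_module_def by blast
  then show ?thesis by simp
qed

lemma right_module_act_zero:
  assumes "right_module M" "m \<in> carrier M"
  shows "ract M m 0 = 0"
proof -
  have "ract M m (0 + 0) = ract M m 0 + ract M m 0" using assms unfolding right_module_def by blast
  then show ?thesis by simp
qed

lemma right_module_kernel:
  assumes M: "right_module M" and N: "right_module N" and f: "f \<in> rmodule_hom M N"
  shows "right_module \<lparr>carrier = {m \<in> carrier M. f m = 0}, ract = ract M\<rparr>"
proof -
  have "f (- m) = 0" if "m \<in> carrier M" "f m = 0" for m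
  proof -
    have "- m \<in> carrier M" using M that by (simp add: right_module_def)
    then have "f (m + - m) = f m + f (- m)" using f that unfolding rmodule_hom_def by blast
    then show ?thesis using that rmodule_hom_zero[OF M f] by simp
  qed
  moreover have "f (ract M m a) = 0" if "m \<in> carrier M" "f m = 0" for m a
    using f that right_module_zero_act[OF N, of a] by (simp add: rmodule_hom_def)
  moreover have "f (m + n) = 0" if "m \<in> carrier M" "n \<in> carrier M" "f m = 0" "f n = 0" for m n
    using f that by (simp add: rmodule_hom_def)
  ultimately show ?thesis
    using M rmodule_hom_zero[OF M f] by (simp add: right_module_def)
qed

lemma free_cover:
  fixes N :: "('a::ring_1, 'n::ab_group_add) rmodule" and \<phi> :: "'n \<Rightarrow> 'i"
  assumes N: "right_module N" and \<phi>: "inj_on \<phi> (carrier N)"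
  shows "\<exists>f. f \<in> rmodule_hom (free_rmodule (\<phi> ` carrier N)) N \<and>
             f ` carrier (free_rmodule (\<phi> ` carrier N)) = carrier N"
proof -
  define I where "I = \<phi> ` carrier N"
  define b where "b = inv_into (carrier N) \<phi>"
  define f where
    "f = (\<lambda>p :: 'i \<Rightarrow>\<^sub>0 'a. \<Sum>i\<in>Poly_Mapping.keys p. ract N (b i) (Poly_Mapping.lookup p i))"
  have b: "b i \<in> carrier N" if "i \<in> I" for i
    using that by (auto simp: b_def I_def inv_into_into)
  have closed: "ract N n a \<in> carrier N" if "n \<in> carrier N" for n a
    using N that by (simp add: right_module_def)
  have sum_closed: "finite A \<Longrightarrow> (\<And>i. i \<in> A \<Longrightarrow> g i \<in> carrier N) \<Longrightarrow> sum g A \<in> carrier N"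
    for A and g :: "'i \<Rightarrow> 'n"
    by (induction A rule: finite_induct) (use N in \<open>auto simp: right_module_def\<close>)
  have sum_act: "finite A \<Longrightarrow> (\<And>i. i \<in> A \<Longrightarrow> g i \<in> carrier N) \<Longrightarrow>
      ract N (sum g A) a = (\<Sum>i\<in>A. ract N (g i) a)" for A a and g :: "'i \<Rightarrow> 'n"
  proof (induction A rule: finite_induct)
    case empty
    then show ?case by (simp add: right_module_zero_act[OF N])
  next
    case (insert x A)
    then have "g x \<in> carrier N" "sum g A \<in> carrier N" by (auto intro: sum_closed)
    then have "ract N (g x + sum g A) a = ract N (g x) a + ract N (sum g A) a"
      using N unfolding right_module_def by blast
    then show ?case using insert by simp
  qed
  have f_eq: "f p = (\<Sum>i\<in>A. ract N (b i) (Poly_Mapping.lookup p i))"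
    if "finite A" "Poly_Mapping.keys p \<subseteq> A" "A \<subseteq> I" for p A
    unfolding f_def
    using that b by (intro sum.mono_neutral_left) (auto simp: in_keys_iff right_module_act_zero[OF N])
  have l: "Poly_Mapping.lookup (Poly_Mapping.map (\<lambda>b. b * a) p) i = Poly_Mapping.lookup p i * a"
    for p :: "'i \<Rightarrow>\<^sub>0 'a" and a i
    by (auto simp: map.rep_eq when_def)
  have hom: "f \<in> rmodule_hom (free_rmodule I) N"
    unfolding rmodule_hom_def free_rmodule_def
  proof (clarsimp, intro conjI allI impI)
    fix p :: "'i \<Rightarrow>\<^sub>0 'a" assume p: "Poly_Mapping.keys p \<subseteq> I"
    show "f p \<in> carrier N"
      unfolding f_def using p by (auto intro!: sum_closed closed b)
    show "f (Poly_Mapping.map (\<lambda>b. b * a) p) = ract N (f p) a" for a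
    proof -
      have "ract N (b i) (x * a) = ract N (ract N (b i) x) a" if "i \<in> I" for i x
        using N b[OF that] unfolding right_module_def by blast
      moreover have "Poly_Mapping.keys (Poly_Mapping.map (\<lambda>b. b * a) p) \<subseteq> Poly_Mapping.keys p"
        by (auto simp: in_keys_iff l)
      moreover have "ract N (f p) a =
          (\<Sum>i\<in>Poly_Mapping.keys p. ract N (ract N (b i) (Poly_Mapping.lookup p i)) a)"
        unfolding f_def by (rule sum_act) (use p b closed in auto)
      ultimately show ?thesis
        using p by (subst f_eq[of "Poly_Mapping.keys p"]) (auto simp: l intro!: sum.cong)
    qed
    fix q :: "'i \<Rightarrow>\<^sub>0 'a" assume q: "Poly_Mapping.keys q \<subseteq> I"
    let ?A = "Poly_Mapping.keys p \<union> Poly_Mapping.keys q"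
    have "ract N (b i) (x + y) = ract N (b i) x + ract N (b i) y" if "i \<in> I" for i x y
      using N b[OF that] unfolding right_module_def by blast
    then show "f (p + q) = f p + f q"
      using p q keys_add[of p q]
      by (auto simp: f_eq[of ?A] lookup_add simp flip: sum.distrib intro!: sum.cong)
  qed
  moreover have "n \<in> f ` carrier (free_rmodule I)" if "n \<in> carrier N" for n
  proof -
    have "f (Poly_Mapping.single (\<phi> n) 1) = n"
      using that N \<phi> by (simp add: f_def b_def right_module_def)
    moreover have "Poly_Mapping.single (\<phi> n) 1 \<in> carrier (free_rmodule I)"
      using that by (simp add: free_rmodule_def I_def)
    ultimately show ?thesis by force
  qed
  ultimately show ?thesis
    unfolding I_def rmodule_hom_def by (intro exI[of _ f]) blast
qed

lemma poly_mapping_list_inj: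
  "\<exists>\<phi> :: (('m \<times> 'a::zero) list \<Rightarrow>\<^sub>0 'a) \<Rightarrow> ('m \<times> 'a) list. inj \<phi>"
proof -
  let ?L = "UNIV :: ('m \<times> 'a) list set"
  let ?graph = "\<lambda>p :: ('m \<times> 'a) list \<Rightarrow>\<^sub>0 'a. (\<lambda>x. (x, Poly_Mapping.lookup p x)) ` Poly_Mapping.keys p"
  have inf: "infinite ?L" by (rule infinite_UNIV_listI)
  have "inj ?graph"
  proof (rule injI, rule poly_mapping_eqI)
    fix p q :: "('m \<times> 'a) list \<Rightarrow>\<^sub>0 'a" and x
    assume "?graph p = ?graph q"
    then have "(x, a) \<in> ?graph p \<longleftrightarrow> (x, a) \<in> ?graph q" for a by simp
    then have "Poly_Mapping.lookup p x = a \<and> a \<noteq> 0 \<longleftrightarrow> Poly_Mapping.lookup q x = a \<and> a \<noteq> 0" for a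
      by (auto simp: in_keys_iff image_iff)
    then show "Poly_Mapping.lookup p x = Poly_Mapping.lookup q x" by metis
  qed
  then have "(UNIV :: (('m \<times> 'a) list \<Rightarrow>\<^sub>0 'a) set) \<lesssim> Fpow (?L \<times> (UNIV :: 'a set))"
    unfolding lepoll_def by (intro exI[of _ ?graph]) (auto simp: Fpow_def)
  also have "Fpow (?L \<times> (UNIV :: 'a set)) \<approx> ?L \<times> (UNIV :: 'a set)"
    using inf finite_cartesian_productD1 by (intro eqpoll_Fpow) blast
  also have "?L \<times> (UNIV :: 'a set) \<lesssim> ?L \<times> ?L"
    by (intro times_lepoll_mono lepoll_refl) (auto simp: lepoll_def inj_def intro!: exI[of _ "\<lambda>a. [(undefined, a)]"])
  also have "?L \<times> ?L \<approx> ?L"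
    using card_of_Times_same_infinite[OF inf] by (simp add: eqpoll_iff_card_of_ordIso)
  finally show ?thesis
    unfolding lepoll_def by auto
qed

lemma free_resolution_exists:
  fixes M :: "('a::ring_1, 'm::ab_group_add) rmodule"
  assumes M: "right_module M"
  shows "\<exists>(I :: nat \<Rightarrow> ('m \<times> 'a) list set) d e. free_resolution M I d e"
proof -
  obtain \<phi> :: "(('m \<times> 'a) list \<Rightarrow>\<^sub>0 'a) \<Rightarrow> ('m \<times> 'a) list" where \<phi>: "inj \<phi>"
    using poly_mapping_list_inj by blast
  define \<psi> where "\<psi> = (\<lambda>m :: 'm. [(m, 0 :: 'a)])"
  have "inj_on \<psi> (carrier M)" by (auto simp: \<psi>_def inj_on_def)
  then obtain e where e: "e \<in> rmodule_hom (free_rmodule (\<psi> ` carrier M)) M"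
    "e ` carrier (free_rmodule (\<psi> ` carrier M)) = carrier M"
    using free_cover[OF M] by blast
  have "\<forall>K :: ('a, ('m \<times> 'a) list \<Rightarrow>\<^sub>0 'a) rmodule. \<exists>f. right_module K \<longrightarrow> f \<in> rmodule_hom (free_rmodule (\<phi> ` carrier K)) K \<and>
                f ` carrier (free_rmodule (\<phi> ` carrier K)) = carrier K"
    using free_cover inj_on_subset[OF \<phi>] by blast
  from choice[OF this] obtain c where c: "\<And>K :: ('a, ('m \<times> 'a) list \<Rightarrow>\<^sub>0 'a) rmodule. right_module K \<Longrightarrow>
      c K \<in> rmodule_hom (free_rmodule (\<phi> ` carrier K)) K \<and>
      c K ` carrier (free_rmodule (\<phi> ` carrier K)) = carrier K"
    by blast
  define ker :: "('m \<times> 'a) list set \<Rightarrow> ((('m \<times> 'a) list \<Rightarrow>\<^sub>0 'a) \<Rightarrow> bool) \<Rightarrow> ('a, ('m \<times> 'a) list \<Rightarrow>\<^sub>0 'a) rmodule"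
    where "ker J P = \<lparr>carrier = {p \<in> carrier (free_rmodule J). P p}, ract = ract (free_rmodule J)\<rparr>" for J P
  define K where "K = rec_nat (ker (\<psi> ` carrier M) (\<lambda>p. e p = 0)) (\<lambda>_ N. ker (\<phi> ` carrier N) (\<lambda>p. c N p = 0))"
  define I where "I = (\<lambda>n. case n of 0 \<Rightarrow> \<psi> ` carrier M | Suc n \<Rightarrow> \<phi> ` carrier (K n))"
  have K0: "K 0 = ker (I 0) (\<lambda>p. e p = 0)" and KS: "K (Suc n) = ker (I (Suc n)) (\<lambda>p. c (K n) p = 0)"
    and IS: "I (Suc n) = \<phi> ` carrier (K n)" and I0: "I 0 = \<psi> ` carrier M" for n
    by (simp_all add: K_def I_def)
  have rm: "right_module (K n)" for n
  proof (induction n)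
    case 0
    show ?case
      using right_module_kernel[OF right_module_free M e(1)] by (simp add: K0 I0 ker_def)
  next
    case (Suc n)
    have "c (K n) \<in> rmodule_hom (free_rmodule (\<phi> ` carrier (K n))) (K n)"
      using c[OF Suc] by blast
    from right_module_kernel[OF right_module_free Suc this] show ?case
      by (simp add: KS IS ker_def)
  qed
  have sub: "carrier (K n) \<subseteq> carrier (free_rmodule (I n))" "ract (K n) = ract (free_rmodule (I n))" for n
    by (cases n; auto simp: K0 KS ker_def)+
  have hom: "c (K n) \<in> rmodule_hom (free_rmodule (I (Suc n))) (free_rmodule (I n))" for n
    using c[OF rm[of n]] sub[of n] unfolding rmodule_hom_def IS by auto
  have "free_resolution M I (\<lambda>n. c (K n)) e"
    unfolding free_resolution_def
  proof (intro conjI allI)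
    show "c (K 0) ` carrier (free_rmodule (I (Suc 0))) = {p \<in> carrier (free_rmodule (I 0)). e p = 0}"
      using c[OF rm[of 0]] by (simp add: IS K0 ker_def)
    show "c (K (Suc n)) ` carrier (free_rmodule (I (Suc (Suc n)))) =
        {p \<in> carrier (free_rmodule (I (Suc n))). c (K n) p = 0}" for n
      using c[OF rm[of "Suc n"]] by (simp add: IS[of "Suc n"] KS ker_def)
  qed (use e hom in \<open>simp_all add: I0\<close>)
  then show ?thesis by blast
qed

section \<open>The Taylor spectrum\<close>

text \<open>Nonvanishing of \<open>Tor\<close> depends only on the isomorphism class of \<open>S\<close>, so
  quantifying over the representatives \<open>S \<in> \<xi>\<close> existentially or universally makes no
  difference.\<close>

definition taylor_spectrum ::
  "('g::lie_algebra, 'v::complex_vs) lmodule \<Rightarrow> ('g, 's::complex_vs) lmodule set set" where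
  "taylor_spectrum V =
     {\<xi> \<in> simple_classes. \<exists>S\<in>\<xi>. \<exists>k.
        carrier (Tor (uea_rmodule (dual_module S)) (uea_lmodule V) k) \<noteq>
        {\<one>\<^bsub>Tor (uea_rmodule (dual_module S)) (uea_lmodule V) k\<^esub>}}"

end

theory Submission
  imports Defs "HOL-Computational_Algebra.Fundamental_Theorem_Algebra"
begin

text \<open>
  Everything rests on the decomposition of a finite-dimensional module \<open>M\<close> over a semisimple \<open>\<gg>\<close> as
  the direct sum of the invariants and \<open>\<gg> M\<close>. If \<open>\<gg>\<close> acts nontrivially, Cartan's criterion provides a nonzero
  ideal on which the trace form of \<open>M\<close> is nondegenerate; the Casimir operator of this ideal has nonzero trace, so it is
  not nilpotent, and the decomposition follows by induction on the dimension through its generalized eigenspaces.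

  Applied to modules of linear maps, the decomposition yields complete reducibility. If there is no nonzero
  homomorphism \<open>S \<rightarrow> V\<close>, some element of the enveloping algebra acts as 0 on \<open>S\<close> and as 1 on \<open>V\<close>, and by the
  decomposition for the adjoint action it may be taken in the centre. Multiplication by this central element is
  null-homotopic on a free resolution of \<open>S\<^sup>*\<close> and the identity on \<open>V\<close>, so \<open>Tor\<close> vanishes. Conversely, a
  submodule \<open>S\<close> of \<open>V\<close> is a direct summand, and the evaluation pairing of \<open>S\<^sup>*\<close> with \<open>S\<close> detects a nonzero
  element of \<open>S\<^sup>* \<otimes> V\<close>.
\<close>

text \<open>The decomposition takes the place of cohomological vanishing theorems: an equivariant
  projection and a central element are each found as the invariant component of a candidate that has
  the right values but is not equivariant. It is therefore needed for modules of vectors, of linear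
  maps and of elements of the enveloping algebra, and is proved for operators on a
  finite-dimensional subspace of an arbitrary type.

  The enveloping algebra is infinite-dimensional; its elements are handled inside finite-dimensional
  pieces that are stable under commutators with letters.

  The Casimir operator need not be a scalar, since the module is not assumed simple. Its trace is
  the dimension of the ideal, which is enough to make the generalized eigenspace for 0 a proper
  submodule.

  \<open>Tor\<close> uses a resolution picked by \<open>SOME\<close>, so no explicit complex is at
  hand and vanishing must hold for every free resolution. A central element suits this: it acts on
  all free right modules compatibly with the differentials, and it can be moved across the tensor
  sign.\<close>

global_interpretation cvs_pair: vector_space_pair
  "scaleC :: complex \<Rightarrow> 'a \<Rightarrow> 'a::complex_vs" "scaleC :: complex \<Rightarrow> 'b \<Rightarrow> 'b::complex_vs"
  by unfold_locales

abbreviation clinear :: "('a::complex_vs \<Rightarrow> 'b::complex_vs) \<Rightarrow> bool" where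
  "clinear \<equiv> Vector_Spaces.linear scaleC scaleC"

lemma clinearI:
  assumes "\<And>x y. f (x + y) = f x + f y" "\<And>c x. f (c *\<^sub>C x) = c *\<^sub>C f x"
  shows "clinear f"
  using assms by (simp add: Vector_Spaces.linear_iff complex_vs.vector_space_axioms)

lemmas clinear_add = cvs_pair.linear_add
  and clinear_diff = cvs_pair.linear_diff
  and clinear_scale = cvs_pair.linear_scale
  and clinear_0 = cvs_pair.linear_0
  and clinear_neg = cvs_pair.linear_neg
  and clinear_sum = cvs_pair.linear_sum

lemmas csubspace_simps = complex_vs.subspace_0 complex_vs.subspace_add complex_vs.subspace_diff
  complex_vs.subspace_neg complex_vs.subspace_scale

declare complex_vs.independent_empty [simp]

section \<open>Finite-dimensional subspaces\<close>

definition is_basis :: "'a::complex_vs set \<Rightarrow> 'a set \<Rightarrow> bool" where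
  "is_basis B W \<longleftrightarrow> finite B \<and> complex_vs.independent B \<and> cspan B = W"

lemma is_basis_subset: "is_basis B W \<Longrightarrow> B \<subseteq> W"
  using complex_vs.span_superset by (auto simp: is_basis_def)

lemma is_basis_subspace: "is_basis B W \<Longrightarrow> csubspace W"
  by (auto simp: is_basis_def)

lemma fin_dim_independent_finite:
  "fin_dim W \<Longrightarrow> complex_vs.independent B \<Longrightarrow> B \<subseteq> W \<Longrightarrow> finite B"
  unfolding fin_dim_def using complex_vs.independent_span_bound[of _ B] by auto

text \<open>The spanning set \<open>X\<close> is a parameter so that a basis can be drawn from a
  prescribed family; \<open>geig_basis\<close> takes it among generalized eigenvectors.\<close>

lemma fin_dim_extend_basis:
  assumes "fin_dim W" "csubspace W" "complex_vs.independent A" "A \<subseteq> W" "A \<subseteq> X" "X \<subseteq> W" "cspan X = W"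
  obtains B where "A \<subseteq> B" "B \<subseteq> X" "is_basis B W"
proof -
  obtain B where B: "A \<subseteq> B" "B \<subseteq> X" "complex_vs.independent B" "X \<subseteq> cspan B"
    by (rule complex_vs.maximal_independent_subset_extend[OF assms(5,3)])
  have "finite B" using fin_dim_independent_finite[OF assms(1) B(3)] B assms(6) by simp
  moreover have "cspan B = W"
    using B assms complex_vs.span_minimal[of X "cspan B"] complex_vs.span_mono[of B X] by auto
  ultimately show ?thesis using that B by (auto simp: is_basis_def)
qed

lemma fin_dim_extend_basis':
  assumes "fin_dim W" "csubspace W" "complex_vs.independent A" "A \<subseteq> W"
  obtains B where "A \<subseteq> B" "is_basis B W"
  using fin_dim_extend_basis[OF assms(1-4), of W] assms by (metis complex_vs.span_eq_iff order_refl)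

lemma fin_dim_basis:
  assumes "fin_dim W" "csubspace W"
  obtains B where "is_basis B W"
  by (rule fin_dim_extend_basis'[OF assms, of "{}"]) (auto intro: that)

lemma fin_dim_csubspace: "fin_dim W \<Longrightarrow> csubspace W"
  by (auto simp: fin_dim_def)

lemma fin_dim_subspace:
  assumes "fin_dim W" "csubspace U" "U \<subseteq> W"
  shows "fin_dim U"
proof -
  obtain B where B: "B \<subseteq> U" "complex_vs.independent B" "U \<subseteq> cspan B"
    using complex_vs.maximal_independent_subset by blast
  have "finite B" using fin_dim_independent_finite[OF assms(1) B(2)] B assms(3) by simp
  moreover have "cspan B = U" using B assms complex_vs.span_subspace by blast
  ultimately show ?thesis by (auto simp: fin_dim_def)
qed

lemma is_basis_dim: "is_basis B W \<Longrightarrow> complex_vs.dim W = card B"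
  by (metis is_basis_def complex_vs.dim_span_eq_card_independent)

lemma dim_strict_mono:
  assumes "fin_dim W" "csubspace U" "U \<subset> W"
  shows "complex_vs.dim U < complex_vs.dim W"
proof -
  obtain A where A: "is_basis A U" using fin_dim_basis fin_dim_subspace assms by blast
  have "A \<subseteq> W" "complex_vs.independent A"
    using A is_basis_subset[OF A] assms(3) by (auto simp: is_basis_def)
  then obtain B where B: "A \<subseteq> B" "is_basis B W"
    using fin_dim_extend_basis'[OF assms(1) fin_dim_csubspace[OF assms(1)]] by metis
  have "A \<noteq> B" using A B assms by (auto simp: is_basis_def)
  then show ?thesis using A B is_basis_dim psubset_card_mono[of B A]
    by (metis is_basis_def psubsetI)
qed

lemma dim_mono_fin:
  assumes "fin_dim W" "csubspace U" "U \<subseteq> W"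
  shows "complex_vs.dim U \<le> complex_vs.dim W"
  using dim_strict_mono[OF assms(1,2)] assms(3) by (cases "U = W") (auto simp: psubset_eq)

lemma fin_dim_image:
  assumes "fin_dim W" "clinear f"
  shows "fin_dim (f ` W)"
proof -
  obtain B where "finite B" "W = cspan B" using assms by (auto simp: fin_dim_def)
  then have "f ` W = cspan (f ` B)" using cvs_pair.linear_span_image[OF assms(2)] by simp
  then show ?thesis using \<open>finite B\<close> by (auto simp: fin_dim_def)
qed

lemma subspace_image: "clinear f \<Longrightarrow> csubspace W \<Longrightarrow> csubspace (f ` W)"
  by (rule cvs_pair.linear_subspace_image)

lemma dim_injective_image:
  assumes "fin_dim W" "clinear f" "\<And>w. w \<in> W \<Longrightarrow> f w = 0 \<Longrightarrow> w = 0"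
  shows "complex_vs.dim (f ` W) = complex_vs.dim W"
proof -
  obtain B where B: "is_basis B W" using fin_dim_basis fin_dim_csubspace assms by blast
  have inj: "inj_on f (cspan B)"
    using B assms(3) cvs_pair.linear_inj_on_iff_eq_0[OF assms(2) complex_vs.subspace_span, of B]
    by (auto simp: is_basis_def)
  have "complex_vs.independent (f ` B)"
    using B inj cvs_pair.linear_independent_injective_image[OF assms(2)] by (auto simp: is_basis_def)
  moreover have "cspan (f ` B) = f ` W"
    using cvs_pair.linear_span_image[OF assms(2)] B by (auto simp: is_basis_def)
  ultimately have "is_basis (f ` B) (f ` W)" using B by (auto simp: is_basis_def)
  moreover have "card (f ` B) = card B"
    using inj inj_on_subset[OF _ complex_vs.span_superset] card_image by blast
  ultimately show ?thesis using B is_basis_dim by metis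
qed

lemma injective_endo_surj:
  assumes "fin_dim W" "clinear f" "f ` W \<subseteq> W" "\<And>w. w \<in> W \<Longrightarrow> f w = 0 \<Longrightarrow> w = 0"
  shows "f ` W = W"
  using dim_strict_mono[of W "f ` W"] dim_injective_image[OF assms(1,2,4)] assms
    subspace_image fin_dim_csubspace by (metis less_irrefl psubsetI)

lemma kernel_nontrivial:
  assumes "fin_dim W" "clinear f" "f ` W \<subseteq> U" "fin_dim U" "complex_vs.dim U < complex_vs.dim W"
  shows "\<exists>w\<in>W. w \<noteq> 0 \<and> f w = 0"
  using dim_injective_image[OF assms(1,2)] dim_mono_fin[OF assms(4) _ assms(3)] assms
    subspace_image fin_dim_csubspace by (metis linorder_not_less)

text \<open>If the image were all of \<open>W\<close>, the images of a basis containing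
  \<open>w\<close> would span \<open>W\<close>; the image of \<open>w\<close> is zero, and the
  others are too few.\<close>

lemma kernel_image_proper:
  assumes "fin_dim W" "clinear f" "w \<in> W" "w \<noteq> 0" "f w = 0"
  shows "f ` W \<noteq> W"
proof
  assume eq: "f ` W = W"
  have "complex_vs.independent {w}" using assms by simp
  then obtain B where B: "{w} \<subseteq> B" "is_basis B W"
    using fin_dim_extend_basis'[OF assms(1) fin_dim_csubspace[OF assms(1)]] assms by (metis empty_subsetI insert_subset)
  have "W = cspan (f ` B)"
    using eq B cvs_pair.linear_span_image[OF assms(2), of B] by (auto simp: is_basis_def)
  also have "f ` B \<subseteq> insert 0 (f ` (B - {w}))" using assms by auto
  then have "cspan (f ` B) \<subseteq> cspan (f ` (B - {w}))"
    using complex_vs.span_mono complex_vs.span_insert_0 by metis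
  finally have "complex_vs.dim W \<le> card (f ` (B - {w}))"
    using B complex_vs.dim_le_card[of W "f ` (B - {w})"] by (simp add: is_basis_def)
  also have "\<dots> \<le> card (B - {w})" using B by (intro card_image_le) (auto simp: is_basis_def)
  also have "\<dots> < card B" using B by (intro psubset_card_mono) (auto simp: is_basis_def)
  finally show False using is_basis_dim[OF B(2)] by simp
qed

section \<open>The trace\<close>

abbreviation coord :: "'a::complex_vs set \<Rightarrow> 'a \<Rightarrow> 'a \<Rightarrow> complex" where
  "coord B \<equiv> complex_vs.representation B"

lemma coord_sum_eq: "is_basis B W \<Longrightarrow> w \<in> W \<Longrightarrow> (\<Sum>b\<in>B. coord B w b *\<^sub>C b) = w"
  using complex_vs.sum_representation_eq[of B w B] by (auto simp: is_basis_def)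

lemma coord_add: "is_basis B W \<Longrightarrow> v \<in> W \<Longrightarrow> w \<in> W \<Longrightarrow> coord B (v + w) b = coord B v b + coord B w b"
  using complex_vs.representation_add[of B] by (auto simp: is_basis_def)

lemma coord_scale: "is_basis B W \<Longrightarrow> v \<in> W \<Longrightarrow> coord B (c *\<^sub>C v) b = c * coord B v b"
  using complex_vs.representation_scale[of B] by (auto simp: is_basis_def)

lemma coord_sum:
  assumes "is_basis B W" "\<And>i. i \<in> I \<Longrightarrow> v i \<in> W"
  shows "coord B (\<Sum>i\<in>I. v i) b = (\<Sum>i\<in>I. coord B (v i) b)"
  using complex_vs.representation_sum[of B I v] assms by (auto simp: is_basis_def)

lemma coord_lin_comb:
  assumes "is_basis B W" "\<And>i. i \<in> I \<Longrightarrow> v i \<in> W"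
  shows "coord B (\<Sum>i\<in>I. c i *\<^sub>C v i) b = (\<Sum>i\<in>I. c i * coord B (v i) b)"
  using assms coord_sum[OF assms(1), of I "\<lambda>i. c i *\<^sub>C v i"] complex_vs.subspace_scale[OF is_basis_subspace[OF assms(1)]]
  by (simp add: coord_scale[OF assms(1)])

lemma coord_basis: "is_basis B W \<Longrightarrow> b \<in> B \<Longrightarrow> coord B b c = (if c = b then 1 else 0)"
  using complex_vs.representation_basis[of B] by (auto simp: is_basis_def)

text \<open>Defined on subspaces rather than types, so that inductions can pass to an invariant
  subspace. The choice made by \<open>SOME\<close> is immaterial for linear maps preserving
  \<open>W\<close>, by \<open>trace_on_eq\<close>.\<close>

definition trace_on :: "'a::complex_vs set \<Rightarrow> ('a \<Rightarrow> 'a) \<Rightarrow> complex" where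
  "trace_on W f = (let B = (SOME B. is_basis B W) in \<Sum>b\<in>B. coord B (f b) b)"

lemma trace_on_eq:
  assumes B: "is_basis B W" and f: "clinear f" "f ` W \<subseteq> W"
  shows "trace_on W f = (\<Sum>b\<in>B. coord B (f b) b)"
proof -
  define C where "C = (SOME B. is_basis B W)"
  have C: "is_basis C W" unfolding C_def using B by (rule someI)
  have BW: "b \<in> W" if "b \<in> B" for b using is_basis_subset[OF B] that by blast
  have CW: "c \<in> W" if "c \<in> C" for c using is_basis_subset[OF C] that by blast
  have fW: "f w \<in> W" if "w \<in> W" for w using f that by blast
  have "(\<Sum>b\<in>B. coord B (f b) b) = (\<Sum>b\<in>B. coord B (\<Sum>c\<in>C. coord C (f b) c *\<^sub>C c) b)"
    using coord_sum_eq[OF C] fW BW by simp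
  also have "\<dots> = (\<Sum>b\<in>B. \<Sum>c\<in>C. coord C (f b) c * coord B c b)"
    by (simp add: coord_lin_comb[OF B CW])
  also have "\<dots> = (\<Sum>c\<in>C. \<Sum>b\<in>B. coord B c b * coord C (f b) c)"
    by (subst sum.swap) (simp add: mult.commute)
  also have "\<dots> = (\<Sum>c\<in>C. coord C (\<Sum>b\<in>B. coord B c b *\<^sub>C f b) c)"
    by (simp add: coord_lin_comb[OF C fW[OF BW]])
  also have "\<dots> = (\<Sum>c\<in>C. coord C (f (\<Sum>b\<in>B. coord B c b *\<^sub>C b)) c)"
    using f by (simp add: clinear_sum clinear_scale)
  also have "\<dots> = (\<Sum>c\<in>C. coord C (f c) c)"
    using coord_sum_eq[OF B] CW by simp
  finally show ?thesis by (simp add: trace_on_def C_def Let_def)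
qed

context
  fixes W :: "'a::complex_vs set"
  assumes W: "fin_dim W"
begin

lemma trace_on_commute:
  assumes f: "clinear f" "f ` W \<subseteq> W" and g: "clinear g" "g ` W \<subseteq> W"
  shows "trace_on W (\<lambda>v. f (g v)) = trace_on W (\<lambda>v. g (f v))"
proof -
  obtain B where B: "is_basis B W" using fin_dim_basis[OF W fin_dim_csubspace[OF W]] .
  have BW: "b \<in> W" if "b \<in> B" for b using is_basis_subset[OF B] that by blast
  have *: "trace_on W (\<lambda>v. f (g v)) = (\<Sum>b\<in>B. \<Sum>c\<in>B. coord B (g b) c * coord B (f c) b)"
    if f: "clinear f" "f ` W \<subseteq> W" and g: "clinear g" "g ` W \<subseteq> W" for f g
  proof -
    have "clinear (\<lambda>v. f (g v))"
      using f g by (intro clinearI) (simp_all add: clinear_add clinear_scale)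
    then have "trace_on W (\<lambda>v. f (g v)) = (\<Sum>b\<in>B. coord B (f (g b)) b)"
      using f g by (intro trace_on_eq[OF B]) auto
    also have "\<dots> = (\<Sum>b\<in>B. coord B (f (\<Sum>c\<in>B. coord B (g b) c *\<^sub>C c)) b)"
      using coord_sum_eq[OF B] BW g by (simp add: image_subset_iff)
    also have "\<dots> = (\<Sum>b\<in>B. coord B (\<Sum>c\<in>B. coord B (g b) c *\<^sub>C f c) b)"
      using f by (simp add: clinear_sum clinear_scale)
    also have "\<dots> = (\<Sum>b\<in>B. \<Sum>c\<in>B. coord B (g b) c * coord B (f c) b)"
      using coord_lin_comb[OF B, of B f] BW f(2) by (simp add: image_subset_iff)
    finally show ?thesis .
  qed
  show ?thesis
    unfolding *[OF f g] *[OF g f] by (subst sum.swap) (simp add: mult.commute)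
qed

lemma trace_on_add:
  assumes f: "clinear f" "f ` W \<subseteq> W" and g: "clinear g" "g ` W \<subseteq> W"
  shows "trace_on W (\<lambda>v. f v + g v) = trace_on W f + trace_on W g"
proof -
  obtain B where B: "is_basis B W" using fin_dim_basis[OF W fin_dim_csubspace[OF W]] .
  have BW: "f b \<in> W" "g b \<in> W" if "b \<in> B" for b using is_basis_subset[OF B] that f g by auto
  have "clinear (\<lambda>v. f v + g v)"
    using f g by (intro clinearI) (simp_all add: clinear_add clinear_scale scaleC_add_right)
  then have "trace_on W (\<lambda>v. f v + g v) = (\<Sum>b\<in>B. coord B (f b + g b) b)"
    using f g complex_vs.subspace_add[OF fin_dim_csubspace[OF W]] by (intro trace_on_eq[OF B]) auto
  then show ?thesis
    using trace_on_eq[OF B f] trace_on_eq[OF B g] BW by (simp add: coord_add[OF B] sum.distrib)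
qed

lemma trace_on_scale:
  assumes f: "clinear f" "f ` W \<subseteq> W"
  shows "trace_on W (\<lambda>v. c *\<^sub>C f v) = c * trace_on W f"
proof -
  obtain B where B: "is_basis B W" using fin_dim_basis[OF W fin_dim_csubspace[OF W]] .
  have BW: "f b \<in> W" if "b \<in> B" for b using is_basis_subset[OF B] that f by auto
  have "clinear (\<lambda>v. c *\<^sub>C f v)"
    using f by (intro clinearI) (simp_all add: clinear_add clinear_scale scaleC_add_right scaleC_scaleC mult.commute)
  then have "trace_on W (\<lambda>v. c *\<^sub>C f v) = (\<Sum>b\<in>B. coord B (c *\<^sub>C f b) b)"
    using f complex_vs.subspace_scale[OF fin_dim_csubspace[OF W]] by (intro trace_on_eq[OF B]) auto
  then show ?thesis
    using trace_on_eq[OF B f] BW by (simp add: coord_scale[OF B] sum_distrib_left)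
qed

lemma trace_on_zero: "trace_on W (\<lambda>v. 0) = 0"
  using trace_on_scale[of "\<lambda>v. 0" 0] complex_vs.subspace_0[OF fin_dim_csubspace[OF W]]
  by (auto simp: clinearI)

lemma trace_on_diff:
  assumes f: "clinear f" "f ` W \<subseteq> W" and g: "clinear g" "g ` W \<subseteq> W"
  shows "trace_on W (\<lambda>v. f v - g v) = trace_on W f - trace_on W g"
proof -
  have "clinear (\<lambda>v. (-1) *\<^sub>C g v)"
    using g by (intro clinearI) (simp_all add: clinear_add clinear_scale scaleC_add_right scaleC_scaleC)
  moreover have "(\<lambda>v. (-1) *\<^sub>C g v) ` W \<subseteq> W"
    using g complex_vs.subspace_scale[OF fin_dim_csubspace[OF W]] by blast
  ultimately have "trace_on W (\<lambda>v. f v + (-1) *\<^sub>C g v) = trace_on W f + - 1 * trace_on W g"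
    using trace_on_add[OF f, of "\<lambda>v. (-1) *\<^sub>C g v"] trace_on_scale[OF g, of "-1"] by simp
  then show ?thesis by simp
qed

lemma trace_on_sum:
  assumes "finite I" "\<And>i. i \<in> I \<Longrightarrow> clinear (f i)" "\<And>i. i \<in> I \<Longrightarrow> f i ` W \<subseteq> W"
  shows "trace_on W (\<lambda>v. \<Sum>i\<in>I. f i v) = (\<Sum>i\<in>I. trace_on W (f i))"
  using assms
proof (induction I)
  case empty
  then show ?case by (simp add: trace_on_zero)
next
  case (insert x I)
  have "clinear (\<lambda>v. \<Sum>i\<in>I. f i v)"
    using insert by (intro clinearI) (simp_all add: clinear_add clinear_scale complex_vs.scale_sum_right sum.distrib)
  moreover have "f i w \<in> W" if "i \<in> I" "w \<in> W" for i w
    using insert.prems(2)[of i] that by auto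
  then have "(\<lambda>v. \<Sum>i\<in>I. f i v) ` W \<subseteq> W"
    by (auto intro!: complex_vs.subspace_sum[OF fin_dim_csubspace[OF W]])
  ultimately show ?case using insert by (simp add: trace_on_add)
qed

end

lemma trace_on_cong:
  assumes "fin_dim W" "\<And>w. w \<in> W \<Longrightarrow> f w = g w"
  shows "trace_on W f = trace_on W g"
proof -
  have "is_basis (SOME B. is_basis B W) W"
    using fin_dim_basis[OF assms(1) fin_dim_csubspace[OF assms(1)]] someI by metis
  from is_basis_subset[OF this] show ?thesis using assms(2)
    by (auto simp: trace_on_def Let_def intro!: sum.cong)
qed

text \<open>In a basis of \<open>W\<close> extending one of \<open>U\<close>, the added vectors
  contribute no diagonal entry, because their images lie in \<open>U\<close>.\<close>

lemma trace_on_image: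
  assumes W: "fin_dim W" and U: "csubspace U" "U \<subseteq> W" and f: "clinear f" "f ` W \<subseteq> U"
  shows "trace_on W f = trace_on U f"
proof -
  obtain A where A: "is_basis A U" using fin_dim_basis fin_dim_subspace assms by blast
  have "A \<subseteq> W" "complex_vs.independent A"
    using A is_basis_subset[OF A] U by (auto simp: is_basis_def)
  then obtain B where B: "A \<subseteq> B" "is_basis B W"
    using fin_dim_extend_basis'[OF W fin_dim_csubspace[OF W]] by metis
  have fU: "f b \<in> cspan A" if "b \<in> B" for b
    using f A is_basis_subset[OF B(2)] that by (auto simp: is_basis_def)
  have ind: "complex_vs.independent B" using B by (auto simp: is_basis_def)
  have "trace_on W f = (\<Sum>b\<in>B. coord B (f b) b)"
    using trace_on_eq[OF B(2) f(1)] f U by blast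
  also have "\<dots> = (\<Sum>b\<in>B. coord A (f b) b)"
    using complex_vs.representation_extend[OF ind fU B(1)] by simp
  also have "\<dots> = (\<Sum>b\<in>A. coord A (f b) b)"
    using B(1) is_basis_def[of B W] B(2)
    by (intro sum.mono_neutral_right) (auto dest: complex_vs.representation_ne_zero)
  also have "\<dots> = trace_on U f"
    using trace_on_eq[OF A f(1)] f U by (metis image_mono order_trans)
  finally show ?thesis .
qed

lemma funpow_clinear: "clinear f \<Longrightarrow> clinear (f ^^ n)" for f :: "'a::complex_vs \<Rightarrow> 'a"
  by (induction n) (auto intro!: clinearI simp: clinear_add clinear_scale)

lemma funpow_zero_mono: "(f ^^ m) w = 0 \<Longrightarrow> clinear f \<Longrightarrow> m \<le> n \<Longrightarrow> (f ^^ n) w = 0"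
  for f :: "'a::complex_vs \<Rightarrow> 'a"
  using funpow_add[of "n - m" m f] by (simp add: clinear_0 funpow_clinear)

lemma funpow_invariant: "f ` W \<subseteq> W \<Longrightarrow> w \<in> W \<Longrightarrow> (f ^^ n) w \<in> W"
  by (induction n) auto

text \<open>A nilpotent map shrinks a nonzero space, and by \<open>trace_on_image\<close> its trace
  can be computed on the image; induction on the dimension does the rest.\<close>

lemma trace_on_nilpotent:
  assumes "fin_dim W" "clinear f" "f ` W \<subseteq> W" "\<And>w. w \<in> W \<Longrightarrow> \<exists>n. (f ^^ n) w = 0"
  shows "trace_on W f = 0"
  using assms
proof (induction "complex_vs.dim W" arbitrary: W rule: less_induct)
  case less
  show ?case
  proof (cases "W = {0}")
    case True
    then have "is_basis {} W" by (simp add: is_basis_def)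
    then show ?thesis using less.prems by (simp add: trace_on_eq)
  next
    case False
    then obtain w where w: "w \<in> W" "w \<noteq> 0"
      using complex_vs.subspace_0[OF fin_dim_csubspace] less.prems by blast
    \<comment> \<open>\<open>n\<close> is positive since \<open>w\<close> is nonzero, so the power
      before it sends \<open>w\<close> to a nonzero vector of the kernel.\<close>
    define n where "n = (LEAST n. (f ^^ n) w = 0)"
    have n: "(f ^^ n) w = 0" unfolding n_def using less.prems(4)[OF w(1)] by (rule LeastI_ex)
    have n0: "n \<noteq> 0" using w n by (intro notI) simp
    have "(f ^^ (n - 1)) w \<noteq> 0"
      unfolding n_def by (rule not_less_Least) (use n0 n_def in auto)
    moreover have "f ((f ^^ (n - 1)) w) = 0" using n n0 by (cases n) auto
    moreover have "(f ^^ (n - 1)) w \<in> W" using less.prems w funpow_invariant by metis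
    ultimately have "f ` W \<subset> W" using kernel_image_proper less.prems by blast
    moreover have "csubspace (f ` W)" using subspace_image less.prems fin_dim_csubspace by blast
    ultimately have "complex_vs.dim (f ` W) < complex_vs.dim W" "fin_dim (f ` W)"
      using dim_strict_mono[OF less.prems(1), of "f ` W"] fin_dim_image[OF less.prems(1,2)] by blast+
    then have "trace_on (f ` W) f = 0" using less.prems by (intro less.hyps) auto
    then show ?thesis using trace_on_image[of W "f ` W" f] less.prems \<open>csubspace (f ` W)\<close> by simp
  qed
qed

section \<open>Generalized eigenspaces\<close>

abbreviation shift :: "('a::complex_vs \<Rightarrow> 'a) \<Rightarrow> complex \<Rightarrow> 'a \<Rightarrow> 'a" where
  "shift T \<mu> \<equiv> (\<lambda>v. T v - \<mu> *\<^sub>C v)"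

definition geig :: "'a::complex_vs set \<Rightarrow> ('a \<Rightarrow> 'a) \<Rightarrow> complex \<Rightarrow> 'a set" where
  "geig W T \<mu> = {w \<in> W. \<exists>n. (shift T \<mu> ^^ n) w = 0}"

lemma clinear_shift: "clinear T \<Longrightarrow> clinear (shift T \<mu>)"
  by (rule clinearI)
    (simp_all add: clinear_add clinear_scale scaleC_add_right scaleC_scaleC complex_vs.scale_right_diff_distrib mult.commute)

lemma funpow_commute:
  fixes f :: "'a \<Rightarrow> 'a"
  shows "(\<And>v. S (f v) = f (S v)) \<Longrightarrow> S ((f ^^ n) v) = (f ^^ n) (S v)"
  by (induction n) auto

lemma nilpotent_vectors_subspace:
  fixes N :: "'a::complex_vs \<Rightarrow> 'a"
  assumes "clinear N"
  shows "csubspace {w. \<exists>n. (N ^^ n) w = 0}"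
proof (rule complex_vs.subspaceI)
  have "(N ^^ 0) 0 = 0" by simp
  then show "0 \<in> {w. \<exists>n. (N ^^ n) w = 0}" by blast
  fix x y assume "x \<in> {w. \<exists>n. (N ^^ n) w = 0}" "y \<in> {w. \<exists>n. (N ^^ n) w = 0}"
  then obtain m n where "(N ^^ m) x = 0" "(N ^^ n) y = 0" by auto
  then have "(N ^^ (max m n)) (x + y) = 0"
    using funpow_zero_mono[OF _ assms, of _ x "max m n"] funpow_zero_mono[OF _ assms, of _ y "max m n"]
    by (simp add: clinear_add funpow_clinear assms)
  then show "x + y \<in> {w. \<exists>n. (N ^^ n) w = 0}" by blast
next
  fix c x assume "x \<in> {w. \<exists>n. (N ^^ n) w = 0}"
  then obtain n where "(N ^^ n) x = 0" by auto
  then have "(N ^^ n) (c *\<^sub>C x) = 0" by (simp add: clinear_scale funpow_clinear assms)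
  then show "c *\<^sub>C x \<in> {w. \<exists>n. (N ^^ n) w = 0}" by blast
qed

text \<open>Coefficients are indexed by \<open>A\<close> and not by the image, since
  \<open>f\<close> may repeat values, as powers of an operator on a vector can.\<close>

lemma span_indexed:
  assumes "finite A" "x \<in> cspan (f ` A)"
  shows "\<exists>c. x = (\<Sum>a\<in>A. c a *\<^sub>C f a)"
  using assms
proof (induction A arbitrary: x)
  case empty
  then show ?case by simp
next
  case (insert a A)
  then obtain k where "x - k *\<^sub>C f a \<in> cspan (f ` A)"
    by (auto simp: complex_vs.span_breakdown_eq)
  then obtain c where c: "x - k *\<^sub>C f a = (\<Sum>a\<in>A. c a *\<^sub>C f a)" using insert by blast
  have "x = (\<Sum>b\<in>insert a A. (c(a := k)) b *\<^sub>C f b)"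
  proof -
    have "(\<Sum>b\<in>A. (c(a := k)) b *\<^sub>C f b) = (\<Sum>b\<in>A. c b *\<^sub>C f b)"
      using insert(2) by (intro sum.cong) auto
    then show ?thesis using insert(1,2) c by (simp add: diff_eq_eq add.commute)
  qed
  then show ?case by blast
qed

section \<open>Annihilating polynomials of a vector\<close>

definition poly_op :: "complex poly \<Rightarrow> ('a::complex_vs \<Rightarrow> 'a) \<Rightarrow> 'a \<Rightarrow> 'a" where
  "poly_op p T w = (\<Sum>k\<le>degree p. coeff p k *\<^sub>C (T ^^ k) w)"

lemma poly_op_altdef: "degree p \<le> n \<Longrightarrow> poly_op p T w = (\<Sum>k\<le>n. coeff p k *\<^sub>C (T ^^ k) w)"
  unfolding poly_op_def by (rule sum.mono_neutral_left) (auto simp: coeff_eq_0)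

text \<open>The linear factor acts first: splitting off a root replaces \<open>w\<close> by its
  shift, which is the descent used in \<open>span_geig\<close>.\<close>

lemma poly_op_linear_factor:
  assumes T: "clinear T"
  shows "poly_op ([:-\<mu>, 1:] * q) T w = poly_op q T (T w - \<mu> *\<^sub>C w)"
proof -
  define n where "n = degree q"
  have d: "degree ([:-\<mu>, 1:] * q) \<le> Suc n"
    using degree_mult_le[of "[:-\<mu>, 1:]" q] by (simp add: n_def)
  have c: "coeff ([:-\<mu>, 1:] * q) k = (if k = 0 then 0 else coeff q (k - 1)) - \<mu> * coeff q k" for k
    by (cases k) auto
  have "poly_op ([:-\<mu>, 1:] * q) T w = (\<Sum>k\<le>Suc n. (if k = 0 then 0 else coeff q (k - 1)) *\<^sub>C (T ^^ k) w)
      - (\<Sum>k\<le>Suc n. (\<mu> * coeff q k) *\<^sub>C (T ^^ k) w)"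
    unfolding poly_op_altdef[OF d] c complex_vs.scale_left_diff_distrib sum_subtractf ..
  also have "(\<Sum>k\<le>Suc n. (if k = 0 then 0 else coeff q (k - 1)) *\<^sub>C (T ^^ k) w)
      = (\<Sum>k\<le>n. coeff q k *\<^sub>C (T ^^ k) (T w))"
    by (subst sum.atMost_Suc_shift) (simp add: funpow_swap1)
  also have "(\<Sum>k\<le>Suc n. (\<mu> * coeff q k) *\<^sub>C (T ^^ k) w) = (\<Sum>k\<le>n. coeff q k *\<^sub>C (T ^^ k) (\<mu> *\<^sub>C w))"
    using T by (simp add: n_def coeff_eq_0 clinear_scale[OF funpow_clinear] scaleC_scaleC mult.commute)
  finally show ?thesis
    using T by (simp add: poly_op_altdef[of q n] n_def clinear_diff[OF funpow_clinear]
        complex_vs.scale_right_diff_distrib sum_subtractf)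
qed

text \<open>The vectors obtained from \<open>w\<close> by powers of \<open>T\<close> cannot stay
  independent in finite dimension. An annihilator of the single vector \<open>w\<close> is what the
  induction in \<open>span_geig\<close> consumes.\<close>

lemma ex_annihilating_poly:
  assumes W: "fin_dim W" and T: "T ` W \<subseteq> W" and w: "w \<in> W"
  shows "\<exists>p. p \<noteq> 0 \<and> poly_op p T w = 0"
proof -
  define E where "E m = (\<lambda>k. (T ^^ k) w) ` {..<m}" for m
  have EW: "E m \<subseteq> W" for m using funpow_invariant[OF T w] by (auto simp: E_def)
  have "\<exists>m. (T ^^ m) w \<in> cspan (E m)"
  proof (rule ccontr)
    assume *: "\<not> ?thesis"
    have "complex_vs.independent (E m) \<and> card (E m) = m" for m
    proof (induction m)
      case 0
      then show ?case by (simp add: E_def)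
    next
      case (Suc m)
      have "E (Suc m) = insert ((T ^^ m) w) (E m)" by (auto simp: E_def less_Suc_eq)
      moreover have "(T ^^ m) w \<notin> E m" using * complex_vs.span_base by blast
      moreover have "finite (E m)" by (simp add: E_def)
      ultimately show ?case using Suc * complex_vs.independent_insertI by auto
    qed
    moreover obtain B where "finite B" "W = cspan B" using W by (auto simp: fin_dim_def)
    ultimately show False
      using complex_vs.independent_span_bound[of B "E (Suc (card B))"] EW by fastforce
  qed
  then obtain m where m: "(T ^^ m) w \<in> cspan (E m)" by blast
  then obtain c where c: "(T ^^ m) w = (\<Sum>k<m. c k *\<^sub>C (T ^^ k) w)"
    using span_indexed[of "{..<m}" "(T ^^ m) w" "\<lambda>k. (T ^^ k) w"] by (auto simp: E_def)
  \<comment> \<open>The monic polynomial of the dependence; its coefficient 1 at \<open>m\<close>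
    makes it nonzero, also when \<open>m\<close> is 0.\<close>
  define p where "p = monom 1 m - (\<Sum>k<m. monom (c k) k)"
  have cf: "coeff p k = (if k = m then 1 else if k < m then - c k else 0)" for k
    by (simp add: p_def coeff_sum)
  have "degree p \<le> m" by (rule degree_le) (simp add: cf)
  then have "poly_op p T w = (\<Sum>k\<le>m. coeff p k *\<^sub>C (T ^^ k) w)" by (rule poly_op_altdef)
  also have "\<dots> = (\<Sum>k<m. coeff p k *\<^sub>C (T ^^ k) w) + coeff p m *\<^sub>C (T ^^ m) w"
    by (simp add: lessThan_Suc_atMost[symmetric])
  also have "\<dots> = 0" by (simp add: cf c scaleC_one sum_negf)
  finally have "poly_op p T w = 0" .
  moreover have "p \<noteq> 0" using cf[of m] by auto
  ultimately show ?thesis by blast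
qed

context
  fixes W :: "'a::complex_vs set" and T :: "'a \<Rightarrow> 'a"
  assumes W: "fin_dim W" and T: "clinear T" and TW: "T ` W \<subseteq> W"
begin

lemma geig_subspace: "csubspace (geig W T \<mu>)"
  using complex_vs.subspace_inter[OF fin_dim_csubspace[OF W] nilpotent_vectors_subspace[OF clinear_shift[OF T]]]
  by (simp add: geig_def Int_def)

lemma geig_subset: "geig W T \<mu> \<subseteq> W"
  by (auto simp: geig_def)

lemma shift_invariant: "w \<in> W \<Longrightarrow> shift T \<mu> w \<in> W"
  using TW complex_vs.subspace_diff complex_vs.subspace_scale fin_dim_csubspace[OF W] by blast

lemma geig_commute:
  assumes "w \<in> geig W T \<mu>" "clinear S" "S w \<in> W" "\<And>v. S (T v) = T (S v)"
  shows "S w \<in> geig W T \<mu>"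
proof -
  obtain n where n: "(shift T \<mu> ^^ n) w = 0" using assms by (auto simp: geig_def)
  have "S (shift T \<mu> v) = shift T \<mu> (S v)" for v
    using assms by (simp add: clinear_diff clinear_scale)
  then have "(shift T \<mu> ^^ n) (S w) = S ((shift T \<mu> ^^ n) w)"
    by (rule funpow_commute[symmetric])
  then show ?thesis using assms n by (auto simp: geig_def clinear_0)
qed

lemma geig_shift: "w \<in> geig W T \<nu> \<Longrightarrow> shift T \<mu> w \<in> geig W T \<nu>"
  using geig_subset by (intro geig_commute[OF _ clinear_shift[OF T]] shift_invariant)
    (auto simp: clinear_diff[OF T] clinear_scale[OF T])

text \<open>On \<open>geig W T \<nu>\<close> the operator \<open>shift T \<mu>\<close> is a nonzero
  scalar plus a nilpotent map. The inverse is built by induction on the exponent that kills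
  \<open>w\<close>.\<close>

lemma geig_shift_surj:
  assumes "\<mu> \<noteq> \<nu>" "w \<in> geig W T \<nu>"
  shows "\<exists>u\<in>geig W T \<nu>. shift T \<mu> u = w"
proof -
  obtain n where "(shift T \<nu> ^^ n) w = 0" using assms by (auto simp: geig_def)
  then show ?thesis using assms(2)
  proof (induction n arbitrary: w)
    case 0
    then show ?case using complex_vs.subspace_0[OF geig_subspace] T by (auto simp: clinear_0 intro!: bexI[of _ 0])
  next
    case (Suc n)
    let ?w = "shift T \<nu> w"
    have "(shift T \<nu> ^^ n) ?w = 0" using Suc.prems by (simp add: funpow_Suc_right del: funpow.simps)
    moreover have "?w \<in> geig W T \<nu>" using Suc geig_shift by blast
    ultimately obtain u where u: "u \<in> geig W T \<nu>" "shift T \<mu> u = ?w" using Suc.IH by blast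
    \<comment> \<open>Since \<open>u\<close> solves the equation for \<open>shift T \<nu> w\<close>,
      applying \<open>shift T \<mu>\<close> to \<open>w - u\<close> leaves
      \<open>(\<nu> - \<mu>) *\<^sub>C w\<close>.\<close>
    define z where "z = inverse (\<nu> - \<mu>) *\<^sub>C (w - u)"
    have "z \<in> geig W T \<nu>"
      unfolding z_def using u Suc.prems geig_subspace complex_vs.subspace_scale complex_vs.subspace_diff by blast
    moreover have "shift T \<mu> z = w"
    proof -
      have "shift T \<mu> (w - u) = shift T \<mu> w - shift T \<mu> u" by (rule clinear_diff[OF clinear_shift[OF T]])
      also have "\<dots> = (\<nu> - \<mu>) *\<^sub>C w" using u(2) by (simp add: complex_vs.scale_left_diff_distrib)
      finally have "shift T \<mu> (w - u) = (\<nu> - \<mu>) *\<^sub>C w" .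
      then show ?thesis
        unfolding z_def using clinear_scale[OF clinear_shift[OF T, of \<mu>], of "inverse (\<nu> - \<mu>)" "w - u"] assms(1)
        by (simp add: scaleC_scaleC scaleC_one)
    qed
    ultimately show ?case by blast
  qed
qed

text \<open>An honest eigenvector for \<mu> is multiplied by \<mu> - \<nu> under each
  \<open>shift T \<nu>\<close>, so no power can kill it unless it is zero.\<close>

lemma geig_shift_inj:
  assumes "\<mu> \<noteq> \<nu>" "w \<in> geig W T \<nu>" "shift T \<mu> w = 0"
  shows "w = 0"
proof -
  have "(shift T \<nu> ^^ n) w = (\<mu> - \<nu>) ^ n *\<^sub>C w" for n
  proof (induction n)
    case 0
    then show ?case by (simp add: scaleC_one)
  next
    case (Suc n)
    have Tw: "T w = \<mu> *\<^sub>C w" using assms by simp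
    have "(shift T \<nu> ^^ Suc n) w = shift T \<nu> ((\<mu> - \<nu>) ^ n *\<^sub>C w)" using Suc by simp
    also have "\<dots> = ((\<mu> - \<nu>) ^ n * \<mu>) *\<^sub>C w - (\<nu> * (\<mu> - \<nu>) ^ n) *\<^sub>C w"
      by (simp add: clinear_scale[OF T] Tw scaleC_scaleC)
    also have "\<dots> = (\<mu> - \<nu>) ^ Suc n *\<^sub>C w"
      by (simp add: algebra_simps flip: complex_vs.scale_left_diff_distrib)
    finally show ?case .
  qed
  then show ?thesis using assms(1,2) by (auto simp: geig_def)
qed

text \<open>A power of \<open>shift T \<mu>\<close> removes the summand for \<mu>; the induction
  hypothesis applies to the remaining images, and this power is injective on the other
  eigenspaces.\<close>

lemma geig_sum_zero:
  assumes "finite F" "\<And>\<nu>. \<nu> \<in> F \<Longrightarrow> w \<nu> \<in> geig W T \<nu>" "(\<Sum>\<nu>\<in>F. w \<nu>) = 0" "\<nu> \<in> F"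
  shows "w \<nu> = 0"
  using assms
proof (induction F arbitrary: w \<nu>)
  case empty
  then show ?case by simp
next
  case (insert \<mu> F)
  obtain n where n: "(shift T \<mu> ^^ n) (w \<mu>) = 0" using insert.prems by (auto simp: geig_def)
  note lin = funpow_clinear[OF clinear_shift[OF T]]
  have "(shift T \<mu> ^^ n) (\<Sum>\<nu>\<in>insert \<mu> F. w \<nu>) = 0" using insert.prems clinear_0[OF lin] by simp
  then have "(\<Sum>\<nu>\<in>F. (shift T \<mu> ^^ n) (w \<nu>)) = 0"
    using insert.hyps n clinear_add[OF lin, of n \<mu> "w \<mu>"] by (simp add: clinear_sum[OF lin])
  moreover have "(shift T \<mu> ^^ k) v \<in> geig W T \<nu>" if "v \<in> geig W T \<nu>" for k v \<nu>
    using that by (induction k) (auto intro: geig_shift)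
  ultimately have z: "(shift T \<mu> ^^ n) (w \<nu>) = 0" if "\<nu> \<in> F" for \<nu>
    using insert.IH[of "\<lambda>\<nu>. (shift T \<mu> ^^ n) (w \<nu>)"] insert.prems that by blast
  have inj: "v = 0" if "v \<in> geig W T \<nu>" "\<mu> \<noteq> \<nu>" "(shift T \<mu> ^^ k) v = 0" for k v \<nu>
    using that
  proof (induction k arbitrary: v)
    case (Suc k)
    then have "shift T \<mu> v = 0" using geig_shift[of v \<nu> \<mu>] Suc.IH[of "shift T \<mu> v"]
      by (simp add: funpow_Suc_right del: funpow.simps)
    then show ?case using Suc geig_shift_inj by blast
  qed simp
  have "w \<nu> = 0" if "\<nu> \<in> F" for \<nu>
    using inj[OF _ _ z[OF that]] insert.prems insert.hyps that by blast
  then show ?case using insert by auto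
qed

text \<open>Induction on the degree of a polynomial annihilating \<open>w\<close>. A root \<mu>
  exists over the complex numbers, and \<open>shift T \<mu> w\<close> is annihilated by the
  quotient, hence already in the span; it remains to undo the shift.\<close>

lemma span_geig: "W = cspan (\<Union>\<mu>. geig W T \<mu>)"
proof
  let ?X = "cspan (\<Union>\<mu>. geig W T \<mu>)"
  show "?X \<subseteq> W" by (rule complex_vs.span_minimal) (use geig_subset fin_dim_csubspace[OF W] in auto)
  have "w \<in> ?X" if "p \<noteq> 0" "poly_op p T w = 0" "w \<in> W" for p w
    using that
  proof (induction "degree p" arbitrary: p w)
    case 0
    then have "coeff p 0 \<noteq> 0" by (metis leading_coeff_0_iff)
    then have "w = 0" using 0 by (simp add: poly_op_def)
    then show ?case using complex_vs.span_zero by simp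
  next
    case (Suc d)
    then obtain \<mu> where "poly p \<mu> = 0"
      using fundamental_theorem_of_algebra[of p] constant_degree[of p] by auto
    then obtain q where q: "p = [:-\<mu>, 1:] * q" by (auto simp: poly_eq_0_iff_dvd dvd_def)
    have q0: "q \<noteq> 0" using q Suc by auto
    then have "degree p = Suc (degree q)" using degree_mult_eq[of "[:-\<mu>, 1:]" q] q by simp
    then have "shift T \<mu> w \<in> ?X"
      using Suc q q0 poly_op_linear_factor[OF T, of \<mu> q w] shift_invariant by auto
    \<comment> \<open>The shift is onto on the eigenspaces for other eigenvalues, and vectors of
      \<open>geig W T \<mu>\<close> are left as they are, with \<open>u = 0\<close>. For
      \<open>v = shift T \<mu> w\<close> this places \<open>w - u\<close> in
      \<open>geig W T \<mu>\<close>.\<close>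
    moreover have "\<exists>u\<in>?X. v - shift T \<mu> u \<in> geig W T \<mu>" if "v \<in> ?X" for v
      using that
    proof (induction rule: complex_vs.span_induct_alt)
      case base
      show ?case using complex_vs.span_zero complex_vs.subspace_0[OF geig_subspace]
        by (auto simp: clinear_0[OF T] intro!: bexI[of _ 0])
    next
      case (step c x y)
      then obtain u where u: "u \<in> ?X" "y - shift T \<mu> u \<in> geig W T \<mu>" by blast
      obtain \<nu> where \<nu>: "x \<in> geig W T \<nu>" using step by blast
      have "\<exists>z\<in>?X. x - shift T \<mu> z \<in> geig W T \<mu>"
      proof (cases "\<nu> = \<mu>")
        case True
        then show ?thesis using \<nu> complex_vs.span_zero by (auto simp: clinear_0[OF T] intro!: bexI[of _ 0])
      next
        case False
        then obtain z where "z \<in> geig W T \<nu>" "shift T \<mu> z = x" using geig_shift_surj[of \<mu> \<nu> x] \<nu> by auto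
        then show ?thesis using complex_vs.subspace_0[OF geig_subspace] complex_vs.span_base
          by (metis UN_I UNIV_I cancel_comm_monoid_add_class.diff_cancel)
      qed
      then obtain z where z: "z \<in> ?X" "x - shift T \<mu> z \<in> geig W T \<mu>" by blast
      have "c *\<^sub>C x + y - shift T \<mu> (c *\<^sub>C z + u) = c *\<^sub>C (x - shift T \<mu> z) + (y - shift T \<mu> u)"
        by (simp add: clinear_add[OF T] clinear_scale[OF T] scaleC_add_right complex_vs.scale_right_diff_distrib
            scaleC_scaleC mult.commute)
      then have "c *\<^sub>C x + y - shift T \<mu> (c *\<^sub>C z + u) \<in> geig W T \<mu>"
        using z u geig_subspace complex_vs.subspace_add complex_vs.subspace_scale by metis
      moreover have "c *\<^sub>C z + u \<in> ?X" using z u complex_vs.span_add complex_vs.span_scale by blast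
      ultimately show ?case by blast
    qed
    ultimately obtain u where u: "u \<in> ?X" "shift T \<mu> w - shift T \<mu> u \<in> geig W T \<mu>" by blast
    have "?X \<subseteq> W" by fact
    then have uW: "w - u \<in> W" using u Suc complex_vs.subspace_diff[OF fin_dim_csubspace[OF W]] by blast
    have "shift T \<mu> (w - u) \<in> geig W T \<mu>"
      using u(2) clinear_diff[OF clinear_shift[OF T, of \<mu>], of w u] by simp
    then obtain n where "(shift T \<mu> ^^ n) (shift T \<mu> (w - u)) = 0" by (auto simp: geig_def)
    then have "(shift T \<mu> ^^ Suc n) (w - u) = 0" by (simp add: funpow_Suc_right del: funpow.simps)
    then have "w - u \<in> geig W T \<mu>" using uW by (auto simp: geig_def simp del: funpow.simps)
    then have "w - u \<in> ?X" using complex_vs.span_base by blast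
    then show ?case using u complex_vs.span_add[of "w - u" _ u] by simp
  qed
  then show "W \<subseteq> ?X" using ex_annihilating_poly[OF W TW] by blast
qed

lemma geig_basis:
  obtains B \<epsilon> where "is_basis B W" "\<And>b. b \<in> B \<Longrightarrow> b \<in> geig W T (\<epsilon> b)"
proof -
  have "(\<Union>\<mu>. geig W T \<mu>) \<subseteq> W" using geig_subset by blast
  then obtain B where B: "B \<subseteq> (\<Union>\<mu>. geig W T \<mu>)" "is_basis B W"
    using fin_dim_extend_basis[OF W fin_dim_csubspace[OF W] complex_vs.independent_empty empty_subsetI empty_subsetI _
        span_geig[symmetric]] by metis
  then have "\<forall>b. \<exists>\<mu>. b \<in> B \<longrightarrow> b \<in> geig W T \<mu>" by blast
  then obtain \<epsilon> where "\<And>b. b \<in> B \<Longrightarrow> b \<in> geig W T (\<epsilon> b)" by metis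
  then show ?thesis using that B by blast
qed

text \<open>Grouping the expansion of \<open>w\<close> by eigenvalue and subtracting
  \<open>w\<close> from the group of \<mu> gives a vanishing sum of generalized eigenvectors, so
  every other group is zero.\<close>

lemma geig_expand:
  assumes B: "is_basis B W" "\<And>b. b \<in> B \<Longrightarrow> b \<in> geig W T (\<epsilon> b)" and w: "w \<in> geig W T \<mu>" and b: "b \<in> B"
    and c: "coord B w b \<noteq> 0"
  shows "\<epsilon> b = \<mu>"
proof -
  have fin: "finite B" using B by (auto simp: is_basis_def)
  have wW: "w \<in> W" using w geig_subset by blast
  define F where "F = insert \<mu> (\<epsilon> ` B)"
  have finF: "finite F" using fin by (simp add: F_def)
  define u where "u \<nu> = (\<Sum>b\<in>{b\<in>B. \<epsilon> b = \<nu>}. coord B w b *\<^sub>C b)" for \<nu>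
  have uW: "u \<nu> \<in> geig W T \<nu>" for \<nu>
    unfolding u_def using B geig_subspace
    by (intro complex_vs.subspace_sum) (auto intro: complex_vs.subspace_scale)
  define z where "z \<nu> = u \<nu> - (if \<nu> = \<mu> then w else 0)" for \<nu>
  have "(\<Sum>\<nu>\<in>F. u \<nu>) = (\<Sum>b\<in>B. coord B w b *\<^sub>C b)"
    unfolding u_def by (rule sum.group[OF fin finF]) (auto simp: F_def)
  then have "(\<Sum>\<nu>\<in>F. z \<nu>) = 0"
    using coord_sum_eq[OF B(1) wW] finF by (simp add: z_def sum_subtractf F_def)
  moreover have "z \<nu> \<in> geig W T \<nu>" for \<nu>
    using uW w by (auto simp: z_def intro!: complex_vs.subspace_diff[OF geig_subspace])
  ultimately have z0: "z \<nu> = 0" if "\<nu> \<in> F" for \<nu> using geig_sum_zero[OF finF _ _ that, of z] by blast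
  show ?thesis
  proof (rule ccontr)
    assume ne: "\<epsilon> b \<noteq> \<mu>"
    then have "u (\<epsilon> b) = 0" using z0[of "\<epsilon> b"] b by (simp add: z_def F_def)
    then have "coord B w b = 0"
      using complex_vs.independentD[of B "{b'\<in>B. \<epsilon> b' = \<epsilon> b}" "coord B w" b] b B(1) fin
      by (auto simp: is_basis_def u_def)
    then show False using c by simp
  qed
qed

lemma geig_disjoint:
  assumes "w \<in> geig W T \<mu>" "w \<in> geig W T \<nu>" "\<mu> \<noteq> \<nu>"
  shows "w = 0"
proof -
  have "(if \<kappa> = \<mu> then w else - w) \<in> geig W T \<kappa>" if "\<kappa> \<in> {\<mu>, \<nu>}" for \<kappa>
    using that assms complex_vs.subspace_neg[OF geig_subspace] by auto
  then have "(if \<mu> = \<mu> then w else - w) = 0"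
    using assms(3) by (intro geig_sum_zero[of "{\<mu>, \<nu>}" "\<lambda>\<kappa>. if \<kappa> = \<mu> then w else - w" \<mu>]) auto
  then show ?thesis by simp
qed

text \<open>The space \<open>?X\<close> of vectors whose coordinates of eigenvalue 0 vanish contains
  all other eigenspaces, whereas \<open>w\<close> has only coordinates of eigenvalue 0.\<close>

lemma geig_0_complement:
  assumes "w \<in> geig W T 0" "w \<in> cspan (\<Union>\<nu>\<in>-{0}. geig W T \<nu>)"
  shows "w = 0"
proof -
  obtain B \<epsilon> where B: "is_basis B W" "\<And>b. b \<in> B \<Longrightarrow> b \<in> geig W T (\<epsilon> b)" using geig_basis by metis
  let ?X = "{v \<in> W. \<forall>b\<in>B. coord B v b \<noteq> 0 \<longrightarrow> \<epsilon> b \<noteq> 0}"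
  have wW: "w \<in> W" using assms geig_subset by blast
  have "csubspace ?X"
    using fin_dim_csubspace[OF W] B(1)
    by (intro complex_vs.subspaceI)
      (auto simp: csubspace_simps coord_add[OF B(1)] coord_scale[OF B(1)] complex_vs.representation_zero)
  moreover have "(\<Union>\<nu>\<in>-{0}. geig W T \<nu>) \<subseteq> ?X"
    using geig_expand[OF B] geig_subset by blast
  ultimately have "w \<in> ?X" using assms(2) complex_vs.span_minimal by blast
  then have "coord B w b = 0" if "b \<in> B" for b using geig_expand[OF B assms(1) that] that by auto
  then have "(\<Sum>b\<in>B. coord B w b *\<^sub>C b) = 0" by simp
  then show ?thesis using coord_sum_eq[OF B(1) wW] by simp
qed

text \<open>This is \<phi> applied to the semisimple part of \<open>T\<close>, defined directly on
  an eigenbasis, so that \<phi> need not be a polynomial. Cartan's criterion uses complex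
  conjugation and the squared absolute value.\<close>

lemma geig_operator:
  assumes B: "is_basis B W" "\<And>b. b \<in> B \<Longrightarrow> b \<in> geig W T (\<epsilon> b)"
  obtains S where "clinear S" "S ` W \<subseteq> W" "\<And>\<mu> w. w \<in> geig W T \<mu> \<Longrightarrow> S w = \<phi> \<mu> *\<^sub>C w"
    "trace_on W S = (\<Sum>b\<in>B. \<phi> (\<epsilon> b))"
proof -
  have ind: "complex_vs.independent B" and fin: "finite B" using B by (auto simp: is_basis_def)
  define S where "S = cvs_pair.construct B (\<lambda>b. \<phi> (\<epsilon> b) *\<^sub>C b)"
  have S: "clinear S" unfolding S_def by (rule cvs_pair.linear_construct[OF ind])
  have Sb: "S b = \<phi> (\<epsilon> b) *\<^sub>C b" if "b \<in> B" for b
    unfolding S_def by (rule cvs_pair.construct_basis[OF ind that])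
  have exp: "S w = (\<Sum>b\<in>B. (coord B w b * \<phi> (\<epsilon> b)) *\<^sub>C b)" if "w \<in> W" for w
  proof -
    have "S w = S (\<Sum>b\<in>B. coord B w b *\<^sub>C b)" using coord_sum_eq[OF B(1) that] by simp
    then show ?thesis using Sb by (simp add: clinear_sum[OF S] clinear_scale[OF S] scaleC_scaleC)
  qed
  have SW: "S ` W \<subseteq> W"
    using is_basis_subset[OF B(1)]
    by (auto simp: exp intro!: complex_vs.subspace_sum complex_vs.subspace_scale is_basis_subspace[OF B(1)])
  have Sg: "S w = \<phi> \<mu> *\<^sub>C w" if w: "w \<in> geig W T \<mu>" for \<mu> w
  proof -
    have wW: "w \<in> W" using w geig_subset by blast
    have "S w = (\<Sum>b\<in>B. \<phi> \<mu> *\<^sub>C (coord B w b *\<^sub>C b))"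
      unfolding exp[OF wW] using geig_expand[OF B w] by (intro sum.cong) (auto simp: scaleC_scaleC mult.commute)
    then show ?thesis using coord_sum_eq[OF B(1) wW] complex_vs.scale_sum_right[of "\<phi> \<mu>" "\<lambda>b. coord B w b *\<^sub>C b" B] by simp
  qed
  have "coord B (S b) b = \<phi> (\<epsilon> b)" if "b \<in> B" for b
    using that is_basis_subset[OF B(1)] coord_scale[OF B(1), of b "\<phi> (\<epsilon> b)" b] coord_basis[OF B(1) that, of b]
    by (simp add: Sb subsetD)
  then have tr: "trace_on W S = (\<Sum>b\<in>B. \<phi> (\<epsilon> b))"
    using trace_on_eq[OF B(1) S SW] by simp
  show ?thesis by (rule that[OF S SW Sg tr])
qed

end

lemma equalizer_subspace: "clinear f \<Longrightarrow> clinear g \<Longrightarrow> csubspace {w. f w = g w}"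
  by (intro complex_vs.subspaceI) (simp_all add: clinear_0 clinear_add clinear_scale)

section \<open>Representations\<close>

text \<open>The operators are total linear maps, which makes the library facts on linear maps applicable;
  only their restriction to the invariant subspace \<open>W\<close> matters.\<close>

locale lie_rep =
  fixes W :: "'v::complex_vs set" and \<rho> :: "'g::lie_algebra \<Rightarrow> 'v \<Rightarrow> 'v"
  assumes fin: "fin_dim W"
    and lin: "clinear (\<rho> x)"
    and inv: "w \<in> W \<Longrightarrow> \<rho> x w \<in> W"
    and rho_add: "\<rho> (x + y) v = \<rho> x v + \<rho> y v"
    and rho_scale: "\<rho> (c *\<^sub>C x) v = c *\<^sub>C \<rho> x v"
    and rho_bracket: "\<rho> (lie_bracket x y) v = \<rho> x (\<rho> y v) - \<rho> y (\<rho> x v)"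
begin

lemma sub: "csubspace W" using fin fin_dim_csubspace by blast

lemma clinear_rho: "clinear (\<lambda>x. \<rho> x v)"
  by (rule clinearI) (simp_all add: rho_add rho_scale)

lemma rho_image: "\<rho> x ` W \<subseteq> W"
  using inv by auto

lemma comp_lin: "clinear (\<lambda>v. \<rho> x (\<rho> y v))" "(\<lambda>v. \<rho> x (\<rho> y v)) ` W \<subseteq> W"
  using inv by (auto intro!: clinearI simp: clinear_add[OF lin] clinear_scale[OF lin])

text \<open>The trace form of \<rho>; for the adjoint representation it is the Killing form.\<close>

definition tform :: "'g \<Rightarrow> 'g \<Rightarrow> complex" where
  "tform x y = trace_on W (\<lambda>v. \<rho> x (\<rho> y v))"

lemma tform_commute: "tform x y = tform y x"
  unfolding tform_def by (rule trace_on_commute[OF fin lin rho_image lin rho_image])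

lemma tform_add_left: "tform (x + y) z = tform x z + tform y z"
  unfolding tform_def rho_add by (rule trace_on_add[OF fin comp_lin comp_lin])

lemma tform_scale_left: "tform (c *\<^sub>C x) z = c * tform x z"
  unfolding tform_def rho_scale by (rule trace_on_scale[OF fin comp_lin])

lemma tform_add_right: "tform z (x + y) = tform z x + tform z y"
  using tform_add_left tform_commute by metis

lemma tform_scale_right: "tform z (c *\<^sub>C x) = c * tform z x"
  using tform_scale_left tform_commute by metis

text \<open>Both sides contain the trace of the product in the order x, y, z; the subtracted traces,
  in the orders y, x, z and x, z, y, agree by cyclicity.\<close>

lemma tform_invariant: "tform (lie_bracket x y) z = tform x (lie_bracket y z)"
proof -
  have 3: "clinear (\<lambda>v. \<rho> a (\<rho> b (\<rho> c v)))" "(\<lambda>v. \<rho> a (\<rho> b (\<rho> c v))) ` W \<subseteq> W" for a b c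
    using inv by (auto intro!: clinearI simp: clinear_add[OF lin] clinear_scale[OF lin])
  have "tform (lie_bracket x y) z = trace_on W (\<lambda>v. \<rho> x (\<rho> y (\<rho> z v))) - trace_on W (\<lambda>v. \<rho> y (\<rho> x (\<rho> z v)))"
    unfolding tform_def rho_bracket by (rule trace_on_diff[OF fin 3 3])
  moreover have "tform x (lie_bracket y z) = trace_on W (\<lambda>v. \<rho> x (\<rho> y (\<rho> z v))) - trace_on W (\<lambda>v. \<rho> x (\<rho> z (\<rho> y v)))"
    unfolding tform_def rho_bracket clinear_diff[OF lin] by (rule trace_on_diff[OF fin 3 3])
  moreover have "trace_on W (\<lambda>v. \<rho> y (\<rho> x (\<rho> z v))) = trace_on W (\<lambda>v. \<rho> x (\<rho> z (\<rho> y v)))"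
    using trace_on_commute[OF fin lin rho_image comp_lin] .
  ultimately show ?thesis by simp
qed

end

lemma lie_bracket_clinear: "clinear (lie_bracket x)" "clinear (\<lambda>x. lie_bracket x y)"
  by (auto intro!: clinearI simp: lie_bracket_add_right lie_bracket_scale_right lie_bracket_add_left lie_bracket_scale_left)

lemma lie_bracket_anti: "lie_bracket y x = - lie_bracket x y"
proof -
  have "lie_bracket (x + y) (x + y) = 0" by (rule lie_bracket_self)
  then have "lie_bracket x y + lie_bracket y x = 0"
    by (simp add: lie_bracket_add_left lie_bracket_add_right lie_bracket_self[of x] lie_bracket_self[of y] add.commute)
  then show ?thesis by (simp add: eq_neg_iff_add_eq_0 add.commute)
qed

lemma lie_bracket_derivation:
  "lie_bracket x (lie_bracket y z) = lie_bracket (lie_bracket x y) z + lie_bracket y (lie_bracket x z)"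
proof -
  have "lie_bracket x (lie_bracket y z) + lie_bracket y (lie_bracket z x) + lie_bracket z (lie_bracket x y) = 0"
    by (rule lie_bracket_jacobi)
  moreover have "lie_bracket y (lie_bracket z x) = - lie_bracket y (lie_bracket x z)"
    using lie_bracket_anti[of z x] clinear_neg[OF lie_bracket_clinear(1)] by metis
  moreover have "lie_bracket z (lie_bracket x y) = - lie_bracket (lie_bracket x y) z"
    by (rule lie_bracket_anti)
  ultimately show ?thesis by (simp add: algebra_simps)
qed

lemma lie_bracket_adjoint:
  "lie_bracket (lie_bracket x y) z = lie_bracket x (lie_bracket y z) - lie_bracket y (lie_bracket x z)"
  using lie_bracket_derivation[of x y z] by simp

section \<open>Engel's theorem\<close>

definition lie_subalgebra :: "'g::lie_algebra set \<Rightarrow> bool" where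
  "lie_subalgebra L \<longleftrightarrow> csubspace L \<and> (\<forall>x\<in>L. \<forall>y\<in>L. lie_bracket x y \<in> L)"

text \<open>No carrier is fixed, so that the same operators can be studied on many pairs of
  subspaces.\<close>

definition lie_ops :: "('g::lie_algebra \<Rightarrow> 'v::complex_vs \<Rightarrow> 'v) \<Rightarrow> bool" where
  "lie_ops \<rho> \<longleftrightarrow> (\<forall>x. clinear (\<rho> x)) \<and> (\<forall>v. clinear (\<lambda>x. \<rho> x v)) \<and>
     (\<forall>x y v. \<rho> (lie_bracket x y) v = \<rho> x (\<rho> y v) - \<rho> y (\<rho> x v))"

lemma lie_ops_adjoint: "lie_ops lie_bracket"
  by (simp add: lie_ops_def lie_bracket_clinear lie_bracket_adjoint)

text \<open>The pair stands for the module \<open>M / N\<close>, which has no carrier in the ambient type.\<close>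

definition nil_pair :: "('g::lie_algebra \<Rightarrow> 'v::complex_vs \<Rightarrow> 'v) \<Rightarrow> 'g set \<Rightarrow> 'v set \<Rightarrow> 'v set \<Rightarrow> bool" where
  "nil_pair \<rho> L M N \<longleftrightarrow> csubspace M \<and> csubspace N \<and> N \<subset> M \<and>
     (\<forall>x\<in>L. \<forall>m\<in>M. \<rho> x m \<in> M) \<and> (\<forall>x\<in>L. \<forall>m\<in>N. \<rho> x m \<in> N) \<and>
     (\<forall>x\<in>L. \<forall>m\<in>M. \<exists>k. (\<rho> x ^^ k) m \<in> N)"

text \<open>Engel's conclusion, a nonzero common null vector, for all subquotients at once:
  \<open>engel_codim_1\<close> applies it to the adjoint action on \<open>L / K\<close>.\<close>

definition engel_property :: "('g::lie_algebra \<Rightarrow> 'v::complex_vs \<Rightarrow> 'v) \<Rightarrow> 'g set \<Rightarrow> bool" where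
  "engel_property \<rho> L \<longleftrightarrow> (\<forall>M N. nil_pair \<rho> L M N \<longrightarrow> (\<exists>m\<in>M - N. \<forall>x\<in>L. \<rho> x m \<in> N))"

lemma engel_zero: "lie_ops \<rho> \<Longrightarrow> engel_property \<rho> {0}"
  unfolding engel_property_def nil_pair_def
proof (intro allI impI)
  fix M N assume "lie_ops \<rho>" and "csubspace M \<and> csubspace N \<and> N \<subset> M \<and> (\<forall>x\<in>{0}. \<forall>m\<in>M. \<rho> x m \<in> M) \<and>
    (\<forall>x\<in>{0}. \<forall>m\<in>N. \<rho> x m \<in> N) \<and> (\<forall>x\<in>{0}. \<forall>m\<in>M. \<exists>k. (\<rho> x ^^ k) m \<in> N)"
  moreover from this have "\<rho> 0 m = 0" for m by (auto simp: lie_ops_def intro: clinear_0)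
  ultimately show "\<exists>m\<in>M - N. \<forall>x\<in>{0}. \<rho> x m \<in> N"
    using complex_vs.subspace_0[of N] by auto
qed

text \<open>The vectors of \<open>M / N\<close> killed by \<open>K\<close> form a nonzero subspace,
  stable under \<open>y\<close> because brackets with \<open>y\<close> stay in \<open>K\<close>. As
  \<open>y\<close> is nilpotent there, it kills one of them as well.\<close>

lemma engel_step:
  assumes \<rho>: "lie_ops \<rho>" and K: "engel_property \<rho> K" and L: "L = cspan (insert y K)"
    and yK: "\<And>k. k \<in> K \<Longrightarrow> lie_bracket k y \<in> K"
  shows "engel_property \<rho> L"
  unfolding engel_property_def
proof (intro allI impI)
  fix M N assume *: "nil_pair \<rho> L M N"
  have N: "csubspace N" using * by (simp add: nil_pair_def)
  have KL: "K \<subseteq> L" "y \<in> L" unfolding L using complex_vs.span_superset[of "insert y K"] by auto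
  then have pK: "nil_pair \<rho> K M N" using * unfolding nil_pair_def by blast
  define X where "X = {m \<in> M. \<forall>k\<in>K. \<rho> k m \<in> N}"
  obtain m where m: "m \<in> X" "m \<notin> N" using K pK unfolding engel_property_def X_def by blast
  have "\<rho> y v \<in> X" if "v \<in> X" for v
  proof -
    have "\<rho> k (\<rho> y v) \<in> N" if k: "k \<in> K" for k
    proof -
      have "\<rho> k (\<rho> y v) = \<rho> (lie_bracket k y) v + \<rho> y (\<rho> k v)"
        using \<rho> by (simp add: lie_ops_def)
      moreover have "\<rho> (lie_bracket k y) v \<in> N" "\<rho> y (\<rho> k v) \<in> N"
        using * yK[OF k] k \<open>v \<in> X\<close> KL by (auto simp: X_def nil_pair_def)
      ultimately show ?thesis using complex_vs.subspace_add[OF N] by simp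
    qed
    then show ?thesis using that * KL by (auto simp: X_def nil_pair_def)
  qed
  then have X: "(\<rho> y ^^ k) m \<in> X" for k using m by (induction k) auto
  \<comment> \<open>The last vector in the orbit of \<open>m\<close> under \<open>\<rho> y\<close>
    that is outside \<open>N\<close> is the required one.\<close>
  define k where "k = (LEAST k. (\<rho> y ^^ k) m \<in> N)"
  have "\<exists>k. (\<rho> y ^^ k) m \<in> N" using * KL m by (auto simp: nil_pair_def X_def)
  then have k: "(\<rho> y ^^ k) m \<in> N" unfolding k_def by (rule LeastI_ex)
  then obtain k' where k': "k = Suc k'" using m by (cases k) auto
  define u where "u = (\<rho> y ^^ k') m"
  have "k' < k" by (simp add: k')
  then have "u \<notin> N" unfolding u_def k_def by (rule not_less_Least)
  moreover have "\<rho> y u \<in> N" using k by (simp add: k' u_def)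
  moreover have "u \<in> X" using X by (simp add: u_def)
  moreover have "csubspace {x. \<rho> x u \<in> N}"
    using cvs_pair.linear_subspace_linear_preimage[of "\<lambda>x. \<rho> x u" N] \<rho> N by (simp add: lie_ops_def)
  ultimately have "insert y K \<subseteq> {x. \<rho> x u \<in> N}" by (auto simp: X_def)
  then have "L \<subseteq> {x. \<rho> x u \<in> N}"
    unfolding L using complex_vs.span_minimal \<open>csubspace {x. \<rho> x u \<in> N}\<close> by blast
  then show "\<exists>m\<in>M - N. \<forall>x\<in>L. \<rho> x m \<in> N"
    using \<open>u \<notin> N\<close> \<open>u \<in> X\<close> by (auto simp: X_def)
qed

text \<open>A proper subalgebra \<open>K\<close> of largest dimension is normalized by some
  \<open>y\<close> outside it. Then \<open>K\<close> and \<open>y\<close> span a strictly larger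
  subalgebra, which by maximality is \<open>L\<close>.\<close>

lemma engel_codim_1:
  assumes L: "lie_subalgebra L" "fin_dim L" "L \<noteq> {0}"
    and nil: "\<And>x y. x \<in> L \<Longrightarrow> y \<in> L \<Longrightarrow> \<exists>k. (lie_bracket x ^^ k) y = 0"
    and IH: "\<And>K. lie_subalgebra K \<Longrightarrow> K \<subset> L \<Longrightarrow> engel_property lie_bracket K"
  obtains K y where "lie_subalgebra K" "K \<subset> L" "L = cspan (insert y K)" "\<And>k. k \<in> K \<Longrightarrow> lie_bracket k y \<in> K"
proof -
  let ?P = "\<lambda>K. lie_subalgebra K \<and> K \<subset> L"
  have Ls: "csubspace L" using L by (simp add: lie_subalgebra_def)
  have "lie_subalgebra {0::'a}" by (simp add: lie_subalgebra_def lie_bracket_self)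
  then have 0: "?P {0}" using L(3) complex_vs.subspace_0[OF Ls] by auto
  have bd: "\<forall>K. ?P K \<longrightarrow> complex_vs.dim K < complex_vs.dim L"
    using dim_strict_mono[OF L(2)] by (auto simp: lie_subalgebra_def)
  obtain K where K: "?P K" and max: "\<And>K'. ?P K' \<Longrightarrow> complex_vs.dim K' \<le> complex_vs.dim K"
    using ex_has_greatest_nat[OF 0 bd] by metis
  have Ks: "csubspace K" using K by (simp add: lie_subalgebra_def)
  \<comment> \<open>A null vector of the adjoint action of \<open>K\<close> on \<open>L / K\<close>
    is exactly an element outside \<open>K\<close> that normalizes \<open>K\<close>.\<close>
  have "nil_pair lie_bracket K L K"
    using K L(1) nil complex_vs.subspace_0[OF Ks] by (auto simp: nil_pair_def lie_subalgebra_def) (metis subsetD psubset_imp_subset)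
  then obtain y where y: "y \<in> L" "y \<notin> K" "\<And>k. k \<in> K \<Longrightarrow> lie_bracket k y \<in> K"
    using IH K unfolding engel_property_def by blast
  define K' where "K' = cspan (insert y K)"
  have K'L: "K' \<subseteq> L" unfolding K'_def using y K Ls by (intro complex_vs.span_minimal) auto
  have "lie_bracket a b \<in> K'" if ab: "a \<in> K'" "b \<in> K'" for a b
  proof -
    have "cspan K = K" using Ks by simp
    then obtain c d where c: "a - c *\<^sub>C y \<in> K" and d: "b - d *\<^sub>C y \<in> K"
      using ab unfolding K'_def complex_vs.span_breakdown_eq by metis
    define a' b' where "a' = a - c *\<^sub>C y" and "b' = b - d *\<^sub>C y"
    have ab': "a = a' + c *\<^sub>C y" "b = b' + d *\<^sub>C y" by (simp_all add: a'_def b'_def)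
    have "lie_bracket a b = lie_bracket a' b' + d *\<^sub>C lie_bracket a' y - c *\<^sub>C lie_bracket b' y"
      unfolding ab' by (simp add: lie_bracket_add_left lie_bracket_add_right lie_bracket_scale_left
          lie_bracket_scale_right lie_bracket_self lie_bracket_anti[of b' y])
    also have "\<dots> \<in> K"
      using c d y(3) K Ks by (auto simp: a'_def b'_def lie_subalgebra_def csubspace_simps)
    finally show ?thesis unfolding K'_def using complex_vs.span_superset by blast
  qed
  then have K'_sub: "lie_subalgebra K'" by (simp add: lie_subalgebra_def K'_def)
  have "K \<subset> K'" using y(2) complex_vs.span_superset[of "insert y K"] by (auto simp: K'_def)
  then have "complex_vs.dim K < complex_vs.dim K'"
    using dim_strict_mono[OF fin_dim_subspace[OF L(2) _ K'L] Ks] by (simp add: K'_def)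
  then have "K' = L" using max[of K'] K'_sub K'L by fastforce
  then show ?thesis using that K y(3) unfolding K'_def by blast
qed

text \<open>The induction step uses the adjoint representation of a smaller subalgebra. The type of \<open>\<rho>\<close> is fixed
  during an induction, so Engel's theorem for representations on the Lie algebra itself comes first.\<close>

lemma engel_adjoint:
  fixes \<rho> :: "'g::lie_algebra \<Rightarrow> 'g \<Rightarrow> 'g"
  assumes "lie_subalgebra L" "fin_dim L" "lie_ops \<rho>"
    "\<And>x y. x \<in> L \<Longrightarrow> y \<in> L \<Longrightarrow> \<exists>k. (lie_bracket x ^^ k) y = 0"
  shows "engel_property \<rho> L"
  using assms
proof (induction "complex_vs.dim L" arbitrary: L \<rho> rule: less_induct)
  case less
  have IH: "engel_property \<sigma> K" if "lie_subalgebra K" "K \<subset> L" "lie_ops \<sigma>" for K and \<sigma> :: "'g \<Rightarrow> 'g \<Rightarrow> 'g"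
  proof (rule less.hyps[OF _ that(1) _ that(3)])
    show "complex_vs.dim K < complex_vs.dim L"
      using dim_strict_mono[OF less.prems(2) _ that(2)] that(1) by (simp add: lie_subalgebra_def)
    show "fin_dim K" using that fin_dim_subspace[OF less.prems(2)] by (auto simp: lie_subalgebra_def)
    show "\<exists>k. (lie_bracket x ^^ k) y = 0" if "x \<in> K" "y \<in> K" for x y
      using less.prems(4)[of x y] that \<open>K \<subset> L\<close> by blast
  qed
  show ?case
  proof (cases "L = {0}")
    case True
    then show ?thesis using engel_zero less.prems by simp
  next
    case False
    obtain K y where "lie_subalgebra K" "K \<subset> L" "L = cspan (insert y K)" "\<And>k. k \<in> K \<Longrightarrow> lie_bracket k y \<in> K"
      by (rule engel_codim_1[OF less.prems(1,2) False less.prems(4) IH[OF _ _ lie_ops_adjoint]]) auto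
    then show ?thesis using engel_step[OF less.prems(3) IH[OF _ _ less.prems(3)]] by blast
  qed
qed

theorem engel:
  fixes \<rho> :: "'g::lie_algebra \<Rightarrow> 'v::complex_vs \<Rightarrow> 'v"
  assumes "lie_subalgebra L" "fin_dim L" "lie_ops \<rho>"
    "\<And>x y. x \<in> L \<Longrightarrow> y \<in> L \<Longrightarrow> \<exists>k. (lie_bracket x ^^ k) y = 0"
  shows "engel_property \<rho> L"
  using assms
proof (induction "complex_vs.dim L" arbitrary: L rule: less_induct)
  case less
  have nil: "\<exists>k. (lie_bracket x ^^ k) y = 0" if "K \<subset> L" "x \<in> K" "y \<in> K" for x y K
    using less.prems(4)[of x y] that by blast
  have fd: "fin_dim K" if "lie_subalgebra K" "K \<subset> L" for K
    using that fin_dim_subspace[OF less.prems(2)] by (auto simp: lie_subalgebra_def)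
  have ad: "engel_property lie_bracket K" if "lie_subalgebra K" "K \<subset> L" for K
    using engel_adjoint[OF that(1) fd[OF that] lie_ops_adjoint] nil[OF that(2)] by blast
  show ?case
  proof (cases "L = {0}")
    case True
    then show ?thesis using engel_zero less.prems by simp
  next
    case False
    obtain K y where K: "lie_subalgebra K" "K \<subset> L" "L = cspan (insert y K)" "\<And>k. k \<in> K \<Longrightarrow> lie_bracket k y \<in> K"
      by (rule engel_codim_1[OF less.prems(1,2) False less.prems(4) ad]) auto
    have "complex_vs.dim K < complex_vs.dim L"
      using dim_strict_mono[OF less.prems(2) _ K(2)] K(1) by (simp add: lie_subalgebra_def)
    then have "engel_property \<rho> K"
      using less.hyps[OF _ K(1) fd[OF K(1,2)] less.prems(3)] nil[OF K(2)] by blast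
    then show ?thesis using engel_step[OF less.prems(3)] K by blast
  qed
qed

section \<open>Cartan's criterion\<close>

context lie_rep
begin

lemma lie_ops: "lie_ops \<rho>"
  by (simp add: lie_ops_def lin clinear_rho rho_bracket)

text \<open>Leibniz rule for shifts: \<open>shift (\<rho> x) (\<mu> + \<alpha>)\<close> applied to
  \<open>\<rho> a m\<close> shifts either \<open>a\<close> or \<open>m\<close>. Induction on the sum
  of the two exponents; once one of them is 0, its vector is zero.\<close>

lemma geig_grading:
  assumes a: "a \<in> geig D (lie_bracket x) \<alpha>" and m: "m \<in> geig W (\<rho> x) \<mu>"
  shows "\<rho> a m \<in> geig W (\<rho> x) (\<mu> + \<alpha>)"
proof -
  have *: "(shift (\<rho> x) (\<mu> + \<alpha>) ^^ (i + j)) (\<rho> a m) = 0"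
    if "(shift (lie_bracket x) \<alpha> ^^ i) a = 0" "(shift (\<rho> x) \<mu> ^^ j) m = 0" for i j a m
    using that
  proof (induction "i + j" arbitrary: i j a m)
    case 0
    then show ?case by (simp add: clinear_0[OF lin])
  next
    case (Suc n)
    note pl = funpow_clinear[OF clinear_shift[OF lin]]
    show ?case
    proof (cases "i = 0 \<or> j = 0")
      case True
      then have "\<rho> a m = 0"
        using Suc.prems by (auto simp: clinear_0[OF lin] clinear_0[OF clinear_rho])
      then show ?thesis by (simp add: clinear_0[OF pl])
    next
      case False
      then obtain i' j' where ij: "i = Suc i'" "j = Suc j'" by (metis not0_implies_Suc)
      have "(shift (\<rho> x) (\<mu> + \<alpha>) ^^ (i' + j)) (\<rho> (shift (lie_bracket x) \<alpha> a) m) = 0"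
        using Suc.prems ij Suc.hyps by (intro Suc.hyps(1)) (auto simp: funpow_Suc_right simp del: funpow.simps)
      moreover have "(shift (\<rho> x) (\<mu> + \<alpha>) ^^ (i + j')) (\<rho> a (shift (\<rho> x) \<mu> m)) = 0"
        using Suc.prems ij Suc.hyps by (intro Suc.hyps(1)) (auto simp: funpow_Suc_right simp del: funpow.simps)
      moreover have "shift (\<rho> x) (\<mu> + \<alpha>) (\<rho> a m)
          = \<rho> (shift (lie_bracket x) \<alpha> a) m + \<rho> a (shift (\<rho> x) \<mu> m)"
        by (simp add: clinear_diff[OF clinear_rho] clinear_diff[OF lin] clinear_scale[OF lin]
            rho_scale rho_bracket scaleC_add_left)
      moreover have "i + j = Suc (i' + j)" "i + j' = i' + j" using ij by auto
      ultimately show ?thesis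
        by (simp add: funpow_Suc_right clinear_add[OF pl] del: funpow.simps)
    qed
  qed
  obtain i where i: "(shift (lie_bracket x) \<alpha> ^^ i) a = 0" using a by (auto simp: geig_def)
  obtain j where j: "(shift (\<rho> x) \<mu> ^^ j) m = 0" using m by (auto simp: geig_def)
  have "m \<in> W" using m by (simp add: geig_def)
  then show ?thesis using *[OF i j] inv unfolding geig_def by blast
qed

text \<open>With \<open>S\<close> the conjugate of the semisimple part of \<open>\<rho> x\<close>, the trace of \<open>\<rho> y \<circ> S\<close> vanishes on
  brackets of eigenvectors of \<open>ad x\<close>, hence at \<open>y = x\<close>, where it is the sum of the squared absolute
  values of the eigenvalues.\<close>

lemma trace_zero_nilpotent:
  assumes D: "lie_subalgebra D" "fin_dim D" "D \<subseteq> cspan {lie_bracket a b | a b. a \<in> D \<and> b \<in> D}"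
    and tz: "\<And>a b. a \<in> D \<Longrightarrow> b \<in> D \<Longrightarrow> tform a b = 0"
    and x: "x \<in> D"
  shows "W \<subseteq> geig W (\<rho> x) 0"
proof -
  note ge = fin lin[of x] rho_image[of x]
  obtain B \<epsilon> where B: "is_basis B W" "\<And>b. b \<in> B \<Longrightarrow> b \<in> geig W (\<rho> x) (\<epsilon> b)"
    using geig_basis[OF ge] by metis
  obtain S where S: "clinear S" "S ` W \<subseteq> W" and Sg: "\<And>\<mu> w. w \<in> geig W (\<rho> x) \<mu> \<Longrightarrow> S w = cnj \<mu> *\<^sub>C w"
    using geig_operator[OF ge B, where \<phi> = cnj] by metis
  obtain Q where Q: "clinear Q" "Q ` W \<subseteq> W"
    and Qg: "\<And>\<mu> w. w \<in> geig W (\<rho> x) \<mu> \<Longrightarrow> Q w = (\<mu> * cnj \<mu>) *\<^sub>C w"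
    and Qt: "trace_on W Q = (\<Sum>b\<in>B. \<epsilon> b * cnj (\<epsilon> b))"
    using geig_operator[OF ge B, where \<phi> = "\<lambda>\<mu>. \<mu> * cnj \<mu>"] by metis
  have W_sp: "W = cspan (\<Union>\<mu>. geig W (\<rho> x) \<mu>)" using span_geig[OF ge] .
  have adD: "lie_bracket x ` D \<subseteq> D" using D x by (auto simp: lie_subalgebra_def)
  note gD = D(2) lie_bracket_clinear(1)[of x] adD
  define X where "X = (\<Union>\<alpha>. geig D (lie_bracket x) \<alpha>)"
  have D_sp: "D = cspan X" using span_geig[OF gD] by (simp add: X_def)
  define \<tau> where "\<tau> y = trace_on W (\<lambda>v. \<rho> y (S v))" for y
  have yS: "clinear (\<lambda>v. \<rho> y (S v))" "(\<lambda>v. \<rho> y (S v)) ` W \<subseteq> W" for y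
    using S inv by (auto intro!: clinearI simp: clinear_add[OF lin] clinear_scale[OF lin] clinear_add[OF S(1)] clinear_scale[OF S(1)])
  have \<tau>: "clinear \<tau>"
    unfolding \<tau>_def
    by (intro clinearI) (simp_all add: rho_add rho_scale trace_on_add[OF fin yS yS] trace_on_scale[OF fin yS] scaleC_complex_def)
  \<comment> \<open>Since \<open>b\<close> raises eigenvalues by \<beta>, its commutator with
    \<open>S\<close> is a multiple of \<open>\<rho> b\<close> itself. By cyclicity the trace on the
    bracket becomes a multiple of \<open>tform a b\<close>, which is zero.\<close>
  have 1: "\<tau> (lie_bracket a b) = 0" if a: "a \<in> D" and b: "b \<in> geig D (lie_bracket x) \<beta>" for a b \<beta>
  proof -
    have bD: "b \<in> D" using b by (auto simp: geig_def)
    let ?R = "\<lambda>v. \<rho> b (S v) - S (\<rho> b v)"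
    have R: "?R w = (- cnj \<beta>) *\<^sub>C \<rho> b w" if "w \<in> W" for w
    proof -
      let ?E = "{w. ?R w = (- cnj \<beta>) *\<^sub>C \<rho> b w}"
      have "csubspace ?E"
        using S by (intro equalizer_subspace clinearI)
          (simp_all add: clinear_add[OF lin] clinear_add[OF S(1)] clinear_scale[OF lin] clinear_scale[OF S(1)]
            scaleC_add_right complex_vs.scale_right_diff_distrib scaleC_scaleC mult.commute)
      moreover have "(\<Union>\<mu>. geig W (\<rho> x) \<mu>) \<subseteq> ?E"
      proof safe
        fix w \<mu> assume w: "w \<in> geig W (\<rho> x) \<mu>"
        have "S (\<rho> b w) = cnj (\<mu> + \<beta>) *\<^sub>C \<rho> b w" using Sg geig_grading[OF b w] by blast
        then show "?R w = (- cnj \<beta>) *\<^sub>C \<rho> b w"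
          using Sg[OF w] by (simp add: clinear_scale[OF lin] scaleC_add_left)
      qed
      ultimately have "W \<subseteq> ?E" by (intro ord_eq_le_trans[OF W_sp] complex_vs.span_minimal)
      then show ?thesis using that by blast
    qed
    have l1: "clinear (\<lambda>v. \<rho> a (\<rho> b (S v)))" "(\<lambda>v. \<rho> a (\<rho> b (S v))) ` W \<subseteq> W"
      and l2: "clinear (\<lambda>v. \<rho> a (S (\<rho> b v)))" "(\<lambda>v. \<rho> a (S (\<rho> b v))) ` W \<subseteq> W"
      and l3: "clinear (\<lambda>v. \<rho> b (\<rho> a (S v)))" "(\<lambda>v. \<rho> b (\<rho> a (S v))) ` W \<subseteq> W"
      using S inv by (auto intro!: clinearI simp: clinear_add[OF lin] clinear_scale[OF lin] clinear_add[OF S(1)] clinear_scale[OF S(1)])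
    have "\<tau> (lie_bracket a b) = trace_on W (\<lambda>v. \<rho> a (\<rho> b (S v))) - trace_on W (\<lambda>v. \<rho> b (\<rho> a (S v)))"
      unfolding \<tau>_def rho_bracket by (rule trace_on_diff[OF fin l1 l3])
    also have "trace_on W (\<lambda>v. \<rho> b (\<rho> a (S v))) = trace_on W (\<lambda>v. \<rho> a (S (\<rho> b v)))"
      by (rule trace_on_commute[OF fin lin rho_image yS])
    also have "trace_on W (\<lambda>v. \<rho> a (\<rho> b (S v))) - \<dots> = trace_on W (\<lambda>v. \<rho> a (\<rho> b (S v)) - \<rho> a (S (\<rho> b v)))"
      by (rule trace_on_diff[OF fin l1 l2, symmetric])
    also have "\<dots> = trace_on W (\<lambda>v. (- cnj \<beta>) *\<^sub>C \<rho> a (\<rho> b v))"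
      using R by (intro trace_on_cong[OF fin]) (metis clinear_diff[OF lin] clinear_scale[OF lin])
    also have "\<dots> = - cnj \<beta> * tform a b"
      unfolding tform_def by (rule trace_on_scale[OF fin comp_lin])
    finally show ?thesis using tz[OF a bD] by simp
  qed
  have 2: "\<tau> (lie_bracket a b) = 0" if "a \<in> D" "b \<in> D" for a b
  proof -
    have "csubspace {b. \<tau> (lie_bracket a b) = 0}"
      by (intro complex_vs.subspaceI)
        (simp_all add: clinear_0[OF \<tau>] clinear_0[OF lie_bracket_clinear(1)] lie_bracket_add_right lie_bracket_scale_right clinear_add[OF \<tau>] clinear_scale[OF \<tau>])
    moreover have "X \<subseteq> {b. \<tau> (lie_bracket a b) = 0}" using 1[OF that(1)] by (auto simp: X_def)
    ultimately have "cspan X \<subseteq> {b. \<tau> (lie_bracket a b) = 0}" by (intro complex_vs.span_minimal)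
    then show ?thesis using that(2) D_sp by blast
  qed
  \<comment> \<open>\<open>D\<close> is spanned by its own brackets, so \<tau> vanishes on all of
    \<open>D\<close>; this is how \<open>x\<close>, not itself a bracket, is reached.\<close>
  have "csubspace {y. \<tau> y = 0}" using cvs_pair.linear_subspace_kernel[OF \<tau>] .
  moreover have "{lie_bracket a b | a b. a \<in> D \<and> b \<in> D} \<subseteq> {y. \<tau> y = 0}" using 2 by auto
  ultimately have "D \<subseteq> {y. \<tau> y = 0}" using D(3) complex_vs.span_minimal by blast
  then have tx: "\<tau> x = 0" using x by blast
  \<comment> \<open>On the eigenspace of \<mu>, \<open>?N\<close> is \<open>cnj \<mu>\<close> times
    \<open>shift (\<rho> x) \<mu>\<close>, hence nilpotent. So \<open>\<tau> x\<close> equals the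
    trace of \<open>Q\<close>, the sum of the squared absolute values of the eigenvalues.\<close>
  let ?N = "\<lambda>v. \<rho> x (S v) - Q v"
  have N: "clinear ?N"
    using S Q by (intro clinearI) (simp_all add: clinear_add[OF lin] clinear_scale[OF lin] clinear_add[OF S(1)]
        clinear_scale[OF S(1)] clinear_add[OF Q(1)] clinear_scale[OF Q(1)] complex_vs.scale_right_diff_distrib)
  have NW: "?N ` W \<subseteq> W" using yS(2)[of x] Q(2) complex_vs.subspace_diff[OF sub] by blast
  have Ng: "(?N ^^ n) w = cnj \<mu> ^ n *\<^sub>C (shift (\<rho> x) \<mu> ^^ n) w \<and> (shift (\<rho> x) \<mu> ^^ n) w \<in> geig W (\<rho> x) \<mu>"
    if w: "w \<in> geig W (\<rho> x) \<mu>" for w \<mu> n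
  proof (induction n)
    case 0
    then show ?case using w by (simp add: scaleC_one)
  next
    case (Suc n)
    define u where "u = (shift (\<rho> x) \<mu> ^^ n) w"
    have u: "u \<in> geig W (\<rho> x) \<mu>" using Suc by (simp add: u_def)
    have "?N u = cnj \<mu> *\<^sub>C shift (\<rho> x) \<mu> u"
      by (simp add: Sg[OF u] Qg[OF u] clinear_scale[OF lin] complex_vs.scale_right_diff_distrib scaleC_scaleC mult.commute)
    then have "?N (cnj \<mu> ^ n *\<^sub>C u) = cnj \<mu> ^ Suc n *\<^sub>C shift (\<rho> x) \<mu> u"
      using clinear_scale[OF N, of "cnj \<mu> ^ n" u] by (simp add: scaleC_scaleC mult.commute)
    moreover have "shift (\<rho> x) \<mu> u \<in> geig W (\<rho> x) \<mu>" using geig_shift[OF ge u] .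
    ultimately show ?case using Suc by (simp add: u_def)
  qed
  have "(\<Union>\<mu>. geig W (\<rho> x) \<mu>) \<subseteq> {w. \<exists>n. (?N ^^ n) w = 0}"
  proof safe
    fix w \<mu> assume w: "w \<in> geig W (\<rho> x) \<mu>"
    then obtain n where "(shift (\<rho> x) \<mu> ^^ n) w = 0" by (auto simp: geig_def)
    then have "(?N ^^ n) w = 0" using Ng[OF w, of n] by simp
    then show "\<exists>n. (?N ^^ n) w = 0" by blast
  qed
  then have "W \<subseteq> {w. \<exists>n. (?N ^^ n) w = 0}"
    by (intro ord_eq_le_trans[OF W_sp] complex_vs.span_minimal nilpotent_vectors_subspace[OF N])
  then have "trace_on W ?N = 0" by (intro trace_on_nilpotent[OF fin N NW]) blast
  moreover have "trace_on W ?N = \<tau> x - trace_on W Q"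
    unfolding \<tau>_def by (rule trace_on_diff[OF fin yS Q])
  ultimately have "(\<Sum>b\<in>B. \<epsilon> b * cnj (\<epsilon> b)) = 0" using tx Qt by simp
  then have "complex_of_real (\<Sum>b\<in>B. (cmod (\<epsilon> b))\<^sup>2) = 0"
    by (simp add: complex_norm_square del: of_real_power)
  then have "(\<Sum>b\<in>B. (cmod (\<epsilon> b))\<^sup>2) = 0" using of_real_eq_0_iff by blast
  then have "\<epsilon> b = 0" if "b \<in> B" for b
    using B(1) that by (subst (asm) sum_nonneg_eq_0_iff) (auto simp: is_basis_def)
  then have "B \<subseteq> geig W (\<rho> x) 0" using B(2) by force
  then have "cspan B \<subseteq> geig W (\<rho> x) 0" using geig_subspace[OF ge] by (intro complex_vs.span_minimal)
  then show ?thesis using B(1) by (simp add: is_basis_def)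
qed

text \<open>All elements of \<open>D\<close> act nilpotently, on \<open>W\<close> and then also on
  \<open>D\<close>. Engel's theorem provides a vector that \<open>D\<close> moves into its null
  space; brackets kill such a vector, and \<open>D\<close> consists of sums of brackets, so
  \<open>D\<close> acts as zero.\<close>

lemma perfect_trace_zero_trivial:
  assumes D: "lie_subalgebra D" "fin_dim D" "D \<subseteq> cspan {lie_bracket a b | a b. a \<in> D \<and> b \<in> D}"
    and tz: "\<And>a b. a \<in> D \<Longrightarrow> b \<in> D \<Longrightarrow> tform a b = 0"
    and faithful: "\<And>a. a \<in> D \<Longrightarrow> (\<And>w. w \<in> W \<Longrightarrow> \<rho> a w = 0) \<Longrightarrow> a = 0"
  shows "D = {0}"
proof -
  have nil: "W \<subseteq> geig W (\<rho> x) 0" if "x \<in> D" for x using trace_zero_nilpotent[OF D tz that] .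
  have ad_nil: "\<exists>k. (lie_bracket x ^^ k) y = 0" if x: "x \<in> D" and y: "y \<in> D" for x y
  proof -
    have adD: "lie_bracket x ` D \<subseteq> D" using D x by (auto simp: lie_subalgebra_def)
    note gD = D(2) lie_bracket_clinear(1)[of x] adD
    \<comment> \<open>Elements of nonzero eigenvalue \<alpha> would send vectors of eigenvalue 0 to
      eigenvalue \<alpha>, but only 0 occurs on \<open>W\<close>. They act as zero and are zero by
      faithfulness.\<close>
    have "geig D (lie_bracket x) \<alpha> \<subseteq> geig D (lie_bracket x) 0" for \<alpha>
    proof
      fix a assume a: "a \<in> geig D (lie_bracket x) \<alpha>"
      show "a \<in> geig D (lie_bracket x) 0"
      proof (cases "\<alpha> = 0")
        case False
        have "\<rho> a w = 0" if w: "w \<in> W" for w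
        proof (rule geig_disjoint[OF fin lin[of x] rho_image])
          show "\<rho> a w \<in> geig W (\<rho> x) 0" using nil[OF x] inv[OF w] by blast
          show "\<rho> a w \<in> geig W (\<rho> x) (0 + \<alpha>)" using geig_grading[OF a] nil[OF x] w by blast
        qed (use False in auto)
        then have "a = 0" using faithful[of a] a by (auto simp: geig_def)
        then show ?thesis using complex_vs.subspace_0[OF geig_subspace[OF gD]] by simp
      qed (use a in simp)
    qed
    then have "(\<Union>\<alpha>. geig D (lie_bracket x) \<alpha>) \<subseteq> geig D (lie_bracket x) 0" by blast
    then have "D \<subseteq> geig D (lie_bracket x) 0"
      by (intro ord_eq_le_trans[OF span_geig[OF gD]] complex_vs.span_minimal geig_subspace[OF gD])
    then show ?thesis using y by (auto simp: geig_def)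
  qed
  \<comment> \<open>Engel is applied to \<open>W / N\<close> rather than to \<open>W\<close>: its
    null vector lies outside \<open>N\<close>, which is what the perfectness of \<open>D\<close>
    contradicts.\<close>
  define N where "N = {w \<in> W. \<forall>a\<in>D. \<rho> a w = 0}"
  have Ns: "csubspace N"
    unfolding N_def using sub
    by (intro complex_vs.subspaceI) (auto simp: csubspace_simps clinear_0[OF lin] clinear_add[OF lin] clinear_scale[OF lin])
  have "N = W"
  proof (rule ccontr)
    assume "N \<noteq> W"
    then have NW: "N \<subset> W" by (auto simp: N_def)
    have "nil_pair \<rho> D W N"
      unfolding nil_pair_def
    proof (intro conjI ballI)
      fix x w assume "x \<in> D" "w \<in> W"
      then obtain k where "(\<rho> x ^^ k) w = 0" using nil[of x] by (auto simp: geig_def)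
      then show "\<exists>k. (\<rho> x ^^ k) w \<in> N" using complex_vs.subspace_0[OF Ns] by metis
    qed (use sub Ns NW inv complex_vs.subspace_0[OF sub] in \<open>auto simp: N_def clinear_0[OF lin]\<close>)
    then obtain m where m: "m \<in> W" "m \<notin> N" "\<And>x. x \<in> D \<Longrightarrow> \<rho> x m \<in> N"
      using engel[OF D(1,2) lie_ops ad_nil] unfolding engel_property_def by blast
    have "\<rho> (lie_bracket a b) m = 0" if "a \<in> D" "b \<in> D" for a b
      using m(3)[OF that(1)] m(3)[OF that(2)] that by (simp add: rho_bracket N_def)
    then have "{lie_bracket a b | a b. a \<in> D \<and> b \<in> D} \<subseteq> {x. \<rho> x m = 0}" by auto
    then have "D \<subseteq> {x. \<rho> x m = 0}"
      using D(3) complex_vs.span_minimal cvs_pair.linear_subspace_kernel[OF clinear_rho] by blast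
    then show False using m by (auto simp: N_def)
  qed
  then have "a = 0" if "a \<in> D" for a using faithful[OF that] that by (auto simp: N_def)
  then show ?thesis using D(1) complex_vs.subspace_0 by (auto simp: lie_subalgebra_def)
qed

text \<open>The derived series becomes stationary for dimension reasons, and its last term is its
  own derived algebra, so \<open>perfect_trace_zero_trivial\<close> makes it zero.\<close>

theorem cartan_criterion:
  assumes K: "lie_subalgebra K" "fin_dim K"
    and tz: "\<And>a b. a \<in> K \<Longrightarrow> b \<in> K \<Longrightarrow> tform a b = 0"
    and faithful: "\<And>a. a \<in> K \<Longrightarrow> (\<And>w. w \<in> W \<Longrightarrow> \<rho> a w = 0) \<Longrightarrow> a = 0"
  shows "lie_solvable K"
proof -
  let ?D = "derived_series K"
  have ss: "csubspace (?D n)" for n using K by (cases n) (auto simp: lie_subalgebra_def)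
  have step: "?D (Suc n) \<subseteq> ?D n" for n
  proof (induction n)
    case 0
    have "{lie_bracket x y | x y. x \<in> K \<and> y \<in> K} \<subseteq> K" using K by (auto simp: lie_subalgebra_def)
    then show ?case using complex_vs.span_minimal[OF _ ss[of 0]] by simp
  next
    case (Suc n)
    then show ?case by (auto intro!: complex_vs.span_mono)
  qed
  have DK: "?D n \<subseteq> K" for n
    by (induction n) (use step in auto)
  have fd: "fin_dim (?D n)" for n using fin_dim_subspace[OF K(2) ss DK] .
  have "\<exists>n. ?D (Suc n) = ?D n"
  proof (rule ccontr)
    assume "\<nexists>n. ?D (Suc n) = ?D n"
    then have less: "complex_vs.dim (?D (Suc n)) < complex_vs.dim (?D n)" for n
      using step dim_strict_mono[OF fd ss] by blast
    have "complex_vs.dim (?D n) + n \<le> complex_vs.dim K" for n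
    proof (induction n)
      case (Suc n)
      then show ?case using less[of n] by linarith
    qed simp
    from this[of "Suc (complex_vs.dim K)"] show False by simp
  qed
  then obtain n where n: "?D (Suc n) = ?D n" by blast
  have "lie_bracket a b \<in> ?D n" if "a \<in> ?D n" "b \<in> ?D n" for a b
  proof -
    have "lie_bracket a b \<in> ?D (Suc n)" using that by (auto intro: complex_vs.span_base)
    then show ?thesis using n by simp
  qed
  then have "lie_subalgebra (?D n)" using ss by (simp add: lie_subalgebra_def)
  moreover have "?D n \<subseteq> cspan {lie_bracket a b | a b. a \<in> ?D n \<and> b \<in> ?D n}" using n by simp
  ultimately have "?D n = {0}"
    using tz faithful DK by (intro perfect_trace_zero_trivial fd) blast+
  then show ?thesis by (auto simp: lie_solvable_def)
qed

end

section \<open>Casimir operators\<close>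

lemma lie_ideal_subalgebra: "lie_ideal I \<Longrightarrow> lie_subalgebra I"
  by (simp add: lie_ideal_def lie_subalgebra_def)

lemma lie_ideal_Int: "lie_ideal I \<Longrightarrow> lie_ideal J \<Longrightarrow> lie_ideal (I \<inter> J)"
  by (auto simp: lie_ideal_def complex_vs.subspace_inter)

lemma semisimple_fin_dim: "semisimple_lie_algebra TYPE('g::lie_algebra) \<Longrightarrow> fin_dim (X :: 'g set) \<longleftrightarrow> csubspace X"
  using fin_dim_subspace[of UNIV X] fin_dim_csubspace[of X] by (auto simp: semisimple_lie_algebra_def)

lemma lie_rep_adjoint:
  assumes "semisimple_lie_algebra TYPE('g::lie_algebra)"
  shows "lie_rep UNIV (lie_bracket :: 'g \<Rightarrow> 'g \<Rightarrow> 'g)"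
  using assms by (intro lie_rep.intro)
    (simp_all add: semisimple_lie_algebra_def lie_bracket_clinear lie_bracket_add_left lie_bracket_scale_left lie_bracket_adjoint)

text \<open>The centre is an abelian, hence solvable, ideal. This makes the adjoint representation
  faithful, as Cartan's criterion for the Killing form demands.\<close>

lemma semisimple_center_zero:
  assumes "semisimple_lie_algebra TYPE('g::lie_algebra)" "\<And>y. lie_bracket (x :: 'g) y = 0"
  shows "x = 0"
proof -
  let ?Z = "{x :: 'g. \<forall>y. lie_bracket x y = 0}"
  have "lie_bracket y x = 0" if "x \<in> ?Z" for x y :: 'g
    using that lie_bracket_anti[of x y] by simp
  then have "lie_ideal ?Z"
    by (auto simp: lie_ideal_def lie_bracket_add_left lie_bracket_scale_left clinear_0[OF lie_bracket_clinear(2)]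
        intro!: complex_vs.subspaceI)
  moreover have "{lie_bracket x y | x y. x \<in> ?Z \<and> y \<in> ?Z} = {0}"
    using clinear_0[OF lie_bracket_clinear(2)] by (auto intro!: exI[of _ 0])
  then have "derived_series ?Z 1 = {0}" by simp
  then have "lie_solvable ?Z" unfolding lie_solvable_def by blast
  ultimately have "?Z = {0}" using assms(1) by (simp add: semisimple_lie_algebra_def)
  then show ?thesis using assms(2) by blast
qed

context lie_rep
begin

lemma tform_linear: "clinear (tform x)" "clinear (\<lambda>x. tform x y)"
  by (auto intro!: clinearI simp: tform_add_left tform_add_right tform_scale_left tform_scale_right scaleC_complex_def)

lemma tform_orthogonal_ideal:
  assumes "lie_ideal I"
  shows "lie_ideal {x. \<forall>y\<in>I. tform x y = 0}"
proof -
  have "tform (lie_bracket z x) y = 0" if x: "\<forall>y\<in>I. tform x y = 0" and "y \<in> I" for x y z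
  proof -
    have "tform (lie_bracket z x) y = - tform (lie_bracket x z) y"
      using lie_bracket_anti[of z x] clinear_neg[OF tform_linear(2)] by metis
    also have "\<dots> = - tform x (lie_bracket z y)" by (simp add: tform_invariant)
    also have "\<dots> = 0" using assms that by (simp add: lie_ideal_def)
    finally show ?thesis .
  qed
  then show ?thesis
    by (auto simp: lie_ideal_def tform_add_left tform_scale_left clinear_0[OF tform_linear(2)]
        intro!: complex_vs.subspaceI)
qed

lemma kernel_ideal: "lie_ideal {x. \<forall>w\<in>W. \<rho> x w = 0}"
  using inv by (auto simp: lie_ideal_def rho_add rho_scale rho_bracket clinear_0[OF clinear_rho] clinear_0[OF lin]
      intro!: complex_vs.subspaceI)

text \<open>In coordinates, the map from the Lie algebra to the dual space of \<open>J\<close> given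
  by the trace form: the values on \<open>B\<close> serve as coefficients on \<open>B\<close>, so
  that no separate type of functionals is involved.\<close>

lemma tform_dual_map:
  assumes B: "is_basis B J"
  shows "clinear (\<lambda>x. \<Sum>b\<in>B. tform b x *\<^sub>C b)" "(\<Sum>b\<in>B. tform b x *\<^sub>C b) \<in> J"
    "(\<Sum>b\<in>B. tform b x *\<^sub>C b) = 0 \<Longrightarrow> y \<in> J \<Longrightarrow> tform y x = 0"
proof -
  show "clinear (\<lambda>x. \<Sum>b\<in>B. tform b x *\<^sub>C b)"
    by (intro clinearI) (simp_all add: tform_add_right tform_scale_right scaleC_add_left sum.distrib
        complex_vs.scale_sum_right scaleC_scaleC)
  show "(\<Sum>b\<in>B. tform b x *\<^sub>C b) \<in> J"
    using is_basis_subset[OF B] is_basis_subspace[OF B]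
    by (intro complex_vs.subspace_sum complex_vs.subspace_scale) auto
  assume 0: "(\<Sum>b\<in>B. tform b x *\<^sub>C b) = 0" and y: "y \<in> J"
  have "tform b x = 0" if "b \<in> B" for b
    using complex_vs.independentD[OF _ _ order_refl 0 that] B by (simp add: is_basis_def)
  then have "B \<subseteq> {y. tform y x = 0}" by auto
  then have "cspan B \<subseteq> {y. tform y x = 0}"
    using cvs_pair.linear_subspace_kernel[OF tform_linear(2)] by (rule complex_vs.span_minimal)
  then show "tform y x = 0" using y B by (auto simp: is_basis_def)
qed

text \<open>\<open>J\<close> is the orthogonal complement, for the Killing form, of the kernel
  \<open>I\<close> of \<rho>. Cartan's criterion is used twice: for the adjoint representation it
  gives that \<open>J\<close> meets \<open>I\<close> in zero, so \<rho> is faithful on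
  \<open>J\<close>; for \<rho> it then makes the radical of the trace form on \<open>J\<close>
  solvable, hence zero.\<close>

lemma nondegenerate_ideal:
  assumes ss: "semisimple_lie_algebra TYPE('g)" and nt: "\<exists>x. \<exists>w\<in>W. \<rho> x w \<noteq> 0"
  obtains J where "lie_ideal J" "J \<noteq> {0}" "\<And>x. x \<in> J \<Longrightarrow> (\<And>y. y \<in> J \<Longrightarrow> tform x y = 0) \<Longrightarrow> x = 0"
proof -
  interpret ad: lie_rep UNIV "lie_bracket :: 'g \<Rightarrow> 'g \<Rightarrow> 'g" by (rule lie_rep_adjoint[OF ss])
  define I where "I = {x. \<forall>w\<in>W. \<rho> x w = 0}"
  have I: "lie_ideal I" unfolding I_def by (rule kernel_ideal)
  then have Is: "csubspace I" by (simp add: lie_ideal_def)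
  define J where "J = {x. \<forall>y\<in>I. ad.tform x y = 0}"
  have J: "lie_ideal J" unfolding J_def by (rule ad.tform_orthogonal_ideal[OF I])
  have zero: "K = {0}" if "lie_ideal K" "lie_solvable K" for K :: "'g set"
    using ss that by (simp add: semisimple_lie_algebra_def)
  have fd: "fin_dim K" if "lie_ideal K" for K :: "'g set"
    using that semisimple_fin_dim[OF ss] by (simp add: lie_ideal_def)
  have IJ: "I \<inter> J = {0}"
  proof (rule zero)
    show IJ: "lie_ideal (I \<inter> J)" using I J by (rule lie_ideal_Int)
    show "lie_solvable (I \<inter> J)"
    proof (rule ad.cartan_criterion[OF lie_ideal_subalgebra[OF IJ] fd[OF IJ]])
      show "ad.tform a b = 0" if "a \<in> I \<inter> J" "b \<in> I \<inter> J" for a b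
        using that by (simp add: J_def)
      show "a = 0" if "\<And>w. w \<in> UNIV \<Longrightarrow> lie_bracket a w = 0" for a :: 'g
        using semisimple_center_zero[OF ss] that by simp
    qed
  qed
  \<comment> \<open>Orthogonality to \<open>I\<close> amounts to as many linear equations as the
    dimension of \<open>I\<close>, which is smaller than that of the whole algebra.\<close>
  have "J \<noteq> {0}"
  proof -
    obtain B where B: "is_basis B I" using fin_dim_basis[OF fd[OF I] Is] .
    have "I \<noteq> UNIV" using nt unfolding I_def by blast
    then have "complex_vs.dim I < complex_vs.dim (UNIV :: 'g set)"
      using dim_strict_mono[OF ad.fin Is] by blast
    moreover have "range (\<lambda>x. \<Sum>b\<in>B. ad.tform b x *\<^sub>C b) \<subseteq> I"
      using ad.tform_dual_map(2)[OF B] by blast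
    ultimately obtain x where x: "x \<noteq> 0" "(\<Sum>b\<in>B. ad.tform b x *\<^sub>C b) = 0"
      using kernel_nontrivial[OF ad.fin ad.tform_dual_map(1)[OF B] _ fd[OF I]] by blast
    then have "x \<in> J" using ad.tform_dual_map(3)[OF B x(2)] ad.tform_commute by (simp add: J_def)
    then show ?thesis using x(1) by blast
  qed
  moreover have "x = 0" if x: "x \<in> J" "\<And>y. y \<in> J \<Longrightarrow> tform x y = 0" for x
  proof -
    define R where "R = J \<inter> {x. \<forall>y\<in>J. tform x y = 0}"
    have R: "lie_ideal R" unfolding R_def by (intro lie_ideal_Int J tform_orthogonal_ideal)
    have "lie_solvable R"
    proof (rule cartan_criterion[OF lie_ideal_subalgebra[OF R] fd[OF R]])
      show "tform a b = 0" if "a \<in> R" "b \<in> R" for a b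
        using that by (simp add: R_def)
      show "a = 0" if "a \<in> R" "\<And>w. w \<in> W \<Longrightarrow> \<rho> a w = 0" for a
      proof -
        have "a \<in> I \<inter> J" using that by (simp add: R_def I_def)
        then show ?thesis using IJ by blast
      qed
    qed
    then have "R = {0}" using zero R by blast
    moreover have "x \<in> R" using x by (simp add: R_def)
    ultimately show ?thesis by blast
  qed
  ultimately show ?thesis using that J by blast
qed

text \<open>The family \<open>y\<close> is the basis of \<open>J\<close> dual to \<open>B\<close>
  for the trace form. The operator commutes with the action because \<open>x\<close> acts on the two
  bases by matrices that are negative transposes of each other.\<close>

lemma casimir:
  assumes ss: "semisimple_lie_algebra TYPE('g)" and nt: "\<exists>x. \<exists>w\<in>W. \<rho> x w \<noteq> 0"
  obtains B :: "'g set" and y where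
    "\<And>x v. (\<Sum>b\<in>B. \<rho> b (\<rho> (y b) (\<rho> x v))) = \<rho> x (\<Sum>b\<in>B. \<rho> b (\<rho> (y b) v))"
    "trace_on W (\<lambda>v. \<Sum>b\<in>B. \<rho> b (\<rho> (y b) v)) \<noteq> 0"
proof -
  obtain J where J: "lie_ideal J" "J \<noteq> {0}"
    and nd: "\<And>x. x \<in> J \<Longrightarrow> (\<And>y. y \<in> J \<Longrightarrow> tform x y = 0) \<Longrightarrow> x = 0"
    using nondegenerate_ideal[OF ss nt] by metis
  have Js: "csubspace J" using J by (simp add: lie_ideal_def)
  have fJ: "fin_dim J" using Js semisimple_fin_dim[OF ss] by blast
  obtain B where B: "is_basis B J" using fin_dim_basis[OF fJ Js] .
  have fB: "finite B" and BJ: "\<And>b. b \<in> B \<Longrightarrow> b \<in> J" and ind: "complex_vs.independent B"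
    using B is_basis_subset[OF B] by (auto simp: is_basis_def)
  let ?f = "\<lambda>x. \<Sum>b\<in>B. tform b x *\<^sub>C b"
  have inj: "x = 0" if "x \<in> J" "?f x = 0" for x
    using nd[OF that(1)] tform_dual_map(3)[OF B that(2)] tform_commute by metis
  have surj: "?f ` J = J"
    using tform_dual_map(1,2)[OF B] inj by (intro injective_endo_surj[OF fJ]) auto
  \<comment> \<open>\<open>?f y\<close> lists the pairings of \<open>y\<close> with
    \<open>B\<close>; the preimage of \<open>b\<close> therefore pairs to 1 with \<open>b\<close>
    and to 0 with the other basis vectors.\<close>
  have "\<forall>b\<in>B. \<exists>y\<in>J. ?f y = b"
  proof
    fix b assume "b \<in> B"
    then have "b \<in> ?f ` J" unfolding surj by (rule BJ)
    then show "\<exists>y\<in>J. ?f y = b" by blast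
  qed
  then obtain y where y: "\<And>b. b \<in> B \<Longrightarrow> y b \<in> J" "\<And>b. b \<in> B \<Longrightarrow> ?f (y b) = b" by metis
  have dual: "tform c (y b) = (if c = b then 1 else 0)" if "b \<in> B" "c \<in> B" for b c
  proof -
    have "(\<Sum>c\<in>B. (tform c (y b) - (if c = b then 1 else 0)) *\<^sub>C c) = ?f (y b) - (\<Sum>c\<in>B. (if c = b then b else 0))"
      unfolding complex_vs.scale_left_diff_distrib sum_subtractf
      by (intro arg_cong2[of _ _ _ _ minus] sum.cong) (auto simp: scaleC_one)
    also have "\<dots> = 0" using y(2)[OF that(1)] that fB by simp
    finally have "tform c (y b) - (if c = b then 1 else 0) = 0"
      using complex_vs.independentD[OF ind fB order_refl _ that(2),
          of "\<lambda>c. tform c (y b) - (if c = b then 1 else 0)"] by simp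
    then show ?thesis by simp
  qed
  have exp1: "z = (\<Sum>c\<in>B. tform z (y c) *\<^sub>C c)" if "z \<in> J" for z
  proof -
    let ?d = "z - (\<Sum>c\<in>B. tform z (y c) *\<^sub>C c)"
    have co: "(\<Sum>c\<in>B. coord B z c *\<^sub>C c) = z" using coord_sum_eq[OF B that] .
    have "tform z (y b) = coord B z b" if "b \<in> B" for b
    proof -
      have "tform z (y b) = tform (\<Sum>c\<in>B. coord B z c *\<^sub>C c) (y b)" using co by simp
      also have "\<dots> = (\<Sum>c\<in>B. coord B z c * tform c (y b))"
        by (simp add: clinear_sum[OF tform_linear(2)] tform_scale_left)
      also have "\<dots> = (\<Sum>c\<in>B. if c = b then coord B z b else 0)"
        using dual that by (intro sum.cong) auto
      finally show ?thesis using that fB by simp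
    qed
    then show ?thesis using co by simp
  qed
  have exp2: "z = (\<Sum>c\<in>B. tform c z *\<^sub>C y c)" if "z \<in> J" for z
  proof -
    let ?s = "\<Sum>c\<in>B. tform c z *\<^sub>C y c"
    have sJ: "?s \<in> J" using y Js by (intro complex_vs.subspace_sum complex_vs.subspace_scale) auto
    have "tform b ?s = tform b z" if "b \<in> B" for b
    proof -
      have "tform b ?s = (\<Sum>c\<in>B. tform c z * tform b (y c))"
        by (simp add: clinear_sum[OF tform_linear(1)] tform_scale_right)
      also have "\<dots> = (\<Sum>c\<in>B. if c = b then tform b z else 0)"
        using dual that by (intro sum.cong) auto
      finally show ?thesis using that fB by simp
    qed
    then have "?f (z - ?s) = 0" by (simp add: clinear_diff[OF tform_linear(1)])
    moreover have "z - ?s \<in> J" using that sJ Js by (rule_tac complex_vs.subspace_diff)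
    ultimately have "z - ?s = 0" using inj by blast
    then show ?thesis by simp
  qed
  have comm: "(\<Sum>b\<in>B. \<rho> b (\<rho> (y b) (\<rho> x v))) = \<rho> x (\<Sum>b\<in>B. \<rho> b (\<rho> (y b) v))" for x v
  proof -
    \<comment> \<open>The matrix of the bracket with \<open>x\<close> in the basis \<open>B\<close>;
      by invariance of the form, its negative transpose describes the bracket on the dual
      basis.\<close>
    define m where "m b c = tform (lie_bracket x b) (y c)" for b c
    have 1: "\<rho> (lie_bracket x b) (\<rho> (y b) v) = (\<Sum>c\<in>B. m b c *\<^sub>C \<rho> c (\<rho> (y b) v))" if "b \<in> B" for b
    proof -
      have "lie_bracket x b \<in> J" using J BJ[OF that] by (simp add: lie_ideal_def)
      then have e: "lie_bracket x b = (\<Sum>c\<in>B. m b c *\<^sub>C c)" unfolding m_def by (rule exp1)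
      show ?thesis unfolding e by (simp add: clinear_sum[OF clinear_rho] rho_scale)
    qed
    have 2: "\<rho> b (\<rho> (lie_bracket x (y b)) v) = - (\<Sum>c\<in>B. m c b *\<^sub>C \<rho> b (\<rho> (y c) v))" if "b \<in> B" for b
    proof -
      have "lie_bracket x (y b) \<in> J" using J y(1)[OF that] by (simp add: lie_ideal_def)
      then have "lie_bracket x (y b) = (\<Sum>c\<in>B. tform c (lie_bracket x (y b)) *\<^sub>C y c)" by (rule exp2)
      moreover have "tform c (lie_bracket x (y b)) = - m c b" for c
        unfolding m_def using tform_invariant[of c x "y b"] lie_bracket_anti[of c x] clinear_neg[OF tform_linear(2)] by metis
      ultimately have e: "lie_bracket x (y b) = (\<Sum>c\<in>B. - m c b *\<^sub>C y c)" by simp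
      show ?thesis unfolding e
        by (simp add: clinear_sum[OF clinear_rho] clinear_sum[OF lin] rho_scale clinear_scale[OF lin] sum_negf
          clinear_neg[OF clinear_rho] clinear_neg[OF lin])
    qed
    have "\<rho> x (\<Sum>b\<in>B. \<rho> b (\<rho> (y b) v)) - (\<Sum>b\<in>B. \<rho> b (\<rho> (y b) (\<rho> x v)))
      = (\<Sum>b\<in>B. \<rho> (lie_bracket x b) (\<rho> (y b) v) + \<rho> b (\<rho> (lie_bracket x (y b)) v))"
      unfolding rho_bracket clinear_diff[OF lin] clinear_sum[OF lin] by (simp add: sum_subtractf sum.distrib)
    also have "\<dots> = (\<Sum>b\<in>B. \<Sum>c\<in>B. m b c *\<^sub>C \<rho> c (\<rho> (y b) v)) - (\<Sum>b\<in>B. \<Sum>c\<in>B. m c b *\<^sub>C \<rho> b (\<rho> (y c) v))"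
      by (simp add: 1 2 sum.distrib sum_negf sum_subtractf)
    also have "\<dots> = 0" by (subst sum.swap) simp
    finally show ?thesis by simp
  qed
  \<comment> \<open>Each dual pair contributes 1, so the trace is the dimension of \<open>J\<close>,
    nonzero in characteristic 0.\<close>
  have "trace_on W (\<lambda>v. \<Sum>b\<in>B. \<rho> b (\<rho> (y b) v)) = (\<Sum>b\<in>B. tform b (y b))"
    unfolding tform_def by (rule trace_on_sum[OF fin fB comp_lin])
  also have "\<dots> = of_nat (card B)" using dual by simp
  also have "\<dots> \<noteq> (0 :: complex)" using J(2) B fB by (auto simp: is_basis_def)
  finally show ?thesis using that[OF comm] by blast
qed

end

section \<open>Invariants and coinvariants\<close>

definition invariants :: "'v::complex_vs set \<Rightarrow> ('g \<Rightarrow> 'v \<Rightarrow> 'v) \<Rightarrow> 'v set" where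
  "invariants W \<rho> = {w \<in> W. \<forall>x. \<rho> x w = 0}"

definition moved :: "'v::complex_vs set \<Rightarrow> ('g \<Rightarrow> 'v \<Rightarrow> 'v) \<Rightarrow> 'v set" where
  "moved W \<rho> = cspan {\<rho> x w | x w. w \<in> W}"

lemma moved_mono: "U \<subseteq> W \<Longrightarrow> moved U \<rho> \<subseteq> moved W \<rho>"
  unfolding moved_def by (intro complex_vs.span_mono) blast

text \<open>The Casimir operator \<open>C\<close> is invertible on eigenspaces of nonzero eigenvalue
  and is a sum of products of operators of the action, so these eigenspaces lie in
  \<open>moved W \<rho>\<close>. The eigenspace \<open>M0\<close> for 0 is a smaller module, to
  which the induction hypothesis applies.\<close>

theorem invariants_moved:
  fixes \<rho> :: "'g::lie_algebra \<Rightarrow> 'v::complex_vs \<Rightarrow> 'v"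
  assumes ss: "semisimple_lie_algebra TYPE('g)" and "lie_rep W \<rho>"
  shows "(\<forall>w\<in>W. \<exists>u\<in>invariants W \<rho>. \<exists>v\<in>moved W \<rho>. w = u + v) \<and> invariants W \<rho> \<inter> moved W \<rho> \<subseteq> {0}"
  using assms(2)
proof (induction "complex_vs.dim W" arbitrary: W rule: less_induct)
  case less
  interpret lie_rep W \<rho> by (rule less.prems)
  show ?case
  proof (cases "\<exists>x. \<exists>w\<in>W. \<rho> x w \<noteq> 0")
    case False
    then have "moved W \<rho> \<subseteq> {0}"
      unfolding moved_def by (intro complex_vs.span_minimal) auto
    moreover have "0 \<in> moved W \<rho>" by (simp add: moved_def complex_vs.span_zero)
    moreover have "invariants W \<rho> = W" using False by (auto simp: invariants_def)
    ultimately show ?thesis by (metis Int_lower2 add.right_neutral order_trans)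
  next
    case True
    obtain B y where
      comm: "\<And>x v. (\<Sum>b\<in>B. \<rho> b (\<rho> (y b) (\<rho> x v))) = \<rho> x (\<Sum>b\<in>B. \<rho> b (\<rho> (y b) v))"
      and tr: "trace_on W (\<lambda>v. \<Sum>b\<in>B. \<rho> b (\<rho> (y b) v)) \<noteq> 0"
      by (rule casimir[OF ss True]) (rule that)
    define C where "C v = (\<Sum>b\<in>B. \<rho> b (\<rho> (y b) v))" for v
    have C: "clinear C"
      by (intro clinearI) (simp_all add: C_def clinear_add[OF lin] clinear_scale[OF lin] sum.distrib complex_vs.scale_sum_right)
    have CW: "C ` W \<subseteq> W" using inv sub by (auto simp: C_def intro!: complex_vs.subspace_sum)
    have C\<rho>: "\<rho> x (C v) = C (\<rho> x v)" for x v using comm by (simp add: C_def)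
    note ge = fin C CW
    define M0 where "M0 = geig W C 0"
    define X where "X = (\<Union>\<nu>\<in>-{0}. geig W C \<nu>)"
    define M1 where "M1 = cspan X"
    have M0W: "M0 \<subseteq> W" by (auto simp: M0_def geig_def)
    have M0s: "csubspace M0" unfolding M0_def by (rule geig_subspace[OF ge])
    have M1s: "csubspace M1" by (simp add: M1_def)
    have XW: "X \<subseteq> W" by (auto simp: X_def geig_def)
    then have M1W: "M1 \<subseteq> W" unfolding M1_def using sub by (intro complex_vs.span_minimal)
    have geig\<rho>: "\<rho> x w \<in> geig W C \<nu>" if "w \<in> geig W C \<nu>" for x w \<nu>
      using geig_commute[OF ge that lin] that inv C\<rho> by (auto simp: geig_def)
    have M1\<rho>: "\<rho> x w \<in> M1" if "w \<in> M1" for x w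
    proof -
      have "X \<subseteq> {w. \<rho> x w \<in> X}" using geig\<rho> by (auto simp: X_def)
      then have "X \<subseteq> {w. \<rho> x w \<in> M1}" using complex_vs.span_superset[of X] by (auto simp: M1_def)
      moreover have "csubspace {w. \<rho> x w \<in> M1}" using cvs_pair.linear_subspace_linear_preimage[OF lin M1s] .
      ultimately have "M1 \<subseteq> {w. \<rho> x w \<in> M1}" unfolding M1_def by (rule complex_vs.span_minimal)
      then show ?thesis using that by blast
    qed
    \<comment> \<open>Otherwise \<open>C\<close> would be nilpotent and its trace zero.\<close>
    have "M0 \<noteq> W"
    proof
      assume "M0 = W"
      then have "trace_on W C = 0"
        by (intro trace_on_nilpotent[OF ge]) (auto simp: M0_def geig_def)
      then show False using tr by (simp add: C_def[abs_def])
    qed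
    then have dim: "complex_vs.dim M0 < complex_vs.dim W" using dim_strict_mono[OF fin M0s] M0W by blast
    have "lie_rep M0 \<rho>"
      using geig\<rho> fin_dim_subspace[OF fin M0s M0W] by (intro lie_rep.intro)
        (auto simp: lin rho_add rho_scale rho_bracket M0_def)
    note IH = less.hyps[OF dim this]
    have sum: "\<exists>a\<in>M0. \<exists>b\<in>M1. w = a + b" if "w \<in> W" for w
    proof -
      have "(\<Union>\<mu>. geig W C \<mu>) \<subseteq> M0 \<union> X" by (auto simp: M0_def X_def)
      then have "W \<subseteq> cspan (M0 \<union> X)"
        by (intro ord_eq_le_trans[OF span_geig[OF ge]] complex_vs.span_mono)
      also have "cspan (M0 \<union> X) = {a + b | a b. a \<in> M0 \<and> b \<in> M1}"
        using M0s by (simp add: complex_vs.span_Un M1_def complex_vs.span_eq_iff[THEN iffD2])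
      finally show ?thesis using that by blast
    qed
    have M1m: "M1 \<subseteq> moved W \<rho>"
      unfolding M1_def
    proof (rule complex_vs.span_minimal)
      show "X \<subseteq> moved W \<rho>"
      proof
        fix w assume "w \<in> X"
        then obtain \<nu> where "w \<in> geig W C \<nu>" "0 \<noteq> \<nu>" by (auto simp: X_def)
        then obtain u where "u \<in> geig W C \<nu>" "C u = w" using geig_shift_surj[OF ge, of 0 \<nu> w] by auto
        then have u: "u \<in> W" "w = (\<Sum>b\<in>B. \<rho> b (\<rho> (y b) u))" by (auto simp: C_def geig_def)
        have "\<rho> b (\<rho> (y b) u) \<in> moved W \<rho>" for b
          unfolding moved_def using inv[OF u(1)] by (intro complex_vs.span_base) blast
        then show "w \<in> moved W \<rho>"
          unfolding u(2) moved_def by (intro complex_vs.span_sum)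
      qed
    qed (simp add: moved_def)
    have ex: "\<exists>u\<in>invariants W \<rho>. \<exists>v\<in>moved W \<rho>. w = u + v" if w: "w \<in> W" for w
    proof -
      obtain a b where ab: "a \<in> M0" "b \<in> M1" "w = a + b" using sum[OF w] by blast
      obtain u v where uv: "u \<in> invariants M0 \<rho>" "v \<in> moved M0 \<rho>" "a = u + v" using IH ab(1) by blast
      have "u \<in> invariants W \<rho>" using uv M0W by (auto simp: invariants_def)
      moreover have "v + b \<in> moved W \<rho>"
        using uv(2) moved_mono[OF M0W, of \<rho>] ab(2) M1m unfolding moved_def by (intro complex_vs.span_add) auto
      ultimately show ?thesis using ab uv by (metis add.assoc)
    qed
    \<comment> \<open>\<open>C\<close> kills an invariant vector, so \<open>u\<close> lies in
      \<open>M0\<close>; as \<open>moved W \<rho>\<close> is contained in the sum of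
      \<open>moved M0 \<rho>\<close> and \<open>M1\<close>, and \<open>M0\<close> meets
      \<open>M1\<close> in zero, \<open>u\<close> is in \<open>moved M0 \<rho>\<close>.\<close>
    have disj: "u = 0" if u: "u \<in> invariants W \<rho>" "u \<in> moved W \<rho>" for u
    proof -
      let ?S = "{a + b | a b. a \<in> moved M0 \<rho> \<and> b \<in> M1}"
      have "csubspace ?S" using M1s by (intro complex_vs.subspace_sums) (simp_all add: moved_def)
      moreover have "{\<rho> x w | x w. w \<in> W} \<subseteq> ?S"
      proof safe
        fix x w assume "w \<in> W"
        then obtain a b where ab: "a \<in> M0" "b \<in> M1" "w = a + b" using sum by blast
        then have "\<rho> x w = \<rho> x a + \<rho> x b" by (simp add: clinear_add[OF lin])
        moreover have "\<rho> x a \<in> moved M0 \<rho>" unfolding moved_def using ab by (intro complex_vs.span_base) auto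
        ultimately show "\<exists>a b. \<rho> x w = a + b \<and> a \<in> moved M0 \<rho> \<and> b \<in> M1" using M1\<rho>[OF ab(2)] by blast
      qed
      ultimately have "moved W \<rho> \<subseteq> ?S" unfolding moved_def[of W] by (intro complex_vs.span_minimal)
      then obtain a b where ab: "u = a + b" "a \<in> moved M0 \<rho>" "b \<in> M1" using u by blast
      have "C u = 0" using u by (simp add: C_def invariants_def clinear_0[OF lin])
      then have "(shift C 0 ^^ 1) u = 0" by simp
      then have u0: "u \<in> M0" using u(1) unfolding M0_def geig_def invariants_def by blast
      have "moved M0 \<rho> \<subseteq> M0" unfolding moved_def using geig\<rho> M0s by (intro complex_vs.span_minimal) (auto simp: M0_def)
      then have "a \<in> M0" using ab by blast
      then have "b \<in> M0" using complex_vs.subspace_diff[OF M0s u0] ab(1) by (metis add_diff_cancel_left')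
      then have "b = 0" using geig_0_complement[OF ge] ab(3) by (simp add: M0_def M1_def X_def)
      then have "u \<in> moved M0 \<rho>" using ab by simp
      moreover have "u \<in> invariants M0 \<rho>" using u(1) u0 by (simp add: invariants_def)
      ultimately show ?thesis using IH by blast
    qed
    show ?thesis using ex disj by blast
  qed
qed

section \<open>Modules over the Lie algebra\<close>

text \<open>In contrast to \<open>clinear\<close>, this says nothing outside the carrier, where the
  values of a module action are arbitrary.\<close>

definition lin_on :: "'a::complex_vs set \<Rightarrow> ('a \<Rightarrow> 'b::complex_vs) \<Rightarrow> bool" where
  "lin_on W f \<longleftrightarrow> (\<forall>v\<in>W. \<forall>w\<in>W. f (v + w) = f v + f w) \<and> (\<forall>c. \<forall>v\<in>W. f (c *\<^sub>C v) = c *\<^sub>C f v)"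

lemma lin_on_add: "lin_on W f \<Longrightarrow> v \<in> W \<Longrightarrow> w \<in> W \<Longrightarrow> f (v + w) = f v + f w"
  and lin_on_scale: "lin_on W f \<Longrightarrow> v \<in> W \<Longrightarrow> f (c *\<^sub>C v) = c *\<^sub>C f v"
  by (auto simp: lin_on_def)

lemma lin_on_0: "lin_on W f \<Longrightarrow> csubspace W \<Longrightarrow> f 0 = 0"
  using lin_on_scale[of W f 0 0] by (simp add: complex_vs.subspace_0)

lemma lin_on_diff: "lin_on W f \<Longrightarrow> csubspace W \<Longrightarrow> v \<in> W \<Longrightarrow> w \<in> W \<Longrightarrow> f (v - w) = f v - f w"
  using lin_on_add[of W f "v - w" w] by (simp add: complex_vs.subspace_diff)

lemma lin_on_sum:
  assumes "lin_on W f" "csubspace W" "\<And>i. i \<in> I \<Longrightarrow> g i \<in> W"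
  shows "f (\<Sum>i\<in>I. g i) = (\<Sum>i\<in>I. f (g i))"
  using assms(3)
proof (induction I rule: infinite_finite_induct)
  case (insert x I)
  then have "sum g I \<in> W" by (intro complex_vs.subspace_sum assms(2)) auto
  then show ?case using insert lin_on_add[OF assms(1), of "g x" "sum g I"] by simp
qed (simp_all add: lin_on_0[OF assms(1,2)])

lemma lin_on_image_subspace:
  assumes "lin_on W f" "csubspace W"
  shows "csubspace (f ` W)"
proof (rule complex_vs.subspaceI)
  show "0 \<in> f ` W" using lin_on_0[OF assms] complex_vs.subspace_0[OF assms(2)] image_eqI by metis
  fix x y assume "x \<in> f ` W" "y \<in> f ` W"
  then obtain a b where "x = f a" "y = f b" "a \<in> W" "b \<in> W" by blast
  then have "x + y = f (a + b)" "a + b \<in> W"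
    using lin_on_add[OF assms(1)] complex_vs.subspace_add[OF assms(2)] by simp_all
  then show "x + y \<in> f ` W" by blast
next
  fix c x assume "x \<in> f ` W"
  then obtain a where "x = f a" "a \<in> W" by blast
  then have "c *\<^sub>C x = f (c *\<^sub>C a)" "c *\<^sub>C a \<in> W"
    using lin_on_scale[OF assms(1)] complex_vs.subspace_scale[OF assms(2)] by simp_all
  then show "c *\<^sub>C x \<in> f ` W" by blast
qed

lemma projection_exists:
  assumes "csubspace W"
  obtains P where "clinear P" "\<And>v. P v \<in> W" "\<And>w. w \<in> W \<Longrightarrow> P w = w"
proof -
  have "clinear (\<lambda>v :: 'a. v)" by (intro clinearI) auto
  from cvs_pair.linear_exists_left_inverse_on[OF this assms] show ?thesis using that by auto
qed

locale lie_mod =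
  fixes V :: "('g::lie_algebra, 'v::complex_vs) lmodule"
  assumes V: "lie_module V"
begin

lemma sub: "csubspace (carrier V)"
  and closed: "v \<in> carrier V \<Longrightarrow> act V x v \<in> carrier V"
  and act_lin: "lin_on (carrier V) (act V x)"
  and act_add_left: "v \<in> carrier V \<Longrightarrow> act V (x + y) v = act V x v + act V y v"
  and act_scale_left: "v \<in> carrier V \<Longrightarrow> act V (c *\<^sub>C x) v = c *\<^sub>C act V x v"
  and act_bracket: "v \<in> carrier V \<Longrightarrow> act V (lie_bracket x y) v = act V x (act V y v) - act V y (act V x v)"
  using V by (auto simp: lie_module_def lin_on_def)

text \<open>Composing the action with a linear projection onto the carrier turns it into total
  linear operators without changing it on the carrier.\<close>

lemma lie_rep_exists:
  assumes "fin_dim (carrier V)"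
  obtains \<rho> where "lie_rep (carrier V) \<rho>" "\<And>x v. v \<in> carrier V \<Longrightarrow> \<rho> x v = act V x v"
proof -
  obtain P where P: "clinear P" "\<And>v. P v \<in> carrier V" "\<And>w. w \<in> carrier V \<Longrightarrow> P w = w"
    by (rule projection_exists[OF sub]) (rule that)
  have "lie_rep (carrier V) (\<lambda>x v. act V x (P v))"
    by (intro lie_rep.intro clinearI)
      (simp_all add: assms P closed act_add_left act_scale_left act_bracket clinear_add[OF P(1)] clinear_scale[OF P(1)]
        lin_on_add[OF act_lin] lin_on_scale[OF act_lin])
  then show ?thesis using that P(3) by fastforce
qed

theorem decomposition:
  assumes "semisimple_lie_algebra TYPE('g)" "fin_dim (carrier V)"
  shows "v \<in> carrier V \<Longrightarrow> \<exists>u\<in>invariants (carrier V) (act V). \<exists>w\<in>moved (carrier V) (act V). v = u + w"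
    and "u \<in> invariants (carrier V) (act V) \<Longrightarrow> u \<in> moved (carrier V) (act V) \<Longrightarrow> u = 0"
proof -
  obtain \<rho> where \<rho>: "lie_rep (carrier V) \<rho>" "\<And>x v. v \<in> carrier V \<Longrightarrow> \<rho> x v = act V x v"
    using lie_rep_exists[OF assms(2)] by blast
  have "invariants (carrier V) \<rho> = invariants (carrier V) (act V)"
    using \<rho>(2) by (auto simp: invariants_def)
  moreover have "{\<rho> x w | x w. w \<in> carrier V} = {act V x w | x w. w \<in> carrier V}"
    by (simp add: \<rho>(2) cong: rev_conj_cong)
  then have "moved (carrier V) \<rho> = moved (carrier V) (act V)" by (simp add: moved_def)
  ultimately show "v \<in> carrier V \<Longrightarrow> \<exists>u\<in>invariants (carrier V) (act V). \<exists>w\<in>moved (carrier V) (act V). v = u + w"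
    and "u \<in> invariants (carrier V) (act V) \<Longrightarrow> u \<in> moved (carrier V) (act V) \<Longrightarrow> u = 0"
    using invariants_moved[OF assms(1) \<rho>(1)] by auto
qed

end

section \<open>The action of the universal enveloping algebra\<close>

lemma poly_mapping_add_induct [case_names single add]:
  assumes "\<And>k c. P (Poly_Mapping.single k c)" "\<And>p q. P p \<Longrightarrow> P q \<Longrightarrow> P (p + q)"
  shows "P (p :: 'k \<Rightarrow>\<^sub>0 'c::monoid_add)"
proof (induction p rule: update_induct)
  case const
  show ?case using assms(1)[of undefined 0] by simp
next
  case (update f a b)
  have "Poly_Mapping.update a b f = f + Poly_Mapping.single a b"
    by (rule poly_mapping_eqI)
      (use update in \<open>auto simp: lookup_update lookup_add lookup_single when_def in_keys_iff\<close>)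
  then show ?case using update assms by simp
qed

lemma abs_rep_uea: "abs_uea (rep_uea u) = u"
  by (rule Quotient3_abs_rep[OF Quotient3_uea])

lemma uea_cases: obtains p where "u = abs_uea p"
  using abs_rep_uea[of u] by metis

lemma single_scalar_central: "Poly_Mapping.single 0 c * p = p * Poly_Mapping.single 0 (c :: complex)"
  for p :: "'k::monoid_add \<Rightarrow>\<^sub>0 complex"
  by (induction p rule: poly_mapping_add_induct) (simp_all add: mult_single mult.commute distrib_left distrib_right)

instantiation uea :: (lie_algebra) complex_vs
begin

definition "scaleC_uea c (u :: 'a uea) = abs_uea (Poly_Mapping.single 0 c) * u"

instance
proof
  fix b c :: complex and x y :: "'a uea"
  show "c *\<^sub>C (x + y) = c *\<^sub>C x + c *\<^sub>C y" by (simp add: scaleC_uea_def distrib_left)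
  show "(b + c) *\<^sub>C x = b *\<^sub>C x + c *\<^sub>C x"
    by (simp add: scaleC_uea_def single_add plus_uea.abs_eq[symmetric] distrib_right)
  show "b *\<^sub>C c *\<^sub>C x = (b * c) *\<^sub>C x"
    by (simp add: scaleC_uea_def mult.assoc[symmetric] times_uea.abs_eq mult_single)
  show "1 *\<^sub>C x = x"
    by (simp add: scaleC_uea_def one_uea_def[symmetric])
qed

end

definition uea_of :: "'g::lie_algebra \<Rightarrow> 'g uea" where
  "uea_of x = abs_uea (letter x)"

lemma scaleC_uea_left: "c *\<^sub>C u * v = c *\<^sub>C (u * v)" for u v :: "'g::lie_algebra uea"
  by (simp add: scaleC_uea_def mult.assoc)

lemma scaleC_uea_right: "u * c *\<^sub>C v = c *\<^sub>C (u * v)" for u v :: "'g::lie_algebra uea"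
proof -
  have "u * abs_uea (Poly_Mapping.single 0 c) = abs_uea (Poly_Mapping.single 0 c) * u"
    using abs_rep_uea[of u] single_scalar_central[of c "rep_uea u"] by (metis times_uea.abs_eq)
  then show ?thesis by (simp add: scaleC_uea_def mult.assoc[symmetric])
qed

text \<open>Words are peeled from the left, in the order in which \<open>foldr\<close> applies their
  letters on a left module.\<close>

lemma uea_induct [case_names add scalar letter]:
  assumes add: "\<And>a b. P a \<Longrightarrow> P b \<Longrightarrow> P (a + b)" and scalar: "\<And>c. P (c *\<^sub>C 1)"
    and letter: "\<And>x a. P a \<Longrightarrow> P (uea_of x * a)"
  shows "P (u :: 'g::lie_algebra uea)"
proof -
  have "P (abs_uea p)" for p
  proof (induction p rule: poly_mapping_add_induct)
    case (single w c)
    have "P (abs_uea (Poly_Mapping.single (FWord ws) c))" for ws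
    proof (induction ws)
      case Nil
      show ?case using scalar[of c] by (simp add: scaleC_uea_def zero_fword_def)
    next
      case (Cons x ws)
      have "Poly_Mapping.single (FWord (x # ws)) c = letter x * Poly_Mapping.single (FWord ws) c"
        by (simp add: mult_single plus_fword_def)
      then show ?case using letter[OF Cons, of x] by (simp add: uea_of_def times_uea.abs_eq)
    qed
    then show ?case by (metis fword.collapse)
  next
    case (add p q)
    then show ?case using assms(1)[OF add] by (simp add: plus_uea.abs_eq)
  qed
  then show ?thesis using abs_rep_uea by metis
qed

lemma uea_of_add: "uea_of (x + y) = uea_of x + uea_of y"
proof -
  have "uea_rel (letter (x + y)) (letter x + letter y)"
    using uea_ideal.rel_add[of x y] by (simp add: uea_rel_def algebra_simps)
  then show ?thesis by (simp add: uea_of_def plus_uea.abs_eq uea.abs_eq_iff)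
qed

lemma uea_of_scale: "uea_of (c *\<^sub>C x) = c *\<^sub>C uea_of x"
  using uea_ideal.rel_scale[of c x]
  by (simp add: uea_of_def scaleC_uea_def times_uea.abs_eq uea.abs_eq_iff uea_rel_def)

lemma uea_of_bracket: "uea_of (lie_bracket x y) = uea_of x * uea_of y - uea_of y * uea_of x"
proof -
  have "uea_rel (letter x * letter y - letter y * letter x) (letter (lie_bracket x y))"
    using uea_ideal.rel_bracket[of x y] by (simp add: uea_rel_def)
  then show ?thesis by (simp add: uea_of_def times_uea.abs_eq minus_uea.abs_eq uea.abs_eq_iff[symmetric])
qed

text \<open>The formula of \<open>uea_lmodule\<close> for an arbitrary element of the free algebra,
  which allows computing before an unknown representative is chosen by
  \<open>rep_uea\<close>.\<close>

definition free_act :: "('g, 'v::complex_vs) lmodule \<Rightarrow> ('g fword \<Rightarrow>\<^sub>0 complex) \<Rightarrow> 'v \<Rightarrow> 'v" where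
  "free_act V p v = (\<Sum>w\<in>Poly_Mapping.keys p. Poly_Mapping.lookup p w *\<^sub>C foldr (act V) (letters w) v)"

lemma free_act_superset:
  assumes "finite A" "Poly_Mapping.keys p \<subseteq> A"
  shows "free_act V p v = (\<Sum>w\<in>A. Poly_Mapping.lookup p w *\<^sub>C foldr (act V) (letters w) v)"
  unfolding free_act_def using assms by (intro sum.mono_neutral_left) (auto simp: in_keys_iff)

lemma free_act_add: "free_act V (p + q) v = free_act V p v + free_act V q v"
  using keys_add[of p q]
  by (simp add: free_act_superset[of "Poly_Mapping.keys p \<union> Poly_Mapping.keys q"] lookup_add scaleC_add_left sum.distrib)

lemma free_act_0: "free_act V 0 v = 0"
  by (simp add: free_act_def)

lemma free_act_diff: "free_act V (p - q) v = free_act V p v - free_act V q v"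
  using free_act_add[of V "p - q" q v] by simp

lemma free_act_single: "free_act V (Poly_Mapping.single w c) v = c *\<^sub>C foldr (act V) (letters w) v"
  by (cases "c = 0") (simp_all add: free_act_def)

lemma act_uea_lmodule: "act (uea_lmodule V) u v = free_act V (rep_uea u) v"
  by (simp add: uea_lmodule_def free_act_def)

lemma carrier_uea_lmodule [simp]: "carrier (uea_lmodule V) = carrier V"
  by (simp add: uea_lmodule_def)

context lie_mod
begin

lemma word_closed: "v \<in> carrier V \<Longrightarrow> foldr (act V) ws v \<in> carrier V"
  by (induction ws) (auto intro: closed)

lemma word_lin: "lin_on (carrier V) (foldr (act V) ws)"
  by (induction ws)
    (simp_all add: lin_on_def word_closed lin_on_add[OF act_lin] lin_on_scale[OF act_lin])

lemma free_act_closed: "v \<in> carrier V \<Longrightarrow> free_act V p v \<in> carrier V"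
  unfolding free_act_def by (intro complex_vs.subspace_sum complex_vs.subspace_scale sub word_closed)

lemma free_act_lin: "lin_on (carrier V) (free_act V p)"
  unfolding lin_on_def free_act_def
  by (simp add: lin_on_add[OF word_lin] lin_on_scale[OF word_lin] scaleC_add_right sum.distrib
      complex_vs.scale_sum_right scaleC_scaleC mult.commute)

lemma free_act_mult:
  assumes v: "v \<in> carrier V"
  shows "free_act V (p * q) v = free_act V p (free_act V q v)"
proof (induction p rule: poly_mapping_add_induct)
  case (single w c)
  show ?case
  proof (induction q rule: poly_mapping_add_induct)
    case (single w' c')
    show ?case
      using v by (simp add: mult_single free_act_single plus_fword_def lin_on_scale[OF word_lin] word_closed scaleC_scaleC)
  next
    case (add p q)
    then show ?case
      using v by (simp add: distrib_left free_act_add lin_on_add[OF free_act_lin] free_act_closed)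
  qed
next
  case (add p q)
  then show ?case by (simp add: distrib_right free_act_add)
qed

lemma free_act_letter: "free_act V (letter x) v = act V x v"
  by (simp add: free_act_single scaleC_one)

lemma free_act_scalar: "free_act V (Poly_Mapping.single 0 c) v = c *\<^sub>C v"
  by (simp add: free_act_single zero_fword_def)

text \<open>The generating relations act as zero by the module axioms. Hence all representatives of
  an element of the enveloping algebra act alike, which is \<open>uact_abs\<close>.\<close>

lemma free_act_ideal: "p \<in> uea_ideal \<Longrightarrow> v \<in> carrier V \<Longrightarrow> free_act V p v = 0"
proof (induction arbitrary: v rule: uea_ideal.induct)
  case (rel_add x y)
  then show ?case by (simp add: free_act_diff free_act_letter act_add_left)
next
  case (rel_scale c x)
  then show ?case by (simp add: free_act_diff free_act_letter free_act_mult free_act_scalar act_scale_left)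
next
  case (rel_bracket x y)
  then show ?case by (simp add: free_act_diff free_act_letter free_act_mult act_bracket)
next
  case (mult_left p r)
  then show ?case using lin_on_0[OF free_act_lin sub] by (simp add: free_act_mult)
next
  case (mult_right p r)
  then show ?case by (simp add: free_act_mult free_act_closed)
qed (simp_all add: free_act_0 free_act_add)

lemma uact_abs: "v \<in> carrier V \<Longrightarrow> act (uea_lmodule V) (abs_uea p) v = free_act V p v"
proof -
  assume v: "v \<in> carrier V"
  have "uea_rel (rep_uea (abs_uea p)) p"
    by (rule Quotient3_rep_abs[OF Quotient3_uea equivp_reflp[OF equivp_uea_rel]])
  then have "rep_uea (abs_uea p) - p \<in> uea_ideal" by (simp add: uea_rel_def)
  then have "free_act V (rep_uea (abs_uea p)) v = free_act V p v"
    using free_act_ideal[OF _ v] by (fastforce simp: free_act_diff)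
  then show ?thesis by (simp add: act_uea_lmodule)
qed

abbreviation uact :: "'g uea \<Rightarrow> 'v \<Rightarrow> 'v" where
  "uact \<equiv> act (uea_lmodule V)"

lemma uact_closed: "v \<in> carrier V \<Longrightarrow> uact u v \<in> carrier V"
  by (simp add: act_uea_lmodule free_act_closed)

lemma uact_lin: "lin_on (carrier V) (uact u)"
  using free_act_lin by (simp add: act_uea_lmodule[abs_def] eta_contract_eq)

lemma uact_add:
  assumes "v \<in> carrier V"
  shows "uact (a + b) v = uact a v + uact b v"
proof -
  obtain p q where "a = abs_uea p" "b = abs_uea q" using uea_cases by metis
  then show ?thesis using assms by (simp add: plus_uea.abs_eq uact_abs free_act_add)
qed

lemma uact_mult:
  assumes "v \<in> carrier V"
  shows "uact (a * b) v = uact a (uact b v)"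
proof -
  obtain p q where "a = abs_uea p" "b = abs_uea q" using uea_cases by metis
  then show ?thesis using assms by (simp add: times_uea.abs_eq uact_abs free_act_mult free_act_closed)
qed

lemma uact_one: "v \<in> carrier V \<Longrightarrow> uact 1 v = v"
  using free_act_scalar[of 1 v] by (simp add: one_uea_def uact_abs scaleC_one flip: single_one)

lemma uact_letter: "v \<in> carrier V \<Longrightarrow> uact (uea_of x) v = act V x v"
  by (simp add: uea_of_def uact_abs free_act_letter)

lemma uact_zero: "v \<in> carrier V \<Longrightarrow> uact 0 v = 0"
  using uact_add[of v 0 0] by simp

lemma uact_diff: "v \<in> carrier V \<Longrightarrow> uact (a - b) v = uact a v - uact b v"
  using uact_add[of v "a - b" b] by simp

lemma uact_scale: "v \<in> carrier V \<Longrightarrow> uact (c *\<^sub>C u) v = c *\<^sub>C uact u v"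
  by (simp add: scaleC_uea_def uact_mult uact_abs free_act_scalar uact_closed)

lemma clinear_uact: "v \<in> carrier V \<Longrightarrow> clinear (\<lambda>u. uact u v)"
  by (intro clinearI) (simp_all add: uact_add uact_scale)

end

lemma uact_equivariant:
  assumes V: "lie_module V" and W: "lie_module W" and f: "lin_on (carrier V) f" "f ` carrier V \<subseteq> carrier W"
    "\<And>x v. v \<in> carrier V \<Longrightarrow> f (act V x v) = act W x (f v)" and v: "v \<in> carrier V"
  shows "f (act (uea_lmodule V) u v) = act (uea_lmodule W) u (f v)"
proof -
  interpret V: lie_mod V by unfold_locales (rule V)
  interpret W: lie_mod W by unfold_locales (rule W)
  have fv: "f v \<in> carrier W" using f(2) v by blast
  show ?thesis
  proof (induction u rule: uea_induct)
    case (add a b)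
    then show ?case using v fv by (simp add: V.uact_add W.uact_add lin_on_add[OF f(1)] V.uact_closed)
  next
    case (scalar c)
    then show ?case using v fv by (simp add: V.uact_scale W.uact_scale V.uact_one W.uact_one lin_on_scale[OF f(1)])
  next
    case (letter x a)
    then show ?case
      using v fv by (simp add: V.uact_mult W.uact_mult V.uact_letter W.uact_letter V.uact_closed W.uact_closed f(3))
  qed
qed

section \<open>The dual module\<close>

lemma sum_fun_apply: "(\<Sum>i\<in>I. f i) x = (\<Sum>i\<in>I. f i x)" for f :: "'i \<Rightarrow> 'a \<Rightarrow> 'b::comm_monoid_add"
  by (induction I rule: infinite_finite_induct) auto

lemma carrier_dual: "carrier (dual_module S) = {f. lin_on (carrier S) f \<and> (\<forall>s. s \<notin> carrier S \<longrightarrow> f s = 0)}"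
  by (auto simp: dual_module_def lin_on_def scaleC_complex_def)

lemma carrier_uea_rmodule [simp]: "carrier (uea_rmodule M) = carrier M"
  by (simp add: uea_rmodule_def)

context lie_mod
begin

text \<open>Acting on a functional from the right by the letters from first to last is
  precomposition with the word acting from the left, its last letter first; so \<open>foldl\<close>
  turns into \<open>foldr\<close> on the same list.\<close>

lemma dual_word:
  assumes "\<And>s. s \<notin> carrier V \<Longrightarrow> f s = 0"
  shows "foldl (ract (dual_module V)) f ws = (\<lambda>s. if s \<in> carrier V then f (foldr (act V) ws s) else 0)"
  using assms
proof (induction ws arbitrary: f)
  case Nil
  then show ?case by auto
next
  case (Cons x ws)
  have r: "ract (dual_module V) f x = (\<lambda>s. if s \<in> carrier V then f (act V x s) else 0)"
    by (simp add: dual_module_def)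
  show ?case
    unfolding foldl.simps r by (subst Cons.IH) (auto simp: word_closed fun_eq_iff)
qed

lemma dual_ract:
  assumes "f \<in> carrier (dual_module V)"
  shows "ract (uea_rmodule (dual_module V)) f u = (\<lambda>s. if s \<in> carrier V then f (uact u s) else 0)"
proof
  fix s
  have f: "lin_on (carrier V) f" "\<And>s. s \<notin> carrier V \<Longrightarrow> f s = 0" using assms by (auto simp: carrier_dual)
  show "ract (uea_rmodule (dual_module V)) f u s = (if s \<in> carrier V then f (uact u s) else 0)"
  proof (cases "s \<in> carrier V")
    case True
    then show ?thesis
      by (simp add: uea_rmodule_def uea_lmodule_def dual_word[OF f(2)] sum_fun_apply scaleC_fun_def
        lin_on_sum[OF f(1) sub] lin_on_scale[OF f(1)] word_closed complex_vs.subspace_scale[OF sub])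
  qed (simp add: uea_rmodule_def dual_word[OF f(2)] sum_fun_apply scaleC_fun_def)
qed

lemma right_module_dual: "right_module (uea_rmodule (dual_module V))"
proof -
  let ?D = "uea_rmodule (dual_module V)"
  have f: "lin_on (carrier V) f" "\<And>s. s \<notin> carrier V \<Longrightarrow> f s = 0" if "f \<in> carrier ?D" for f
    using that by (auto simp: carrier_dual)
  have cl: "ract ?D f u \<in> carrier ?D" if "f \<in> carrier ?D" for f u
    using that f(1)[OF that] sub
    by (simp add: dual_ract) (simp add: carrier_dual lin_on_def uact_closed lin_on_add[OF uact_lin]
        lin_on_scale[OF uact_lin] csubspace_simps)
  have add: "f + g \<in> carrier ?D" "- f \<in> carrier ?D" if "f \<in> carrier ?D" "g \<in> carrier ?D" for f g
    using that by (auto simp: carrier_dual lin_on_def algebra_simps)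
  have 0: "0 \<in> carrier ?D" by (simp add: carrier_dual lin_on_def)
  show ?thesis
    unfolding right_module_def
    using 0 add cl
    by (auto simp: dual_ract fun_eq_iff uact_add uact_mult uact_one uact_closed lin_on_add[OF f(1)] f(2))
qed

end

section \<open>Complete reducibility\<close>

definition lie_hom :: "('v::complex_vs \<Rightarrow> 'w::complex_vs) \<Rightarrow> ('g::lie_algebra, 'v) lmodule \<Rightarrow> ('g, 'w) lmodule \<Rightarrow> bool" where
  "lie_hom f V W \<longleftrightarrow> lin_on (carrier V) f \<and> f ` carrier V \<subseteq> carrier W \<and>
     (\<forall>x. \<forall>v\<in>carrier V. f (act V x v) = act W x (f v))"

lemma lie_submodule_module: "lie_module V \<Longrightarrow> lie_submodule W V \<Longrightarrow> lie_module (V\<lparr>carrier := W\<rparr>)"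
  by (simp add: lie_module_def lie_submodule_def subset_iff)

lemma uact_lie_hom:
  assumes "lie_module V" "lie_module W" "lie_hom f V W" "v \<in> carrier V"
  shows "f (act (uea_lmodule V) u v) = act (uea_lmodule W) u (f v)"
  using assms by (intro uact_equivariant) (auto simp: lie_hom_def)

text \<open>The value 0 outside \<open>W\<close> makes each endomorphism of \<open>W\<close> a
  single function, so that \<open>endos W\<close> is finite-dimensional when \<open>W\<close>
  is.\<close>

definition endos :: "'v::complex_vs set \<Rightarrow> ('v \<Rightarrow> 'v) set" where
  "endos W = {\<phi>. lin_on W \<phi> \<and> (\<forall>v\<in>W. \<phi> v \<in> W) \<and> (\<forall>v. v \<notin> W \<longrightarrow> \<phi> v = 0)}"

definition id_on :: "'v::complex_vs set \<Rightarrow> 'v \<Rightarrow> 'v" where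
  "id_on W v = (if v \<in> W then v else 0)"

text \<open>\<open>comp_module V\<close> is a direct sum of copies of \<open>V\<close>.\<close>

definition end_module :: "('g::lie_algebra, 'v::complex_vs) lmodule \<Rightarrow> ('g, 'v \<Rightarrow> 'v) lmodule" where
  "end_module V = \<lparr>carrier = endos (carrier V),
     act = (\<lambda>x \<phi> v. if v \<in> carrier V then act V x (\<phi> v) - \<phi> (act V x v) else 0)\<rparr>"

definition comp_module :: "('g::lie_algebra, 'v::complex_vs) lmodule \<Rightarrow> ('g, 'v \<Rightarrow> 'v) lmodule" where
  "comp_module V = \<lparr>carrier = endos (carrier V),
     act = (\<lambda>x \<phi> v. if v \<in> carrier V then act V x (\<phi> v) else 0)\<rparr>"

lemma carrier_end_module [simp]: "carrier (end_module V) = endos (carrier V)"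
  and carrier_comp_module [simp]: "carrier (comp_module V) = endos (carrier V)"
  by (simp_all add: end_module_def comp_module_def)

lemma endosD:
  assumes "\<phi> \<in> endos W"
  shows "lin_on W \<phi>" "v \<in> W \<Longrightarrow> \<phi> v \<in> W" "v \<notin> W \<Longrightarrow> \<phi> v = 0"
  using assms by (auto simp: endos_def)

lemma endos_subspace: "csubspace W \<Longrightarrow> csubspace (endos W)"
  by (intro complex_vs.subspaceI)
    (auto simp: endos_def lin_on_def scaleC_fun_def csubspace_simps scaleC_add_right scaleC_scaleC mult.commute
      algebra_simps)

lemma id_on_endos: "csubspace W \<Longrightarrow> id_on W \<in> endos W"
  by (auto simp: endos_def id_on_def lin_on_def csubspace_simps)

text \<open>The coordinate functional of \<open>b\<close> tensored with \<open>c\<close>. For fixed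
  \<open>b\<close> it embeds \<open>W\<close>, as \<open>c\<close> varies, into its
  endomorphisms.\<close>

definition rank_one :: "'v::complex_vs set \<Rightarrow> 'v set \<Rightarrow> 'v \<Rightarrow> 'v \<Rightarrow> 'v \<Rightarrow> 'v" where
  "rank_one W B b c = (\<lambda>v. if v \<in> W then coord B v b *\<^sub>C c else 0)"

lemma rank_one_endos: "is_basis B W \<Longrightarrow> c \<in> W \<Longrightarrow> rank_one W B b c \<in> endos W"
  using is_basis_subspace[of B W]
  by (auto simp: endos_def rank_one_def lin_on_def csubspace_simps coord_add coord_scale scaleC_add_left scaleC_scaleC)

lemma rank_one_clinear: "clinear (rank_one W B b)"
  by (intro clinearI) (auto simp: rank_one_def fun_eq_iff scaleC_add_right scaleC_fun_def scaleC_scaleC mult.commute)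

lemma endos_rank_one_sum:
  assumes B: "is_basis B W" and \<phi>: "\<phi> \<in> endos W"
  shows "\<phi> = (\<Sum>b\<in>B. rank_one W B b (\<phi> b))"
proof
  fix v
  show "\<phi> v = (\<Sum>b\<in>B. rank_one W B b (\<phi> b)) v"
  proof (cases "v \<in> W")
    case True
    have "\<phi> v = \<phi> (\<Sum>b\<in>B. coord B v b *\<^sub>C b)" using coord_sum_eq[OF B True] by simp
    also have "\<dots> = (\<Sum>b\<in>B. coord B v b *\<^sub>C \<phi> b)"
      using is_basis_subset[OF B] is_basis_subspace[OF B] endosD[OF \<phi>]
      by (subst lin_on_sum[of W]) (auto simp: csubspace_simps lin_on_scale subset_iff)
    finally show ?thesis using True by (simp add: sum_fun_apply rank_one_def)
  qed (simp add: endosD[OF \<phi>] sum_fun_apply rank_one_def)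
qed

lemma endos_fin_dim:
  assumes "fin_dim W"
  shows "fin_dim (endos W)"
proof -
  obtain B where B: "is_basis B W" using fin_dim_basis[OF assms fin_dim_csubspace[OF assms]] by blast
  let ?E = "(\<lambda>(b, c). rank_one W B b c) ` (B \<times> B)"
  have fB: "finite B" using B by (simp add: is_basis_def)
  have "\<phi> \<in> cspan ?E" if \<phi>: "\<phi> \<in> endos W" for \<phi>
  proof -
    have "rank_one W B b (\<phi> b) \<in> cspan ?E" if b: "b \<in> B" for b
    proof -
      have "\<phi> b \<in> W" using is_basis_subset[OF B] b endosD(2)[OF \<phi>] by blast
      then have "rank_one W B b (\<phi> b) = (\<Sum>c\<in>B. coord B (\<phi> b) c *\<^sub>C rank_one W B b c)"
        using coord_sum_eq[OF B] clinear_sum[OF rank_one_clinear] clinear_scale[OF rank_one_clinear]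
        by (metis (no_types, lifting) sum.cong)
      also have "\<dots> \<in> cspan ?E"
        using b by (intro complex_vs.span_sum complex_vs.span_scale complex_vs.span_base) auto
      finally show ?thesis .
    qed
    then have "(\<Sum>b\<in>B. rank_one W B b (\<phi> b)) \<in> cspan ?E" by (rule complex_vs.span_sum)
    then show ?thesis using endos_rank_one_sum[OF B \<phi>] by simp
  qed
  moreover have "fin_dim (cspan ?E)" unfolding fin_dim_def using fB by (intro exI[of _ ?E]) simp
  ultimately show ?thesis
    using fin_dim_subspace[OF _ endos_subspace[OF fin_dim_csubspace[OF assms]]] by blast
qed

context lie_mod
begin

lemma end_module_module: "lie_module (end_module V)"
  unfolding lie_module_def
proof (intro conjI allI ballI)
  show "csubspace (carrier (end_module V))" by (simp add: endos_subspace sub)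
  fix x \<phi> assume \<phi>: "\<phi> \<in> carrier (end_module V)"
  then have \<phi>_lin: "lin_on (carrier V) \<phi>" and \<phi>_closed: "\<And>v. v \<in> carrier V \<Longrightarrow> \<phi> v \<in> carrier V"
    by (auto simp: endos_def)
  have "lin_on (carrier V) (act (end_module V) x \<phi>)"
    by (simp add: lin_on_def end_module_def csubspace_simps[OF sub] closed \<phi>_closed lin_on_add[OF act_lin]
        lin_on_scale[OF act_lin] lin_on_add[OF \<phi>_lin] lin_on_scale[OF \<phi>_lin] complex_vs.scale_right_diff_distrib)
  then show "act (end_module V) x \<phi> \<in> carrier (end_module V)"
    by (auto simp: endos_def end_module_def \<phi>_closed closed csubspace_simps[OF sub])
next
qed (auto simp: end_module_def fun_eq_iff endosD closed act_add_left act_scale_left act_bracket scaleC_fun_def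
    lin_on_add[OF act_lin] lin_on_scale[OF act_lin] lin_on_add[OF endosD(1)] lin_on_scale[OF endosD(1)]
    lin_on_diff[OF act_lin sub] lin_on_diff[OF endosD(1) sub] complex_vs.scale_right_diff_distrib)

lemma comp_module_module: "lie_module (comp_module V)"
  unfolding lie_module_def
proof (intro conjI allI ballI)
  show "csubspace (carrier (comp_module V))" by (simp add: endos_subspace sub)
  fix x \<phi> assume \<phi>: "\<phi> \<in> carrier (comp_module V)"
  then have \<phi>_lin: "lin_on (carrier V) \<phi>" and \<phi>_closed: "\<And>v. v \<in> carrier V \<Longrightarrow> \<phi> v \<in> carrier V"
    by (auto simp: endos_def)
  have "lin_on (carrier V) (act (comp_module V) x \<phi>)"
    by (simp add: lin_on_def comp_module_def csubspace_simps[OF sub] closed \<phi>_closed lin_on_add[OF act_lin]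
        lin_on_scale[OF act_lin] lin_on_add[OF \<phi>_lin] lin_on_scale[OF \<phi>_lin] complex_vs.scale_right_diff_distrib)
  then show "act (comp_module V) x \<phi> \<in> carrier (comp_module V)"
    by (auto simp: endos_def comp_module_def \<phi>_closed closed csubspace_simps[OF sub])
next
qed (auto simp: comp_module_def fun_eq_iff endosD closed act_add_left act_scale_left act_bracket scaleC_fun_def
    lin_on_add[OF act_lin] lin_on_scale[OF act_lin])

text \<open>The linear maps into \<open>N\<close> that are scalar on \<open>N\<close> form a module, and its elements \<open>x \<cdot> \<phi>\<close> vanish on \<open>N\<close>.
  The invariant component of a linear projection onto \<open>N\<close> is therefore an equivariant projection.\<close>

theorem complete_reducibility:
  assumes ss: "semisimple_lie_algebra TYPE('g)" and fd: "fin_dim (carrier V)" and N: "lie_submodule N V"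
  obtains \<pi> where "lie_hom \<pi> V V" "\<pi> ` carrier V \<subseteq> N" "\<And>n. n \<in> N \<Longrightarrow> \<pi> n = n"
proof -
  have Ns: "csubspace N" and NV: "N \<subseteq> carrier V" and NA: "\<And>x n. n \<in> N \<Longrightarrow> act V x n \<in> N"
    using N by (auto simp: lie_submodule_def)
  define M where "M = {\<phi> \<in> endos (carrier V). (\<forall>v\<in>carrier V. \<phi> v \<in> N) \<and> (\<exists>c. \<forall>n\<in>N. \<phi> n = c *\<^sub>C n)}"
  have "lie_submodule M (end_module V)"
    unfolding lie_submodule_def
  proof (intro conjI allI ballI complex_vs.subspaceI)
    have "\<forall>n\<in>N. (0 :: 'v) = 0 *\<^sub>C n" by simp
    then show "0 \<in> M"
      using endos_subspace[OF sub] Ns unfolding M_def by (auto simp: csubspace_simps intro!: exI[of _ 0])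
    show "\<phi> + \<psi> \<in> M" if \<phi>: "\<phi> \<in> M" and \<psi>: "\<psi> \<in> M" for \<phi> \<psi>
    proof -
      obtain c d where "\<forall>n\<in>N. \<phi> n = c *\<^sub>C n" "\<forall>n\<in>N. \<psi> n = d *\<^sub>C n" using \<phi> \<psi> by (auto simp: M_def)
      then have "\<forall>n\<in>N. (\<phi> + \<psi>) n = (c + d) *\<^sub>C n" by (simp add: scaleC_add_left)
      then show ?thesis
        using \<phi> \<psi> endos_subspace[OF sub] Ns unfolding M_def by (auto simp: csubspace_simps)
    qed
    show "a *\<^sub>C \<phi> \<in> M" if \<phi>: "\<phi> \<in> M" for a \<phi>
    proof -
      obtain c where "\<forall>n\<in>N. \<phi> n = c *\<^sub>C n" using \<phi> by (auto simp: M_def)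
      then have "\<forall>n\<in>N. (a *\<^sub>C \<phi>) n = (a * c) *\<^sub>C n" by (simp add: scaleC_fun_def scaleC_scaleC)
      moreover have "\<forall>v\<in>carrier V. (a *\<^sub>C \<phi>) v \<in> N" using \<phi> Ns by (auto simp: M_def scaleC_fun_def csubspace_simps)
      moreover have "a *\<^sub>C \<phi> \<in> endos (carrier V)" using \<phi> endos_subspace[OF sub] by (simp add: M_def csubspace_simps)
      ultimately show ?thesis unfolding M_def by blast
    qed
    show "M \<subseteq> carrier (end_module V)" by (auto simp: M_def)
    show "act (end_module V) x \<phi> \<in> M" if \<phi>: "\<phi> \<in> M" for x \<phi>
    proof -
      have "\<phi> \<in> endos (carrier V)" using \<phi> by (simp add: M_def)
      then have "act (end_module V) x \<phi> \<in> endos (carrier V)"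
        using lie_mod.closed[OF lie_mod.intro[OF end_module_module], of \<phi> x] by simp
      \<comment> \<open>A scalar on \<open>N\<close> commutes with the action on \<open>N\<close>,
        so the two terms cancel and the new scalar is 0.\<close>
      moreover have "act (end_module V) x \<phi> n = 0 *\<^sub>C n" if n: "n \<in> N" for n
        using \<phi> n NA[OF n] NV by (auto simp: end_module_def M_def lin_on_scale[OF act_lin] subset_iff)
      moreover have "\<forall>v\<in>carrier V. act (end_module V) x \<phi> v \<in> N"
        using \<phi> NA Ns by (auto simp: end_module_def M_def closed csubspace_simps)
      ultimately show ?thesis unfolding M_def by blast
    qed
  qed
  then have ME: "lie_module (end_module V\<lparr>carrier := M\<rparr>)" "csubspace M" "M \<subseteq> endos (carrier V)"
    using lie_submodule_module[OF end_module_module] by (auto simp: lie_submodule_def)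
  interpret M: lie_mod "end_module V\<lparr>carrier := M\<rparr>" by unfold_locales (rule ME)
  have "fin_dim M" using fin_dim_subspace[OF endos_fin_dim[OF fd] ME(2,3)] .
  note dec = M.decomposition(1)[OF ss, simplified, OF this]
  obtain P where P: "clinear P" "\<And>v. P v \<in> N" "\<And>w. w \<in> N \<Longrightarrow> P w = w"
    by (rule projection_exists[OF Ns]) (rule that)
  let ?P = "\<lambda>v. if v \<in> carrier V then P v else 0"
  have "?P \<in> endos (carrier V)"
    using P(2) NV by (auto simp: endos_def lin_on_def csubspace_simps[OF sub] clinear_add[OF P(1)] clinear_scale[OF P(1)])
  moreover have "\<exists>c. \<forall>n\<in>N. ?P n = c *\<^sub>C n" using P(3) NV by (intro exI[of _ 1]) (auto simp: scaleC_one)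
  moreover have "\<forall>v\<in>carrier V. ?P v \<in> N" using P(2) by simp
  ultimately have "?P \<in> M" unfolding M_def by blast
  from dec[OF this] obtain \<pi> w where \<pi>: "\<pi> \<in> invariants M (act (end_module V))" and w: "w \<in> moved M (act (end_module V))"
    and eq: "?P = \<pi> + w" by blast
  \<comment> \<open>Consequently the invariant component \<pi> agrees with the projection on
    \<open>N\<close>.\<close>
  have "moved M (act (end_module V)) \<subseteq> {\<phi>. \<forall>n\<in>N. \<phi> n = 0}"
    unfolding moved_def
  proof (rule complex_vs.span_minimal)
    show "{act (end_module V) x \<phi> | x \<phi>. \<phi> \<in> M} \<subseteq> {\<phi>. \<forall>n\<in>N. \<phi> n = 0}"
      using NA NV by (auto simp: end_module_def M_def lin_on_scale[OF act_lin] subset_iff)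
  qed (auto intro!: complex_vs.subspaceI simp: scaleC_fun_def)
  then have "\<pi> n = n" if "n \<in> N" for n
  proof -
    have "w n = 0" using w \<open>moved M (act (end_module V)) \<subseteq> {\<phi>. \<forall>n\<in>N. \<phi> n = 0}\<close> that by blast
    then show ?thesis using fun_cong[OF eq, of n] that P(3) NV by auto
  qed
  moreover have "lie_hom \<pi> V V"
    unfolding lie_hom_def
  proof (intro conjI allI ballI)
    have "\<pi> \<in> endos (carrier V)" using \<pi> by (simp add: invariants_def M_def)
    then show "lin_on (carrier V) \<pi>" "\<pi> ` carrier V \<subseteq> carrier V" by (auto simp: endos_def)
    fix x v assume v: "v \<in> carrier V"
    have "act (end_module V) x \<pi> = 0" using \<pi> by (simp add: invariants_def)
    from fun_cong[OF this, of v] show "\<pi> (act V x v) = act V x (\<pi> v)" using v by (simp add: end_module_def)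
  qed
  moreover have "\<pi> ` carrier V \<subseteq> N" using \<pi> by (auto simp: invariants_def M_def)
  ultimately show ?thesis using that by blast
qed

text \<open>Evaluation at a vector of the carrier is an equivariant map from
  \<open>comp_module V\<close> to \<open>V\<close>.\<close>

lemma uact_comp_module:
  assumes "\<phi> \<in> endos (carrier V)"
  shows "act (uea_lmodule (comp_module V)) u \<phi> = (\<lambda>v. if v \<in> carrier V then uact u (\<phi> v) else 0)"
proof
  interpret C: lie_mod "comp_module V" by unfold_locales (rule comp_module_module)
  fix v
  show "C.uact u \<phi> v = (if v \<in> carrier V then uact u (\<phi> v) else 0)"
  proof (cases "v \<in> carrier V")
    case True
    have "(\<lambda>\<phi>. \<phi> v) (C.uact u \<phi>) = uact u (\<phi> v)"
      by (rule uact_lie_hom[OF comp_module_module V])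
        (use True assms in \<open>auto simp: lie_hom_def lin_on_def scaleC_fun_def endosD comp_module_def\<close>)
    then show ?thesis using True by simp
  next
    case False
    then show ?thesis using C.uact_closed[of \<phi> u] assms endosD(3)[of "C.uact u \<phi>"] by simp
  qed
qed

end

section \<open>Central elements separating modules\<close>

lemma uact_id_on:
  assumes "lie_module V"
  shows "act (uea_lmodule (comp_module V)) u (id_on (carrier V)) = (\<lambda>v. if v \<in> carrier V then act (uea_lmodule V) u v else 0)"
proof -
  interpret lie_mod V by unfold_locales (rule assms)
  show ?thesis by (simp add: uact_comp_module[OF id_on_endos[OF sub]]) (simp add: id_on_def fun_eq_iff)
qed

text \<open>A vector killed by the annihilator of \<open>S\<close> is the image of the identity under an equivariant map from
  the endomorphisms of \<open>S\<close>, which form a direct sum of copies of \<open>S\<close>.\<close>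

lemma annihilated_vector_zero:
  fixes S :: "('g::lie_algebra, 's::complex_vs) lmodule" and V :: "('g, 'v::complex_vs) lmodule"
  assumes ss: "semisimple_lie_algebra TYPE('g)"
    and S: "lie_module S" "fin_dim (carrier S)" and V: "lie_module V"
    and hom: "\<And>f s. lie_hom f S V \<Longrightarrow> s \<in> carrier S \<Longrightarrow> f s = 0"
    and v: "v \<in> carrier V"
    and ann: "\<And>u. (\<And>s. s \<in> carrier S \<Longrightarrow> act (uea_lmodule S) u s = 0) \<Longrightarrow> act (uea_lmodule V) u v = 0"
  shows "v = 0"
proof -
  interpret S: lie_mod S by unfold_locales (rule S)
  interpret V: lie_mod V by unfold_locales (rule V)
  interpret C: lie_mod "comp_module S" by unfold_locales (rule S.comp_module_module)
  define i where "i = id_on (carrier S)"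
  have i: "i \<in> endos (carrier S)" unfolding i_def by (rule id_on_endos[OF S.sub])
  then have iC: "i \<in> carrier (comp_module S)" by simp
  have ui: "C.uact u i = (\<lambda>s. if s \<in> carrier S then S.uact u s else 0)" for u
    unfolding i_def by (rule uact_id_on[OF S(1)])
  \<comment> \<open>The submodule generated by the identity, a copy of the enveloping algebra modulo
    the annihilator of \<open>S\<close>.\<close>
  define N where "N = range (\<lambda>u. C.uact u i)"
  have N: "lie_submodule N (comp_module S)"
    unfolding lie_submodule_def
  proof (intro conjI allI ballI)
    show "csubspace N"
      unfolding N_def by (intro subspace_image C.clinear_uact iC complex_vs.subspace_UNIV)
    show "N \<subseteq> carrier (comp_module S)" unfolding N_def using C.uact_closed[OF iC] by blast
    fix x n assume "n \<in> N"
    then obtain u where "n = C.uact u i" by (auto simp: N_def)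
    then have "act (comp_module S) x n = C.uact (uea_of x * u) i"
      using iC by (simp add: C.uact_mult C.uact_letter C.uact_closed del: carrier_comp_module)
    then show "act (comp_module S) x n \<in> N" by (simp add: N_def)
  qed
  \<comment> \<open>On \<open>N\<close> this sends \<open>u\<close> applied to the identity to
    \<open>u\<close> applied to \<open>v\<close>; hypothesis \<open>ann\<close> makes the choice of
    \<open>u\<close> irrelevant.\<close>
  define f where "f n = V.uact (SOME u. n = C.uact u i) v" for n
  have f: "f (C.uact u i) = V.uact u v" for u
  proof -
    define u' where "u' = (SOME u'. C.uact u i = C.uact u' i)"
    have "C.uact u i = C.uact u' i" unfolding u'_def by (rule someI[of _ u]) simp
    then have "S.uact u' s = S.uact u s" if "s \<in> carrier S" for s
      using that by (simp add: ui fun_eq_iff) metis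
    then have "V.uact (u' - u) v = 0" by (intro ann) (simp add: S.uact_diff)
    then show ?thesis using v by (simp add: f_def u'_def V.uact_diff)
  qed
  \<comment> \<open>Composition with the projection extends \<open>f\<close> from \<open>N\<close>
    to the whole of \<open>comp_module S\<close>.\<close>
  obtain \<pi> where \<pi>: "lie_hom \<pi> (comp_module S) (comp_module S)" "\<pi> ` carrier (comp_module S) \<subseteq> N" "\<And>n. n \<in> N \<Longrightarrow> \<pi> n = n"
    by (rule C.complete_reducibility[OF ss _ N]) (use endos_fin_dim[OF S(2)] in \<open>simp_all\<close>)
  define h where "h \<phi> = f (\<pi> \<phi>)" for \<phi>
  have h: "lie_hom h (comp_module S) V"
  proof -
    have rep: "\<exists>u. \<pi> \<phi> = C.uact u i" if "\<phi> \<in> carrier (comp_module S)" for \<phi>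
      using \<pi>(2) that unfolding N_def by blast
    have \<pi>_lin: "lin_on (carrier (comp_module S)) \<pi>" using \<pi>(1) by (simp add: lie_hom_def)
    have "h (\<phi> + \<psi>) = h \<phi> + h \<psi>" if \<phi>: "\<phi> \<in> carrier (comp_module S)" and \<psi>: "\<psi> \<in> carrier (comp_module S)" for \<phi> \<psi>
    proof -
      obtain a b where ab: "\<pi> \<phi> = C.uact a i" "\<pi> \<psi> = C.uact b i" using rep \<phi> \<psi> by blast
      have "\<pi> (\<phi> + \<psi>) = C.uact (a + b) i"
        using \<phi> \<psi> ab iC by (simp add: lin_on_add[OF \<pi>_lin] C.uact_add del: carrier_comp_module)
      then show ?thesis using ab v by (simp add: h_def f V.uact_add)
    qed
    moreover have "h (c *\<^sub>C \<phi>) = c *\<^sub>C h \<phi>" if \<phi>: "\<phi> \<in> carrier (comp_module S)" for \<phi> c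
    proof -
      obtain a where a: "\<pi> \<phi> = C.uact a i" using rep \<phi> by blast
      have "\<pi> (c *\<^sub>C \<phi>) = C.uact (c *\<^sub>C a) i"
        using \<phi> a iC by (simp add: lin_on_scale[OF \<pi>_lin] C.uact_scale del: carrier_comp_module)
      then show ?thesis using a v by (simp add: h_def f V.uact_scale)
    qed
    moreover have "h \<phi> \<in> carrier V" if \<phi>: "\<phi> \<in> carrier (comp_module S)" for \<phi>
      using rep[OF \<phi>] v by (auto simp: h_def f V.uact_closed)
    moreover have "h (act (comp_module S) x \<phi>) = act V x (h \<phi>)" if \<phi>: "\<phi> \<in> carrier (comp_module S)" for x \<phi>
    proof -
      obtain a where a: "\<pi> \<phi> = C.uact a i" using rep \<phi> by blast
      have "\<pi> (act (comp_module S) x \<phi>) = C.uact (uea_of x * a) i"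
        using \<pi>(1) \<phi> a iC by (simp add: lie_hom_def C.uact_mult C.uact_letter C.uact_closed del: carrier_comp_module)
      then show ?thesis using a v by (simp add: h_def f V.uact_mult V.uact_letter V.uact_closed)
    qed
    ultimately show ?thesis by (auto simp: lie_hom_def lin_on_def simp del: carrier_comp_module)
  qed
  obtain B where B: "is_basis B (carrier S)" using fin_dim_basis[OF S(2) S.sub] by blast
  \<comment> \<open>For each \<open>b\<close> this is a homomorphism from \<open>S\<close> to
    \<open>V\<close> as a function of \<open>s\<close>. The identity is a sum of such operators, so
    \<open>h\<close> kills it.\<close>
  have zero: "h (rank_one (carrier S) B b s) = 0" if "b \<in> B" "s \<in> carrier S" for b s
  proof (rule hom[OF _ that(2)])
    have r: "rank_one (carrier S) B b s \<in> carrier (comp_module S)" if "s \<in> carrier S" for s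
      using rank_one_endos[OF B that] by simp
    have "rank_one (carrier S) B b (act S x s) = act (comp_module S) x (rank_one (carrier S) B b s)"
      if "s \<in> carrier S" for x s
      using that by (auto simp: rank_one_def comp_module_def fun_eq_iff lin_on_scale[OF S.act_lin])
    then show "lie_hom (\<lambda>s. h (rank_one (carrier S) B b s)) S V"
      using h r by (simp add: lie_hom_def lin_on_def clinear_add[OF rank_one_clinear] clinear_scale[OF rank_one_clinear]
          image_subset_iff del: carrier_comp_module)
  qed
  have lh: "lin_on (carrier (comp_module S)) h" using h by (simp add: lie_hom_def)
  have "h i = h (\<Sum>b\<in>B. rank_one (carrier S) B b (i b))" using endos_rank_one_sum[OF B i] by simp
  also have "\<dots> = (\<Sum>b\<in>B. h (rank_one (carrier S) B b (i b)))"
    using rank_one_endos[OF B] is_basis_subset[OF B] endosD(2)[OF i] by (intro lin_on_sum[OF lh C.sub]) auto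
  also have "\<dots> = 0"
    using zero is_basis_subset[OF B] endosD(2)[OF i] by (intro sum.neutral) auto
  finally have "h i = 0" .
  moreover have "C.uact 1 i = i" using C.uact_one[OF iC] .
  then have "\<pi> i = C.uact 1 i" using \<pi>(3)[of i] unfolding N_def by (metis rangeI)
  then have "h i = v" using v by (simp add: h_def f V.uact_one)
  ultimately show ?thesis by simp
qed

text \<open>Let \<open>I\<close> be the annihilator of \<open>S\<close>. Projecting the identity of
  \<open>V\<close> onto the submodule generated by \<open>I\<close> gives some \<open>u\<close> in
  \<open>I\<close> for which \<open>a * u\<close> and \<open>a\<close> act alike on \<open>V\<close>
  whenever \<open>a\<close> is in \<open>I\<close>. Thus \<open>v - u v\<close> is killed by
  \<open>I\<close>, and \<open>annihilated_vector_zero\<close> applies to it.\<close>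

lemma separating_element:
  fixes S :: "('g::lie_algebra, 's::complex_vs) lmodule" and V :: "('g, 'v::complex_vs) lmodule"
  assumes ss: "semisimple_lie_algebra TYPE('g)"
    and S: "lie_module S" "fin_dim (carrier S)" and V: "lie_module V" "fin_dim (carrier V)"
    and hom: "\<And>f s. lie_hom f S V \<Longrightarrow> s \<in> carrier S \<Longrightarrow> f s = 0"
  obtains u where "\<And>s. s \<in> carrier S \<Longrightarrow> act (uea_lmodule S) u s = 0"
    "\<And>v. v \<in> carrier V \<Longrightarrow> act (uea_lmodule V) u v = v"
proof -
  interpret S: lie_mod S by unfold_locales (rule S)
  interpret V: lie_mod V by unfold_locales (rule V)
  interpret C: lie_mod "comp_module V" by unfold_locales (rule V.comp_module_module)
  define i where "i = id_on (carrier V)"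
  have i: "i \<in> endos (carrier V)" unfolding i_def by (rule id_on_endos[OF V.sub])
  then have iC: "i \<in> carrier (comp_module V)" by simp
  define I where "I = {u. \<forall>s\<in>carrier S. S.uact u s = 0}"
  have I: "csubspace I"
    by (intro complex_vs.subspaceI) (auto simp: I_def S.uact_zero S.uact_add S.uact_scale)
  define N where "N = (\<lambda>u. C.uact u i) ` I"
  have N: "lie_submodule N (comp_module V)"
    unfolding lie_submodule_def
  proof (intro conjI allI ballI)
    show "csubspace N"
      unfolding N_def by (intro subspace_image C.clinear_uact iC I)
    show "N \<subseteq> carrier (comp_module V)" unfolding N_def using C.uact_closed[OF iC] by blast
    fix x n assume "n \<in> N"
    then obtain u where u: "u \<in> I" "n = C.uact u i" by (auto simp: N_def)
    have "act (comp_module V) x n = C.uact (uea_of x * u) i"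
      using iC u by (simp add: C.uact_mult C.uact_letter C.uact_closed del: carrier_comp_module)
    moreover have "uea_of x * u \<in> I"
      using u(1) S.uact_letter[OF complex_vs.subspace_0[OF S.sub]] lin_on_0[OF S.act_lin S.sub]
      by (simp add: I_def S.uact_mult)
    ultimately show "act (comp_module V) x n \<in> N" by (simp add: N_def)
  qed
  obtain \<pi> where \<pi>: "lie_hom \<pi> (comp_module V) (comp_module V)" "\<pi> ` carrier (comp_module V) \<subseteq> N" "\<And>n. n \<in> N \<Longrightarrow> \<pi> n = n"
    by (rule C.complete_reducibility[OF ss _ N]) (use endos_fin_dim[OF V(2)] in \<open>simp_all\<close>)
  obtain u where u: "u \<in> I" "\<pi> i = C.uact u i" using \<pi>(2) iC unfolding N_def by blast
  have kill: "V.uact a (v - V.uact u v) = 0" if "a \<in> I" "v \<in> carrier V" for a v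
  proof -
    have "C.uact a i = \<pi> (C.uact a i)" using \<pi>(3) that by (simp add: N_def)
    also have "\<dots> = C.uact a (C.uact u i)"
      using uact_lie_hom[OF V.comp_module_module V.comp_module_module \<pi>(1) iC] u(2) by simp
    also have "\<dots> = C.uact (a * u) i" using C.uact_mult[OF iC] by simp
    finally have "V.uact a v = V.uact (a * u) v"
      using that(2) unfolding i_def uact_id_on[OF V(1)] by (simp add: fun_eq_iff) metis
    then show ?thesis
      using that(2) by (simp add: V.uact_mult lin_on_diff[OF V.uact_lin V.sub] V.uact_closed)
  qed
  have "v - V.uact u v = 0" if v: "v \<in> carrier V" for v
  proof (rule annihilated_vector_zero[OF ss S V(1)])
    show "f s = 0" if "lie_hom f S V" "s \<in> carrier S" for f s using hom that .
    show "v - V.uact u v \<in> carrier V" using v by (simp add: V.uact_closed csubspace_simps[OF V.sub])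
    show "V.uact a (v - V.uact u v) = 0" if "\<And>s. s \<in> carrier S \<Longrightarrow> S.uact a s = 0" for a
      using kill[OF _ v] that by (simp add: I_def)
  qed
  then show ?thesis using that[of u] u(1) by (simp add: I_def)
qed

section \<open>The word-length filtration of the enveloping algebra and its adjoint action\<close>

primrec uea_filtration :: "nat \<Rightarrow> 'g::lie_algebra uea set" where
  "uea_filtration 0 = cspan {1}"
| "uea_filtration (Suc n) = cspan (uea_filtration n \<union> {uea_of x * u | x u. u \<in> uea_filtration n})"

lemma uea_filtration_subspace: "csubspace (uea_filtration n)"
  by (cases n) auto

lemma uea_filtration_Suc: "uea_filtration n \<subseteq> uea_filtration (Suc n)"
  by (auto intro: complex_vs.span_base)

lemma uea_filtration_mono: "m \<le> n \<Longrightarrow> uea_filtration m \<subseteq> uea_filtration n"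
  using lift_Suc_mono_le[of uea_filtration] uea_filtration_Suc by blast

lemma uea_filtration_mult: "u \<in> uea_filtration n \<Longrightarrow> uea_of x * u \<in> uea_filtration (Suc n)"
  by (auto intro: complex_vs.span_base)

lemma uea_filtration_exhaustive: "\<exists>n. u \<in> uea_filtration n"
proof (induction u rule: uea_induct)
  case (add a b)
  then obtain m n where "a \<in> uea_filtration m" "b \<in> uea_filtration n" by blast
  then have "a \<in> uea_filtration (max m n)" "b \<in> uea_filtration (max m n)"
    using uea_filtration_mono[of m "max m n"] uea_filtration_mono[of n "max m n"] by auto
  then show ?case using complex_vs.subspace_add[OF uea_filtration_subspace] by blast
next
  case (scalar c)
  have "c *\<^sub>C 1 \<in> uea_filtration 0" by (auto intro: complex_vs.span_scale complex_vs.span_base)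
  then show ?case by blast
next
  case (letter x a)
  then show ?case using uea_filtration_mult by blast
qed

lemma clinear_uea_of: "clinear uea_of"
  by (intro clinearI) (simp_all add: uea_of_add uea_of_scale)

lemma clinear_uea_mult: "clinear (\<lambda>u. u * v)" "clinear (\<lambda>v. u * v)" for u v :: "'g::lie_algebra uea"
  by (auto intro!: clinearI simp: distrib_left distrib_right scaleC_uea_left scaleC_uea_right)

text \<open>With finite-dimensional steps, \<open>decomposition\<close> becomes available for the
  adjoint action on the enveloping algebra, one step at a time.\<close>

lemma uea_filtration_fin_dim:
  assumes "fin_dim (UNIV :: 'g::lie_algebra set)"
  shows "fin_dim (uea_filtration n :: 'g uea set)"
proof (induction n)
  case 0
  then show ?case by (auto simp: fin_dim_def)
next
  case (Suc n)
  obtain G :: "'g set" where G: "finite G" "UNIV = cspan G" using assms by (auto simp: fin_dim_def)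
  obtain B :: "'g uea set" where B: "finite B" "uea_filtration n = cspan B" using Suc by (auto simp: fin_dim_def)
  let ?T = "B \<union> (\<lambda>(x, u). uea_of x * u) ` (G \<times> B)"
  have 1: "uea_of x * u \<in> cspan ?T" if u: "u \<in> B" for x u
  proof -
    have "csubspace {x. uea_of x * u \<in> cspan ?T}"
      by (intro complex_vs.subspaceI)
        (simp_all add: uea_of_add uea_of_scale distrib_right scaleC_uea_left complex_vs.span_add complex_vs.span_scale
          clinear_0[OF clinear_uea_of] complex_vs.span_zero)
    moreover have "G \<subseteq> {x. uea_of x * u \<in> cspan ?T}" using u by (auto intro!: complex_vs.span_base)
    ultimately have "cspan G \<subseteq> {x. uea_of x * u \<in> cspan ?T}" by (intro complex_vs.span_minimal)
    then show ?thesis using G by blast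
  qed
  have 2: "uea_of x * u \<in> cspan ?T" if u: "u \<in> uea_filtration n" for x u
  proof -
    have "csubspace {u. uea_of x * u \<in> cspan ?T}"
      using cvs_pair.linear_subspace_linear_preimage[OF clinear_uea_mult(2) complex_vs.subspace_span] .
    moreover have "B \<subseteq> {u. uea_of x * u \<in> cspan ?T}" using 1 by blast
    ultimately have "cspan B \<subseteq> {u. uea_of x * u \<in> cspan ?T}" by (intro complex_vs.span_minimal)
    then show ?thesis using u B by blast
  qed
  have "uea_filtration n \<subseteq> cspan ?T" unfolding B(2) by (intro complex_vs.span_mono) blast
  moreover have "{uea_of x * u | x u. u \<in> uea_filtration n} \<subseteq> cspan ?T" using 2 by blast
  ultimately have "uea_filtration (Suc n) \<subseteq> cspan ?T"
    unfolding uea_filtration.simps(2)[of n] by (intro complex_vs.span_minimal) simp_all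
  moreover have "fin_dim (cspan ?T)" unfolding fin_dim_def using G B by (intro exI[of _ ?T]) simp
  ultimately show ?case using fin_dim_subspace[OF _ uea_filtration_subspace] by blast
qed

definition ad_module :: "nat \<Rightarrow> ('g::lie_algebra, 'g uea) lmodule" where
  "ad_module n = \<lparr>carrier = uea_filtration n, act = (\<lambda>x u. uea_of x * u - u * uea_of x)\<rparr>"

lemma carrier_ad_module [simp]: "carrier (ad_module n) = uea_filtration n"
  by (simp add: ad_module_def)

text \<open>Taking the commutator with a letter obeys the Leibniz rule, and the commutator of two
  letters is again a letter, so word length does not grow.\<close>

lemma uea_filtration_ad: "u \<in> uea_filtration n \<Longrightarrow> uea_of x * u - u * uea_of x \<in> uea_filtration n"
proof (induction n arbitrary: u)
  case 0
  then obtain c where "u = c *\<^sub>C 1" by (auto simp: complex_vs.span_singleton)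
  then show ?case by (simp add: scaleC_uea_left scaleC_uea_right complex_vs.span_zero)
next
  case (Suc n)
  let ?S = "{u. uea_of x * u - u * uea_of x \<in> uea_filtration (Suc n)}"
  have lin: "clinear (\<lambda>u. uea_of x * u - u * uea_of x)"
    by (intro clinearI) (simp_all add: algebra_simps scaleC_uea_left scaleC_uea_right complex_vs.scale_right_diff_distrib)
  have "csubspace ?S"
    using cvs_pair.linear_subspace_linear_preimage[OF lin uea_filtration_subspace] .
  moreover have "uea_of x * u - u * uea_of x \<in> uea_filtration (Suc n)" if "u \<in> uea_filtration n" for u
    using Suc.IH[OF that] uea_filtration_Suc by blast
  moreover have "uea_of x * (uea_of y * u) - (uea_of y * u) * uea_of x \<in> uea_filtration (Suc n)"
    if u: "u \<in> uea_filtration n" for y u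
  proof -
    have "uea_of x * (uea_of y * u) - (uea_of y * u) * uea_of x
        = uea_of (lie_bracket x y) * u + uea_of y * (uea_of x * u - u * uea_of x)"
      by (simp add: uea_of_bracket algebra_simps)
    also have "\<dots> \<in> uea_filtration (Suc n)"
      by (intro complex_vs.subspace_add uea_filtration_subspace uea_filtration_mult u Suc.IH)
    finally show ?thesis .
  qed
  ultimately have "uea_filtration (Suc n) \<subseteq> ?S"
    unfolding uea_filtration.simps(2)[of n] by (intro complex_vs.span_minimal) auto
  then show ?case using Suc.prems by blast
qed

lemma ad_module_module: "lie_module (ad_module n)"
  unfolding lie_module_def ad_module_def
  by (simp add: uea_filtration_subspace uea_filtration_ad uea_of_add uea_of_scale uea_of_bracket algebra_simps
      scaleC_uea_left scaleC_uea_right complex_vs.scale_right_diff_distrib)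

lemma central_of_commuting:
  assumes "\<And>x. uea_of x * z = z * uea_of x"
  shows "u * z = z * u"
proof (induction u rule: uea_induct)
  case (letter x a)
  then show ?case using assms by (metis mult.assoc)
qed (simp_all add: distrib_left distrib_right scaleC_uea_left scaleC_uea_right)

text \<open>The action on \<open>V\<close> is a homomorphism from the adjoint module to the endomorphisms of \<open>V\<close>, so it respects
  the decompositions into invariants and commutators.\<close>

lemma invariant_part_acts:
  fixes V :: "('g::lie_algebra, 'v::complex_vs) lmodule"
  assumes ss: "semisimple_lie_algebra TYPE('g)" and V: "lie_module V" "fin_dim (carrier V)"
    and z: "\<And>x. uea_of x * z = z * uea_of x" and w: "w \<in> moved (uea_filtration n) (act (ad_module n))"
    and c: "\<And>v. v \<in> carrier V \<Longrightarrow> act (uea_lmodule V) (z + w) v = c *\<^sub>C v"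
    and v: "v \<in> carrier V"
  shows "act (uea_lmodule V) z v = c *\<^sub>C v"
proof -
  interpret V: lie_mod V by unfold_locales (rule V)
  interpret E: lie_mod "end_module V" by unfold_locales (rule V.end_module_module)
  define R where "R u = (\<lambda>v. if v \<in> carrier V then V.uact u v else 0)" for u
  have R: "R u \<in> carrier (end_module V)" for u
    using V.uact_lin by (auto simp: endos_def R_def lin_on_def V.uact_closed csubspace_simps[OF V.sub])
  have lin: "clinear R"
    by (intro clinearI) (auto simp: R_def fun_eq_iff V.uact_add V.uact_scale scaleC_fun_def)
  have ad: "R (uea_of x * u - u * uea_of x) = act (end_module V) x (R u)" for x u
    by (auto simp: R_def end_module_def fun_eq_iff V.uact_diff V.uact_mult V.uact_letter V.uact_closed V.closed)
  \<comment> \<open>The equivariant map \<open>R\<close> carries commutators to moved endomorphisms.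
    On the other hand \<open>R w\<close> is the scalar \<open>c\<close> minus the action of
    \<open>z\<close>, which is invariant, so \<open>R w\<close> is zero.\<close>
  have "R w \<in> moved (carrier (end_module V)) (act (end_module V))"
  proof -
    have "R ` moved (uea_filtration n) (act (ad_module n)) = cspan (R ` {act (ad_module n) x u | x u. u \<in> uea_filtration n})"
      unfolding moved_def using cvs_pair.linear_span_image[OF lin] by simp
    also have "\<dots> \<subseteq> moved (carrier (end_module V)) (act (end_module V))"
      unfolding moved_def
    proof (rule complex_vs.span_mono, safe)
      fix x u
      have "R (act (ad_module n) x u) = act (end_module V) x (R u)" by (simp add: ad_module_def ad)
      then show "\<exists>y \<phi>. R (act (ad_module n) x u) = act (end_module V) y \<phi> \<and> \<phi> \<in> carrier (end_module V)"
        using R by blast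
    qed
    finally show ?thesis using w by blast
  qed
  moreover have eq: "R w = c *\<^sub>C id_on (carrier V) - R z"
    using c by (auto simp: R_def id_on_def fun_eq_iff scaleC_fun_def V.uact_add eq_diff_eq add.commute)
  moreover have "c *\<^sub>C id_on (carrier V) - R z \<in> invariants (carrier (end_module V)) (act (end_module V))"
  proof -
    have "R (uea_of x * z - z * uea_of x) = 0" for x using z clinear_0[OF lin] by simp
    then have 1: "act (end_module V) x (R z) = 0" for x using ad by simp
    have 2: "act (end_module V) x (c *\<^sub>C id_on (carrier V)) = 0" for x
      by (auto simp: end_module_def id_on_def fun_eq_iff scaleC_fun_def V.closed lin_on_scale[OF V.act_lin])
    have i: "c *\<^sub>C id_on (carrier V) \<in> carrier (end_module V)"
      using id_on_endos[OF V.sub] endos_subspace[OF V.sub] by (simp add: csubspace_simps)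
    show ?thesis
      using i R[of z] 1 2 E.sub by (simp add: invariants_def lin_on_diff[OF E.act_lin E.sub] csubspace_simps del: carrier_end_module)
  qed
  ultimately have "R w = 0"
    using E.decomposition(2)[OF ss, of "R w"] endos_fin_dim[OF V(2)] by simp
  from fun_cong[OF this, of v] have "V.uact w v = 0" using v by (simp add: R_def)
  then show ?thesis using c[OF v] v by (simp add: V.uact_add)
qed

text \<open>The invariant component of a separating element commutes with all letters, which
  generate the algebra. It acts by the same scalars, 0 on \<open>S\<close> and 1 on
  \<open>V\<close>.\<close>

theorem central_separation:
  fixes S :: "('g::lie_algebra, 's::complex_vs) lmodule" and V :: "('g, 'v::complex_vs) lmodule"
  assumes ss: "semisimple_lie_algebra TYPE('g)"
    and S: "lie_module S" "fin_dim (carrier S)" and V: "lie_module V" "fin_dim (carrier V)"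
    and hom: "\<And>f s. lie_hom f S V \<Longrightarrow> s \<in> carrier S \<Longrightarrow> f s = 0"
  obtains z where "\<And>u. u * z = z * u" "\<And>s. s \<in> carrier S \<Longrightarrow> act (uea_lmodule S) z s = 0"
    "\<And>v. v \<in> carrier V \<Longrightarrow> act (uea_lmodule V) z v = v"
proof -
  obtain u where u: "\<And>s. s \<in> carrier S \<Longrightarrow> act (uea_lmodule S) u s = 0"
    "\<And>v. v \<in> carrier V \<Longrightarrow> act (uea_lmodule V) u v = v"
    by (rule separating_element[OF ss S V]) (use hom in \<open>blast+\<close>)
  obtain n where n: "u \<in> uea_filtration n" using uea_filtration_exhaustive by blast
  interpret A: lie_mod "ad_module n :: ('g, 'g uea) lmodule" by unfold_locales (rule ad_module_module)
  have "fin_dim (carrier (ad_module n :: ('g, 'g uea) lmodule))"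
    using ss by (simp add: uea_filtration_fin_dim semisimple_lie_algebra_def)
  from A.decomposition(1)[OF ss this, of u] n obtain z w where
    z: "z \<in> invariants (uea_filtration n) (act (ad_module n))"
    and w: "w \<in> moved (uea_filtration n) (act (ad_module n))" and eq: "u = z + w"
    unfolding carrier_ad_module by blast
  have z: "uea_of x * z = z * uea_of x" for x using z by (simp add: invariants_def ad_module_def)
  have "act (uea_lmodule S) z s = 0 *\<^sub>C s" if "s \<in> carrier S" for s
    using invariant_part_acts[OF ss S z w _ that, of 0] u(1) eq by simp
  moreover have "act (uea_lmodule V) z v = 1 *\<^sub>C v" if "v \<in> carrier V" for v
    using invariant_part_acts[OF ss V z w _ that, of 1] u(2) eq by (simp add: scaleC_one)
  ultimately show ?thesis using that[of z] central_of_commuting[OF z] by (simp add: scaleC_one)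
qed

section \<open>Homotopies on free resolutions\<close>

lemma rmodule_homD:
  assumes "f \<in> rmodule_hom M N"
  shows "m \<in> carrier M \<Longrightarrow> f m \<in> carrier N" "m \<in> carrier M \<Longrightarrow> n \<in> carrier M \<Longrightarrow> f (m + n) = f m + f n"
    "m \<in> carrier M \<Longrightarrow> f (ract M m a) = ract N (f m) a"
  using assms by (auto simp: rmodule_hom_def)

lemma right_moduleD:
  assumes "right_module M"
  shows "0 \<in> carrier M" "m \<in> carrier M \<Longrightarrow> n \<in> carrier M \<Longrightarrow> m + n \<in> carrier M" "m \<in> carrier M \<Longrightarrow> - m \<in> carrier M"
    "m \<in> carrier M \<Longrightarrow> ract M m a \<in> carrier M"
    "m \<in> carrier M \<Longrightarrow> n \<in> carrier M \<Longrightarrow> ract M (m + n) a = ract M m a + ract M n a"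
    "m \<in> carrier M \<Longrightarrow> ract M m (a + b) = ract M m a + ract M m b"
    "m \<in> carrier M \<Longrightarrow> ract M m (a * b) = ract M (ract M m a) b"
    "m \<in> carrier M \<Longrightarrow> ract M m 1 = m"
  using assms by (auto simp: right_module_def)

lemma right_module_diff: "right_module M \<Longrightarrow> m \<in> carrier M \<Longrightarrow> n \<in> carrier M \<Longrightarrow> m - n \<in> carrier M"
  using right_moduleD(2)[of M m "- n"] right_moduleD(3)[of M n] by simp

lemma rmodule_hom_diff:
  assumes "right_module M" "f \<in> rmodule_hom M N" "m \<in> carrier M" "n \<in> carrier M"
  shows "f (m - n) = f m - f n"
  using rmodule_homD(2)[OF assms(2), of "m - n" n] assms right_module_diff[OF assms(1), of m n] by simp

lemma rmodule_hom_compose: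
  "f \<in> rmodule_hom M N \<Longrightarrow> g \<in> rmodule_hom N P \<Longrightarrow> (\<lambda>m. g (f m)) \<in> rmodule_hom M P"
  by (simp add: rmodule_hom_def)

lemma rmodule_hom_add:
  assumes "right_module N" "f \<in> rmodule_hom M N" "g \<in> rmodule_hom M N"
  shows "(\<lambda>m. f m + g m) \<in> rmodule_hom M N"
  using assms by (auto simp: rmodule_hom_def right_moduleD algebra_simps)

lemma rmodule_hom_central:
  assumes "right_module M" "\<And>a. a * z = z * (a :: 'a::ring_1)"
  shows "(\<lambda>m. ract M m z) \<in> rmodule_hom M M"
  using assms(2) right_moduleD(7)[OF assms(1), of _ _ z] right_moduleD(7)[OF assms(1), of _ z]
  by (simp add: rmodule_hom_def right_moduleD(4,5)[OF assms(1)])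

lemma carrier_free_rmodule: "carrier (free_rmodule I) = {p. Poly_Mapping.keys p \<subseteq> I}"
  by (simp add: free_rmodule_def)

lemma lookup_ract_free: "Poly_Mapping.lookup (ract (free_rmodule I) p a) i = Poly_Mapping.lookup p i * a"
  by (auto simp: free_rmodule_def map.rep_eq when_def)

lemma ract_free_single: "ract (free_rmodule I) (Poly_Mapping.single i 1) a = Poly_Mapping.single i (a :: 'a::ring_1)"
  by (rule poly_mapping_eqI) (simp add: lookup_ract_free lookup_single when_def)

lemma free_rmodule_induct [consumes 1, case_names zero single add]:
  assumes "p \<in> carrier (free_rmodule I)" "P 0"
    "\<And>i a. i \<in> I \<Longrightarrow> P (Poly_Mapping.single i a)"
    "\<And>p q. p \<in> carrier (free_rmodule I) \<Longrightarrow> q \<in> carrier (free_rmodule I) \<Longrightarrow> P p \<Longrightarrow> P q \<Longrightarrow> P (p + q)"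
  shows "P (p :: 'i \<Rightarrow>\<^sub>0 'a::ring_1)"
proof -
  have "Poly_Mapping.keys p \<subseteq> I \<Longrightarrow> P p"
  proof (induction p rule: update_induct)
    case const
    show ?case using assms(2) .
  next
    case (update f a b)
    have eq: "Poly_Mapping.update a b f = f + Poly_Mapping.single a b"
      by (rule poly_mapping_eqI)
        (use update in \<open>auto simp: lookup_update lookup_add lookup_single when_def in_keys_iff\<close>)
    have "Poly_Mapping.keys (Poly_Mapping.update a b f) = insert a (Poly_Mapping.keys f)"
      using update by (auto simp: in_keys_iff lookup_update split: if_splits)
    then have "a \<in> I" "Poly_Mapping.keys f \<subseteq> I" using update by auto
    then show ?case
      unfolding eq using update by (intro assms(4)) (auto simp: carrier_free_rmodule assms(3) split: if_splits)
  qed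
  then show ?thesis using assms(1) by (simp add: carrier_free_rmodule)
qed

lemma free_rmodule_hom_eq:
  assumes f: "f \<in> rmodule_hom (free_rmodule I) N" and g: "g \<in> rmodule_hom (free_rmodule I) N"
    and eq: "\<And>i. i \<in> I \<Longrightarrow> f (Poly_Mapping.single i 1) = g (Poly_Mapping.single i 1)"
    and p: "p \<in> carrier (free_rmodule I)"
  shows "f p = g (p :: 'i \<Rightarrow>\<^sub>0 'a::ring_1)"
  using p
proof (induction p rule: free_rmodule_induct)
  case zero
  show ?case using rmodule_hom_zero[OF right_module_free f] rmodule_hom_zero[OF right_module_free g] by simp
next
  case (single i a)
  have "Poly_Mapping.single i 1 \<in> carrier (free_rmodule I :: ('a, _) rmodule)"
    using single by (simp add: carrier_free_rmodule)
  then show ?case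
    using rmodule_homD(3)[OF f, of "Poly_Mapping.single i 1" a] rmodule_homD(3)[OF g, of "Poly_Mapping.single i 1" a] eq[OF single]
    by (simp add: ract_free_single)
next
  case (add p q)
  then show ?case using rmodule_homD(2)[OF f] rmodule_homD(2)[OF g] by simp
qed

lemma free_rmodule_lift:
  fixes I :: "'i set"
  assumes N: "right_module N" and \<beta>: "\<And>i. i \<in> I \<Longrightarrow> \<beta> i \<in> carrier N"
  shows "\<exists>f\<in>rmodule_hom (free_rmodule I) N. \<forall>i\<in>I. f (Poly_Mapping.single i (1::'a::ring_1)) = \<beta> i"
proof -
  define f where "f p = (\<Sum>i\<in>Poly_Mapping.keys p. ract N (\<beta> i) (Poly_Mapping.lookup p i))" for p :: "'i \<Rightarrow>\<^sub>0 'a"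
  have sum_closed: "finite A \<Longrightarrow> A \<subseteq> I \<Longrightarrow> (\<Sum>i\<in>A. ract N (\<beta> i) (c i)) \<in> carrier N" for A c
    by (induction A rule: finite_induct) (auto simp: right_moduleD[OF N] \<beta>)
  have sum_act: "finite A \<Longrightarrow> A \<subseteq> I \<Longrightarrow> ract N (\<Sum>i\<in>A. ract N (\<beta> i) (c i)) a = (\<Sum>i\<in>A. ract N (\<beta> i) (c i * a))" for A c a
  proof (induction A rule: finite_induct)
    case empty
    then show ?case by (simp add: right_module_zero_act[OF N])
  next
    case (insert x A)
    then show ?case by (simp add: right_moduleD[OF N] \<beta> sum_closed)
  qed
  have f_eq: "f p = (\<Sum>i\<in>A. ract N (\<beta> i) (Poly_Mapping.lookup p i))"
    if "finite A" "Poly_Mapping.keys p \<subseteq> A" "A \<subseteq> I" for p A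
    unfolding f_def
    using that \<beta> by (intro sum.mono_neutral_left) (auto simp: in_keys_iff right_module_act_zero[OF N])
  have "f \<in> rmodule_hom (free_rmodule I) N"
    unfolding rmodule_hom_def mem_Collect_eq carrier_free_rmodule
  proof (intro conjI ballI allI)
    fix p :: "'i \<Rightarrow>\<^sub>0 'a" assume "p \<in> {p. Poly_Mapping.keys p \<subseteq> I}"
    then have p: "Poly_Mapping.keys p \<subseteq> I" by simp
    show "f p \<in> carrier N" unfolding f_def using p by (intro sum_closed) auto
    show "f (ract (free_rmodule I) p a) = ract N (f p) a" for a
    proof -
      have "Poly_Mapping.keys (ract (free_rmodule I) p a) \<subseteq> Poly_Mapping.keys p"
        by (auto simp: in_keys_iff lookup_ract_free)
      then have "f (ract (free_rmodule I) p a) = (\<Sum>i\<in>Poly_Mapping.keys p. ract N (\<beta> i) (Poly_Mapping.lookup p i * a))"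
        using p by (simp add: f_eq[of "Poly_Mapping.keys p"] lookup_ract_free)
      then show ?thesis unfolding f_def[of p] using p by (simp add: sum_act)
    qed
    fix q :: "'i \<Rightarrow>\<^sub>0 'a" assume "q \<in> {p. Poly_Mapping.keys p \<subseteq> I}"
    then have q: "Poly_Mapping.keys q \<subseteq> I" by simp
    let ?A = "Poly_Mapping.keys p \<union> Poly_Mapping.keys q"
    have "ract N (\<beta> i) (a + b) = ract N (\<beta> i) a + ract N (\<beta> i) b" if "i \<in> ?A" for i a b
      using p q that \<beta> by (intro right_moduleD(6)[OF N]) auto
    then show "f (p + q) = f p + f q"
      using p q keys_add[of p q] by (simp add: f_eq[of ?A] lookup_add sum.distrib)
  qed
  moreover have "f (Poly_Mapping.single i 1) = \<beta> i" if "i \<in> I" for i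
    using that \<beta> by (simp add: f_def right_moduleD(8)[OF N])
  ultimately show ?thesis by blast
qed

text \<open>Centrality makes right multiplication by \<open>z\<close> a chain map; it covers the
  zero map of \<open>M\<close>. The homotopy is built degree by degree, with values on basis
  elements supplied by exactness.\<close>

lemma null_homotopy:
  fixes M :: "('a::ring_1, 'm::ab_group_add) rmodule" and I :: "nat \<Rightarrow> 'i set"
  assumes M: "right_module M" and res: "free_resolution M I d e"
    and z: "\<And>a. a * z = z * a" "\<And>m. m \<in> carrier M \<Longrightarrow> ract M m z = 0"
  obtains h where "\<And>n. h n \<in> rmodule_hom (free_rmodule (I n)) (free_rmodule (I (Suc n)))"
    "\<And>p. p \<in> carrier (free_rmodule (I 0)) \<Longrightarrow> ract (free_rmodule (I 0)) p z = d 0 (h 0 p)"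
    "\<And>n p. p \<in> carrier (free_rmodule (I (Suc n))) \<Longrightarrow>
       ract (free_rmodule (I (Suc n))) p z = d (Suc n) (h (Suc n) p) + h n (d n p)"
proof -
  define F where "F n = (free_rmodule (I n) :: ('a, 'i \<Rightarrow>\<^sub>0 'a) rmodule)" for n
  note rm = right_module_free
  have rmF: "right_module (F n)" for n unfolding F_def by (rule rm)
  have e: "e \<in> rmodule_hom (F 0) M" and d: "\<And>n. d n \<in> rmodule_hom (F (Suc n)) (F n)"
    and ex0: "d 0 ` carrier (F (Suc 0)) = {p \<in> carrier (F 0). e p = 0}"
    and ex: "\<And>n. d (Suc n) ` carrier (F (Suc (Suc n))) = {p \<in> carrier (F (Suc n)). d n p = 0}"
    using res by (auto simp: free_resolution_def F_def)
  have zh: "(\<lambda>p. ract (F n) p z) \<in> rmodule_hom (F n) (F n)" for n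
    by (rule rmodule_hom_central[OF rmF z(1)])
  have lift: "\<exists>f. f \<in> rmodule_hom (F n) (F m) \<and> (\<forall>i\<in>I n. f (Poly_Mapping.single i 1) = \<beta> i)"
    if "\<And>i. i \<in> I n \<Longrightarrow> \<beta> i \<in> carrier (F m)" for n m \<beta>
    using free_rmodule_lift[OF rmF that] unfolding F_def Bex_def .
  have single: "Poly_Mapping.single i 1 \<in> carrier (F n)" if "i \<in> I n" for i n
    using that by (simp add: F_def carrier_free_rmodule)
  \<comment> \<open>The homotopy identity restricted to cycles, where the term from the lower degree
    vanishes. It mentions a single map, so it can be carried through the recursion; in degree 0
    every element counts as a cycle.\<close>
  let ?P = "\<lambda>n h. h \<in> rmodule_hom (F n) (F (Suc n)) \<and>
      (\<forall>p\<in>carrier (F n). (case n of 0 \<Rightarrow> True | Suc m \<Rightarrow> d m p = 0) \<longrightarrow> d n (h p) = ract (F n) p z)"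
  let ?Q = "\<lambda>n h h'. \<forall>p\<in>carrier (F (Suc n)). ract (F (Suc n)) p z = d (Suc n) (h' p) + h (d n p)"
  have base: "\<exists>h. ?P 0 h"
  proof -
    have "\<forall>i\<in>I 0. \<exists>b\<in>carrier (F 1). d 0 b = ract (F 0) (Poly_Mapping.single i 1) z"
    proof
      fix i assume i: "i \<in> I 0"
      let ?s = "Poly_Mapping.single i 1 :: 'i \<Rightarrow>\<^sub>0 'a"
      have "e (ract (F 0) ?s z) = ract M (e ?s) z" using rmodule_homD(3)[OF e single[OF i]] .
      also have "\<dots> = 0" using z(2) rmodule_homD(1)[OF e single[OF i]] .
      finally have "ract (F 0) ?s z \<in> d 0 ` carrier (F (Suc 0))"
        unfolding ex0 using right_moduleD(4)[OF rmF single[OF i]] by simp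
      then show "\<exists>b\<in>carrier (F 1). d 0 b = ract (F 0) ?s z" by force
    qed
    from bchoice[OF this[unfolded Bex_def]] obtain \<beta> where \<beta>: "\<And>i. i \<in> I 0 \<Longrightarrow> \<beta> i \<in> carrier (F 1)"
      "\<And>i. i \<in> I 0 \<Longrightarrow> d 0 (\<beta> i) = ract (F 0) (Poly_Mapping.single i 1) z" by auto
    obtain h where h: "h \<in> rmodule_hom (F 0) (F 1)" "\<And>i. i \<in> I 0 \<Longrightarrow> h (Poly_Mapping.single i 1) = \<beta> i"
      using lift[of 0 \<beta> 1, OF \<beta>(1)] by auto
    have "d 0 (h p) = ract (F 0) p z" if "p \<in> carrier (F 0)" for p
      using free_rmodule_hom_eq[of "\<lambda>p. d 0 (h p)" "I 0" "F 0" "\<lambda>p. ract (F 0) p z" p] that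
        rmodule_hom_compose[OF h(1)[unfolded One_nat_def] d[of 0]] zh[of 0] h(2) \<beta>(2) by (simp add: F_def)
    then show ?thesis using h(1) by auto
  qed
  have step: "\<exists>h'. ?P (Suc n) h' \<and> ?Q n h h'" if h: "?P n h" for n h
  proof -
    have hh: "h \<in> rmodule_hom (F n) (F (Suc n))" using h by blast
    have dd: "d n p \<in> carrier (F n)" "d n (h (d n p)) = ract (F n) (d n p) z" if p: "p \<in> carrier (F (Suc n))" for p
    proof -
      show dp: "d n p \<in> carrier (F n)" using rmodule_homD(1)[OF d p] .
      have "case n of 0 \<Rightarrow> True | Suc m \<Rightarrow> d m (d n p) = 0"
      proof (cases n)
        case (Suc m)
        then have "d n p \<in> {p \<in> carrier (F (Suc m)). d m p = 0}" using p ex[of m] by auto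
        then show ?thesis using Suc by simp
      qed simp
      then show "d n (h (d n p)) = ract (F n) (d n p) z" using h dp by blast
    qed
    have "\<forall>i\<in>I (Suc n). \<exists>b\<in>carrier (F (Suc (Suc n))).
        d (Suc n) b = ract (F (Suc n)) (Poly_Mapping.single i 1) z - h (d n (Poly_Mapping.single i 1))"
    proof
      fix i assume i: "i \<in> I (Suc n)"
      let ?s = "Poly_Mapping.single i 1 :: 'i \<Rightarrow>\<^sub>0 'a"
      note s = single[OF i]
      have 1: "ract (F (Suc n)) ?s z \<in> carrier (F (Suc n))" by (rule right_moduleD(4)[OF rmF s])
      have 2: "h (d n ?s) \<in> carrier (F (Suc n))" using rmodule_homD(1)[OF hh dd(1)[OF s]] .
      \<comment> \<open>Both terms have the image \<open>ract (F n) (d n ?s) z\<close>: the first by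
        linearity of \<open>d n\<close>, the second because \<open>d n ?s\<close> is a cycle, where
        \<open>?P\<close> applies.\<close>
      have "d n (ract (F (Suc n)) ?s z - h (d n ?s)) = 0"
        unfolding rmodule_hom_diff[OF rmF d 1 2] rmodule_homD(3)[OF d s] dd(2)[OF s] by simp
      then have "ract (F (Suc n)) ?s z - h (d n ?s) \<in> d (Suc n) ` carrier (F (Suc (Suc n)))"
        unfolding ex using right_module_diff[OF rmF 1 2] by simp
      then show "\<exists>b\<in>carrier (F (Suc (Suc n))). d (Suc n) b = ract (F (Suc n)) ?s z - h (d n ?s)" by force
    qed
    from bchoice[OF this[unfolded Bex_def]] obtain \<beta> where \<beta>: "\<And>i. i \<in> I (Suc n) \<Longrightarrow> \<beta> i \<in> carrier (F (Suc (Suc n)))"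
      "\<And>i. i \<in> I (Suc n) \<Longrightarrow> d (Suc n) (\<beta> i) = ract (F (Suc n)) (Poly_Mapping.single i 1) z - h (d n (Poly_Mapping.single i 1))"
      by auto
    obtain h' where h': "h' \<in> rmodule_hom (F (Suc n)) (F (Suc (Suc n)))"
      "\<And>i. i \<in> I (Suc n) \<Longrightarrow> h' (Poly_Mapping.single i 1) = \<beta> i"
      using lift[of "Suc n" \<beta> "Suc (Suc n)", OF \<beta>(1)] by auto
    have "(\<lambda>p. d (Suc n) (h' p) + h (d n p)) \<in> rmodule_hom (F (Suc n)) (F (Suc n))"
      by (rule rmodule_hom_add[OF rmF rmodule_hom_compose[OF h'(1) d] rmodule_hom_compose[OF d hh]])
    then have Q: "?Q n h h'"
      using free_rmodule_hom_eq[of "\<lambda>p. ract (F (Suc n)) p z" "I (Suc n)" "F (Suc n)" "\<lambda>p. d (Suc n) (h' p) + h (d n p)"]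
        zh[of "Suc n"] h'(2) \<beta>(2) by (simp add: F_def)
    \<comment> \<open>On cycles the term \<open>h (d n p)\<close> is \<open>h 0\<close>, which turns
      the full identity into the invariant for the next degree.\<close>
    moreover have "h 0 = 0" using rmodule_hom_zero[OF rmF hh] .
    ultimately show ?thesis using h'(1) by auto
  qed
  obtain h where h: "\<And>n. ?P n (h n)" "\<And>n. ?Q n (h n) (h (Suc n))"
    using dependent_nat_choice[of ?P ?Q, OF base step] by metis
  show ?thesis
  proof (rule that[of h])
    show "h n \<in> rmodule_hom (free_rmodule (I n)) (free_rmodule (I (Suc n)))" for n
      using h(1)[of n] by (simp add: F_def)
    show "ract (free_rmodule (I 0)) p z = d 0 (h 0 p)" if "p \<in> carrier (free_rmodule (I 0))" for p
      using h(1)[of 0] that by (simp add: F_def)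
    show "ract (free_rmodule (I (Suc n))) p z = d (Suc n) (h (Suc n) p) + h n (d n p)"
      if "p \<in> carrier (free_rmodule (I (Suc n)))" for n p
      using h(2)[of n] that by (simp add: F_def)
  qed
qed

section \<open>Tensor products and Tor\<close>

abbreviation map_left :: "('m \<Rightarrow> 'm') \<Rightarrow> ('m \<times> 'n \<Rightarrow>\<^sub>0 int) \<Rightarrow> ('m' \<times> 'n \<Rightarrow>\<^sub>0 int)" where
  "map_left f \<equiv> frag_extend (\<lambda>(m, n). frag_of (f m, n))"

text \<open>Closure of the carrier keeps the defining relations of the tensor product inside the
  free abelian group on pairs of carrier elements.\<close>

definition left_closed :: "('a, 'n::ab_group_add) lmodule \<Rightarrow> bool" where
  "left_closed N \<longleftrightarrow> (\<forall>n\<in>carrier N. \<forall>n'\<in>carrier N. n + n' \<in> carrier N) \<and> (\<forall>a. \<forall>n\<in>carrier N. act N a n \<in> carrier N)"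

abbreviation tensor_gens ::
  "('a::ring_1, 'm::ab_group_add) rmodule \<Rightarrow> ('a, 'n::ab_group_add) lmodule \<Rightarrow> ('m \<times> 'n \<Rightarrow>\<^sub>0 int) set" where
  "tensor_gens M N \<equiv>
      {frag_of (m + m', n) - frag_of (m, n) - frag_of (m', n) | m m' n.
          m \<in> carrier M \<and> m' \<in> carrier M \<and> n \<in> carrier N} \<union>
       {frag_of (m, n + n') - frag_of (m, n) - frag_of (m, n') | m n n'.
          m \<in> carrier M \<and> n \<in> carrier N \<and> n' \<in> carrier N} \<union>
       {frag_of (ract M m a, n) - frag_of (m, act N a n) | m a n.
          m \<in> carrier M \<and> n \<in> carrier N}"

locale tensor_pair =
  fixes M :: "('a::ring_1, 'm::ab_group_add) rmodule" and N :: "('a, 'n::ab_group_add) lmodule"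
  assumes M: "right_module M" and N: "left_closed N"
begin

abbreviation "G \<equiv> free_Abelian_group (carrier M \<times> carrier N)"
abbreviation "R \<equiv> tensor_rels M N"

lemma gens_subset: "tensor_gens M N \<subseteq> carrier G"
proof -
  have keys3: "Poly_Mapping.keys (frag_of a - frag_of b - frag_of c) \<subseteq> S" if "a \<in> S" "b \<in> S" "c \<in> S" for a b c :: "'m \<times> 'n" and S
    using keys_diff[of "frag_of a - frag_of b" "frag_of c"] keys_diff[of "frag_of a" "frag_of b"] that by auto
  have keys2: "Poly_Mapping.keys (frag_of a - frag_of b) \<subseteq> S" if "a \<in> S" "b \<in> S" for a b :: "'m \<times> 'n" and S
    using keys_diff[of "frag_of a" "frag_of b"] that by auto
  have Nc: "n + n' \<in> carrier N" "act N a n \<in> carrier N" if "n \<in> carrier N" "n' \<in> carrier N" for n n' a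
    using N that by (auto simp: left_closed_def)
  have "g \<in> carrier G" if "g \<in> tensor_gens M N" for g
    using that
  proof (elim UnE; unfold mem_Collect_eq; elim exE conjE)
    fix m m' n assume *: "g = frag_of (m + m', n) - frag_of (m, n) - frag_of (m', n)" "m \<in> carrier M" "m' \<in> carrier M" "n \<in> carrier N"
    show ?thesis unfolding *(1) carrier_free_Abelian_group_iff
      by (rule keys3) (use * right_moduleD(2)[OF M] in auto)
  next
    fix m n n' assume *: "g = frag_of (m, n + n') - frag_of (m, n) - frag_of (m, n')" "m \<in> carrier M" "n \<in> carrier N" "n' \<in> carrier N"
    show ?thesis unfolding *(1) carrier_free_Abelian_group_iff
      by (rule keys3) (use * Nc in auto)
  next
    fix m a n assume *: "g = frag_of (ract M m a, n) - frag_of (m, act N a n)" "m \<in> carrier M" "n \<in> carrier N"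
    show ?thesis unfolding *(1) carrier_free_Abelian_group_iff
      by (rule keys2) (use * Nc right_moduleD(4)[OF M] in auto)
  qed
  then show ?thesis by (rule subsetI)
qed

lemma rels_generate: "R = generate G (tensor_gens M N)"
  by (simp add: tensor_rels_def)

lemma rels_subgroup: "subgroup R G"
  unfolding rels_generate by (rule group.generate_is_subgroup[OF group_free_Abelian_group gens_subset])

lemma rels_normal: "R \<lhd> G"
  by (rule comm_group.subgroup_imp_normal[OF abelian_free_Abelian_group rels_subgroup])

lemma rels_carrier: "x \<in> R \<Longrightarrow> Poly_Mapping.keys x \<subseteq> carrier M \<times> carrier N"
  using subsetD[OF subgroup.subset[OF rels_subgroup], of x] by simp

lemma rels_0: "0 \<in> R"
  using subgroup.one_closed[OF rels_subgroup] by simp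

lemma rels_add: "x \<in> R \<Longrightarrow> y \<in> R \<Longrightarrow> x + y \<in> R"
  using subgroup.m_closed[OF rels_subgroup] by simp

lemma rels_minus: "x \<in> R \<Longrightarrow> - x \<in> R"
  using subgroup.m_inv_closed[OF rels_subgroup, of x] rels_carrier[of x] by simp

lemma rels_diff: "x \<in> R \<Longrightarrow> y \<in> R \<Longrightarrow> x - y \<in> R"
  using rels_add[of x "- y"] rels_minus[of y] by simp

lemma rels_gen: "x \<in> tensor_gens M N \<Longrightarrow> x \<in> R"
  unfolding rels_generate by (rule generate.incl)

lemma rels_induct [consumes 1, case_names gen zero minus add]:
  assumes "x \<in> R" "\<And>g. g \<in> tensor_gens M N \<Longrightarrow> P g" "P 0" "\<And>x. P x \<Longrightarrow> P (- x)" "\<And>x y. P x \<Longrightarrow> P y \<Longrightarrow> P (x + y)"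
  shows "P x"
  using assms(1) unfolding rels_generate
proof (induction rule: generate.induct)
  case (inv h)
  then have "h \<in> carrier G" by (rule subsetD[OF gens_subset])
  then have "inv\<^bsub>G\<^esub> h = - h" by simp
  then show ?case using assms(2,4) inv by simp
qed (use assms in auto)

lemma coset: "R #>\<^bsub>G\<^esub> c = {r + c | r. r \<in> R}"
  by (auto simp: r_coset_def)

lemma coset_eq_iff: "R #>\<^bsub>G\<^esub> c = R #>\<^bsub>G\<^esub> c' \<longleftrightarrow> c - c' \<in> R"
proof
  assume "R #>\<^bsub>G\<^esub> c = R #>\<^bsub>G\<^esub> c'"
  moreover have "c \<in> R #>\<^bsub>G\<^esub> c" unfolding coset using rels_0 by force
  ultimately obtain r where "r \<in> R" "c = r + c'" unfolding coset by blast
  then show "c - c' \<in> R" by simp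
next
  assume d: "c - c' \<in> R"
  have "r + c = (r + (c - c')) + c'" "r + c' = (r - (c - c')) + c" for r by simp_all
  then show "R #>\<^bsub>G\<^esub> c = R #>\<^bsub>G\<^esub> c'"
    unfolding coset using d rels_add rels_diff by blast
qed

lemma tensor_group: "group (tensor M N)"
  unfolding tensor_def by (rule normal.factorgroup_is_group[OF rels_normal])

lemma tensor_carrier: "carrier (tensor M N) = (\<lambda>c. R #>\<^bsub>G\<^esub> c) ` {c. Poly_Mapping.keys c \<subseteq> carrier M \<times> carrier N}"
proof -
  have "carrier G = {c. Poly_Mapping.keys c \<subseteq> carrier M \<times> carrier N}" by auto
  then show ?thesis unfolding tensor_def carrier_FactGroup by simp
qed

lemma tensor_one: "\<one>\<^bsub>tensor M N\<^esub> = R #>\<^bsub>G\<^esub> 0"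
  by (simp add: tensor_def coset)

lemma tensor_mult:
  assumes "Poly_Mapping.keys c \<subseteq> carrier M \<times> carrier N" "Poly_Mapping.keys c' \<subseteq> carrier M \<times> carrier N"
  shows "(R #>\<^bsub>G\<^esub> c) \<otimes>\<^bsub>tensor M N\<^esub> (R #>\<^bsub>G\<^esub> c') = R #>\<^bsub>G\<^esub> (c + c')"
  using normal.rcos_sum[OF rels_normal, of c c'] assms by (simp add: tensor_def)

end

lemma keys_map_left:
  assumes "Poly_Mapping.keys c \<subseteq> A \<times> B" "\<And>m. m \<in> A \<Longrightarrow> f m \<in> A'"
  shows "Poly_Mapping.keys (map_left f c) \<subseteq> A' \<times> B"
proof -
  have "Poly_Mapping.keys (map_left f c) \<subseteq> (\<Union>x\<in>Poly_Mapping.keys c. Poly_Mapping.keys (case x of (m, n) \<Rightarrow> frag_of (f m, n)))"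
    by (rule keys_frag_extend)
  also have "\<dots> \<subseteq> A' \<times> B" by (rule UN_least) (use assms in auto)
  finally show ?thesis .
qed

locale tensor_pair_hom = S: tensor_pair M N + T: tensor_pair M' N
  for M :: "('a::ring_1, 'm::ab_group_add) rmodule" and M' :: "('a, 'm'::ab_group_add) rmodule"
    and N :: "('a, 'n::ab_group_add) lmodule" +
  fixes f :: "'m \<Rightarrow> 'm'"
  assumes f: "f \<in> rmodule_hom M M'"
begin

lemma map_left_rels:
  assumes "c \<in> tensor_rels M N"
  shows "map_left f c \<in> tensor_rels M' N"
  using assms
proof (induction rule: S.rels_induct)
  case (gen g)
  then have "map_left f g \<in> tensor_gens M' N"
  proof (elim UnE; unfold mem_Collect_eq; elim exE conjE)
    fix m m' n assume *: "g = frag_of (m + m', n) - frag_of (m, n) - frag_of (m', n)" "m \<in> carrier M" "m' \<in> carrier M" "n \<in> carrier N"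
    then have "map_left f g = frag_of (f m + f m', n) - frag_of (f m, n) - frag_of (f m', n)"
      by (simp add: frag_extend_diff rmodule_homD[OF f])
    then show ?thesis using * rmodule_homD(1)[OF f] by blast
  next
    fix m n n' assume *: "g = frag_of (m, n + n') - frag_of (m, n) - frag_of (m, n')" "m \<in> carrier M" "n \<in> carrier N" "n' \<in> carrier N"
    then have "map_left f g = frag_of (f m, n + n') - frag_of (f m, n) - frag_of (f m, n')"
      by (simp add: frag_extend_diff)
    then show ?thesis using * rmodule_homD(1)[OF f] by blast
  next
    fix m a n assume *: "g = frag_of (ract M m a, n) - frag_of (m, act N a n)" "m \<in> carrier M" "n \<in> carrier N"
    then have "map_left f g = frag_of (ract M' (f m) a, n) - frag_of (f m, act N a n)"
      by (simp add: frag_extend_diff rmodule_homD[OF f])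
    then show ?thesis using * rmodule_homD(1)[OF f] by blast
  qed
  then show ?case by (rule T.rels_gen)
qed (simp_all add: T.rels_0 T.rels_minus T.rels_add frag_extend_minus frag_extend_add)

text \<open>Relations are mapped to relations, so all members of a coset yield the same coset and
  \<open>the_elem\<close> is applied to a singleton.\<close>

lemma tensor_map_coset: "tensor_map M' N f (S.R #>\<^bsub>S.G\<^esub> c) = T.R #>\<^bsub>T.G\<^esub> map_left f c"
proof -
  have "T.R #>\<^bsub>T.G\<^esub> map_left f x = T.R #>\<^bsub>T.G\<^esub> map_left f c" if x: "x \<in> S.R #>\<^bsub>S.G\<^esub> c" for x
  proof -
    obtain r where "r \<in> S.R" "x = r + c" using x unfolding S.coset by blast
    then show ?thesis
      unfolding T.coset_eq_iff using map_left_rels[of r] by (simp add: frag_extend_add)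
  qed
  moreover have "c \<in> S.R #>\<^bsub>S.G\<^esub> c" unfolding S.coset using S.rels_0 by force
  ultimately have "(\<lambda>x. T.R #>\<^bsub>T.G\<^esub> map_left f x) ` (S.R #>\<^bsub>S.G\<^esub> c) = {T.R #>\<^bsub>T.G\<^esub> map_left f c}" by blast
  then show ?thesis unfolding tensor_map_def by simp
qed

lemma tensor_map_hom: "group_hom (tensor M N) (tensor M' N) (tensor_map M' N f)"
proof (intro group_hom.intro group_hom_axioms.intro S.tensor_group T.tensor_group)
  have keys: "Poly_Mapping.keys (map_left f c) \<subseteq> carrier M' \<times> carrier N" if "Poly_Mapping.keys c \<subseteq> carrier M \<times> carrier N" for c
    using keys_map_left[OF that] rmodule_homD(1)[OF f] by blast
  show "tensor_map M' N f \<in> hom (tensor M N) (tensor M' N)"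
    by (rule homI)
      (auto simp: S.tensor_carrier T.tensor_carrier tensor_map_coset S.tensor_mult T.tensor_mult keys frag_extend_add)
qed

end

text \<open>With cycles \<open>Z\<close> and boundaries \<open>B\<close>, this turns the vanishing
  of a homology group into an inclusion of sets.\<close>

lemma FactGroup_trivial_iff:
  assumes G: "group G" and Z: "subgroup Z G" and B: "subgroup B G"
  shows "carrier (subgroup_generated G Z Mod B) = {\<one>\<^bsub>subgroup_generated G Z Mod B\<^esub>} \<longleftrightarrow> Z \<subseteq> B"
proof -
  interpret group G by (rule G)
  have Zc: "carrier (subgroup_generated G Z) = Z"
    using Z by (rule subgroup.carrier_subgroup_generated_subgroup)
  have coset: "B #>\<^bsub>subgroup_generated G Z\<^esub> x = B #>\<^bsub>G\<^esub> x" for x by (simp add: r_coset_def)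
  have self: "x \<in> B #>\<^bsub>G\<^esub> x" if "x \<in> Z" for x
    using rcos_self[OF _ B] subgroup.subset[OF Z] that by blast
  have "carrier (subgroup_generated G Z Mod B) = (\<lambda>x. B #>\<^bsub>G\<^esub> x) ` Z"
    by (simp add: carrier_FactGroup Zc coset)
  moreover have "(\<lambda>x. B #>\<^bsub>G\<^esub> x) ` Z = {B} \<longleftrightarrow> Z \<subseteq> B"
  proof
    assume "(\<lambda>x. B #>\<^bsub>G\<^esub> x) ` Z = {B}"
    then show "Z \<subseteq> B" using self by blast
  next
    assume "Z \<subseteq> B"
    then have "B #>\<^bsub>G\<^esub> x = B" if "x \<in> Z" for x using subgroup.rcos_const[OF B G] that by blast
    then show "(\<lambda>x. B #>\<^bsub>G\<^esub> x) ` Z = {B}" using subgroup.one_closed[OF Z] by force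
  qed
  ultimately show ?thesis by simp
qed

text \<open>The additive extension of \<phi> to the free abelian group; such maps detect formal sums
  that are nonzero in a tensor product.\<close>

definition frag_eval :: "('k \<Rightarrow> complex) \<Rightarrow> ('k \<Rightarrow>\<^sub>0 int) \<Rightarrow> complex" where
  "frag_eval \<phi> c = (\<Sum>k\<in>Poly_Mapping.keys c. of_int (Poly_Mapping.lookup c k) * \<phi> k)"

lemma frag_eval_add: "frag_eval \<phi> (a + b) = frag_eval \<phi> a + frag_eval \<phi> b"
proof -
  have sup: "frag_eval \<phi> c = (\<Sum>k\<in>A. of_int (Poly_Mapping.lookup c k) * \<phi> k)"
    if "finite A" "Poly_Mapping.keys c \<subseteq> A" for c A
    unfolding frag_eval_def using that by (intro sum.mono_neutral_left) (auto simp: in_keys_iff)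
  let ?A = "Poly_Mapping.keys a \<union> Poly_Mapping.keys b"
  show ?thesis
    using keys_add[of a b] by (simp add: sup[of ?A] lookup_add algebra_simps sum.distrib)
qed

lemma frag_eval_0: "frag_eval \<phi> 0 = 0"
  by (simp add: frag_eval_def)

lemma frag_eval_diff: "frag_eval \<phi> (a - b) = frag_eval \<phi> a - frag_eval \<phi> b"
  using frag_eval_add[of \<phi> "a - b" b] by simp

lemma frag_eval_of: "frag_eval \<phi> (frag_of x) = \<phi> x"
  by (simp add: frag_eval_def)

section \<open>Homology of a tensored free resolution\<close>

locale tensored_resolution =
  fixes M :: "('a::ring_1, 'm::ab_group_add) rmodule" and N :: "('a, 'n::ab_group_add) lmodule"
    and I :: "nat \<Rightarrow> 'i set" and d e
  assumes M: "right_module M" and N: "left_closed N" and res: "free_resolution M I d e"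
begin

abbreviation "F n \<equiv> (free_rmodule (I n) :: ('a, 'i \<Rightarrow>\<^sub>0 'a) rmodule)"
abbreviation "chain_frags n \<equiv> {c. Poly_Mapping.keys c \<subseteq> carrier (F n) \<times> carrier N}"
abbreviation "rels n \<equiv> tensor_rels (F n) N"

lemma e: "e \<in> rmodule_hom (F 0) M" and d: "d n \<in> rmodule_hom (F (Suc n)) (F n)"
  using res by (auto simp: free_resolution_def)

lemma pair: "tensor_pair (F n) N"
  by (intro tensor_pair.intro right_module_free N)

lemma pair_hom: "f \<in> rmodule_hom (F m) (F n) \<Longrightarrow> tensor_pair_hom (F m) (F n) N f"
  by (intro tensor_pair_hom.intro tensor_pair_hom_axioms.intro pair)

text \<open>Cycles are described by formal sums whose boundary is a relation, so that later
  arguments avoid cosets.\<close>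

definition cycles :: "nat \<Rightarrow> (('i \<Rightarrow>\<^sub>0 'a) \<times> 'n \<Rightarrow>\<^sub>0 int) set" where
  "cycles k = {c \<in> chain_frags k. case k of 0 \<Rightarrow> True | Suc n \<Rightarrow> map_left (d n) c \<in> rels n}"

theorem homology_trivial_iff:
  "carrier (tensor_homology I d N k) = {\<one>\<^bsub>tensor_homology I d N k\<^esub>} \<longleftrightarrow>
     (\<forall>c\<in>cycles k. \<exists>b\<in>chain_frags (Suc k). c - map_left (d k) b \<in> rels k)"
proof -
  interpret K: tensor_pair "F k" N by (rule pair)
  interpret K1: tensor_pair "F (Suc k)" N by (rule pair)
  interpret D: tensor_pair_hom "F (Suc k)" "F k" N "d k" by (rule pair_hom[OF d])
  let ?C = "\<lambda>n. tensor (F n) N" and ?\<delta> = "\<lambda>n. tensor_map (F n) N (d n)"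
  define Z where "Z = (case k of 0 \<Rightarrow> carrier (?C 0) | Suc n \<Rightarrow> kernel (?C (Suc n)) (?C n) (?\<delta> n))"
  define B where "B = ?\<delta> k ` carrier (?C (Suc k))"
  have hom: "tensor_homology I d N k = subgroup_generated (?C k) Z Mod B"
    by (simp add: tensor_homology_def Z_def B_def Let_def)
  have Z: "subgroup Z (?C k)"
  proof (cases k)
    case 0
    then show ?thesis using group.subgroup_self[OF K.tensor_group] by (simp add: Z_def)
  next
    case (Suc n)
    interpret D': tensor_pair_hom "F (Suc n)" "F n" N "d n" by (rule pair_hom[OF d])
    show ?thesis using group_hom.subgroup_kernel[OF D'.tensor_map_hom] Suc by (simp add: Z_def)
  qed
  have B: "subgroup B (?C k)"
    unfolding B_def using group_hom.subgroup_img_is_subgroup[OF D.tensor_map_hom] group.subgroup_self[OF K1.tensor_group] by blast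
  have Z_eq: "Z = (\<lambda>c. rels k #>\<^bsub>K.G\<^esub> c) ` cycles k"
  proof (cases k)
    case 0
    then show ?thesis using K.tensor_carrier by (simp add: Z_def cycles_def)
  next
    case (Suc n)
    interpret L: tensor_pair "F n" N by (rule pair)
    interpret D': tensor_pair_hom "F (Suc n)" "F n" N "d n" by (rule pair_hom[OF d])
    have "?\<delta> n (rels (Suc n) #>\<^bsub>D'.S.G\<^esub> c) = \<one>\<^bsub>?C n\<^esub> \<longleftrightarrow> map_left (d n) c \<in> rels n" for c
      using L.coset_eq_iff[of "map_left (d n) c" 0] by (simp add: D'.tensor_map_coset L.tensor_one)
    then show ?thesis
      unfolding Z_def Suc kernel_def cycles_def using D'.S.tensor_carrier by auto
  qed
  have "Z \<subseteq> B \<longleftrightarrow> (\<forall>c\<in>cycles k. \<exists>b\<in>chain_frags (Suc k). rels k #>\<^bsub>K.G\<^esub> c = rels k #>\<^bsub>K.G\<^esub> map_left (d k) b)"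
    unfolding Z_eq B_def K1.tensor_carrier image_image D.tensor_map_coset by blast
  then show ?thesis
    unfolding hom FactGroup_trivial_iff[OF K.tensor_group Z B] K.coset_eq_iff .
qed

text \<open>Modulo relations, a chain equals its product with \<open>z\<close>, by homotopy the
  boundary of \<open>h c\<close> plus \<open>h\<close> of the boundary of \<open>c\<close>. For a
  cycle the last term is a relation.\<close>

theorem homology_vanishes:
  assumes z: "\<And>a. a * z = z * a" "\<And>m. m \<in> carrier M \<Longrightarrow> ract M m z = 0" "\<And>n. n \<in> carrier N \<Longrightarrow> act N z n = n"
  shows "carrier (tensor_homology I d N k) = {\<one>\<^bsub>tensor_homology I d N k\<^esub>}"
  unfolding homology_trivial_iff
proof
  fix c assume c: "c \<in> cycles k"
  interpret K: tensor_pair "F k" N by (rule pair)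
  obtain h where h: "\<And>n. h n \<in> rmodule_hom (F n) (F (Suc n))"
    and h0: "\<And>p. p \<in> carrier (F 0) \<Longrightarrow> ract (F 0) p z = d 0 (h 0 p)"
    and hS: "\<And>n p. p \<in> carrier (F (Suc n)) \<Longrightarrow> ract (F (Suc n)) p z = d (Suc n) (h (Suc n) p) + h n (d n p)"
    by (rule null_homotopy[OF M res z(1,2)]) blast+
  \<comment> \<open>Moved across the tensor sign, \<open>z\<close> acts on \<open>v\<close> as the
    identity.\<close>
  have zv: "frag_of (ract (F k) p z, v) - frag_of (p, v) \<in> rels k" if "p \<in> carrier (F k)" "v \<in> carrier N" for p v
  proof -
    have "frag_of (ract (F k) p z, v) - frag_of (p, act N z v) \<in> rels k"
      using that by (intro K.rels_gen UnI2) blast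
    then show ?thesis using z(3)[OF that(2)] by simp
  qed
  have cc: "Poly_Mapping.keys c \<subseteq> carrier (F k) \<times> carrier N" using c by (simp add: cycles_def)
  define b where "b = map_left (h k) c"
  have "b \<in> chain_frags (Suc k)"
    unfolding b_def using keys_map_left[OF cc, of "h k"] rmodule_homD(1)[OF h] by blast
  moreover have "c - map_left (d k) b \<in> rels k"
  proof (cases k)
    case 0
    have "x - map_left (d 0) (map_left (h 0) x) \<in> rels 0" if "Poly_Mapping.keys x \<subseteq> carrier (F 0) \<times> carrier N" for x
      using that
    proof (induction x rule: frag_induction)
      case (one x)
      then obtain p v where x: "x = (p, v)" "p \<in> carrier (F 0)" "v \<in> carrier N" by blast
      then show ?case using K.rels_minus[OF zv[of p v]] h0[OF x(2)] 0 by simp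
    next
      case (diff a b)
      then show ?case using K.rels_diff[unfolded 0, OF diff] by (simp add: frag_extend_diff algebra_simps)
    qed (use K.rels_0 0 in simp)
    then show ?thesis using cc 0 by (simp add: b_def)
  next
    case (Suc n)
    interpret H: tensor_pair_hom "F n" "F (Suc n)" N "h n" by (rule pair_hom[OF h])
    have R0: "0 \<in> rels (Suc n)" using H.T.rels_0 .
    \<comment> \<open>On a generator \<open>(p, v)\<close> this is the homotopy identity for
      \<open>p\<close>, together with one additivity relation that splits the sum in the first
      factor.\<close>
    have "x - map_left (d (Suc n)) (map_left (h (Suc n)) x) - map_left (h n) (map_left (d n) x) \<in> rels (Suc n)"
      if "Poly_Mapping.keys x \<subseteq> carrier (F (Suc n)) \<times> carrier N" for x
      using that
    proof (induction x rule: frag_induction)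
      case (one x)
      then obtain p v where x: "x = (p, v)" "p \<in> carrier (F (Suc n))" "v \<in> carrier N" by blast
      let ?a = "d (Suc n) (h (Suc n) p)" and ?b = "h n (d n p)"
      have "?a \<in> carrier (F (Suc n))" "?b \<in> carrier (F (Suc n))"
        using x(2) rmodule_homD(1)[OF h] rmodule_homD(1)[OF d] by blast+
      then have "frag_of (?a + ?b, v) - frag_of (?a, v) - frag_of (?b, v) \<in> rels (Suc n)"
        using x(3) by (intro H.T.rels_gen) blast
      moreover have "frag_of (?a + ?b, v) - frag_of (p, v) \<in> rels (Suc n)"
        using zv[of p v] x Suc hS[OF x(2)] by simp
      ultimately have "(frag_of (?a + ?b, v) - frag_of (?a, v) - frag_of (?b, v)) - (frag_of (?a + ?b, v) - frag_of (p, v)) \<in> rels (Suc n)"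
        by (rule H.T.rels_diff)
      then show ?case by (simp add: x(1) algebra_simps)
    next
      case (diff a b)
      then show ?case using H.T.rels_diff[OF diff] by (simp add: frag_extend_diff algebra_simps)
    qed (use R0 in simp)
    from this[of c] have "c - map_left (d (Suc n)) b - map_left (h n) (map_left (d n) c) \<in> rels (Suc n)"
      using cc Suc by (simp add: b_def)
    moreover have "map_left (h n) (map_left (d n) c) \<in> rels (Suc n)"
      using c Suc by (intro H.map_left_rels) (simp add: cycles_def)
    ultimately show ?thesis using H.T.rels_add Suc by fastforce
  qed
  ultimately show "\<exists>b\<in>chain_frags (Suc k). c - map_left (d k) b \<in> rels k" by blast
qed

text \<open>A balanced biadditive map, composed with the augmentation \<open>e\<close> in the first
  argument, kills all relations and, since \<open>e\<close> vanishes on boundaries, all boundaries.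
  It is nonzero on a lift of \<open>m\<close> paired with \<open>n\<close>.\<close>

theorem homology_0_nontrivial:
  fixes \<phi> :: "'m \<Rightarrow> 'n \<Rightarrow> complex"
  assumes add_left: "\<And>m m' n. m \<in> carrier M \<Longrightarrow> m' \<in> carrier M \<Longrightarrow> n \<in> carrier N \<Longrightarrow> \<phi> (m + m') n = \<phi> m n + \<phi> m' n"
    and add_right: "\<And>m n n'. m \<in> carrier M \<Longrightarrow> n \<in> carrier N \<Longrightarrow> n' \<in> carrier N \<Longrightarrow> \<phi> m (n + n') = \<phi> m n + \<phi> m n'"
    and balanced: "\<And>m a n. m \<in> carrier M \<Longrightarrow> n \<in> carrier N \<Longrightarrow> \<phi> (ract M m a) n = \<phi> m (act N a n)"
    and nz: "m \<in> carrier M" "n \<in> carrier N" "\<phi> m n \<noteq> 0"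
  shows "carrier (tensor_homology I d N 0) \<noteq> {\<one>\<^bsub>tensor_homology I d N 0\<^esub>}"
proof
  assume "carrier (tensor_homology I d N 0) = {\<one>\<^bsub>tensor_homology I d N 0\<^esub>}"
  then have *: "\<forall>c\<in>cycles 0. \<exists>b\<in>chain_frags (Suc 0). c - map_left (d 0) b \<in> rels 0"
    by (simp only: homology_trivial_iff)
  interpret K: tensor_pair "F 0" N by (rule pair)
  define \<Phi> where "\<Phi> = frag_eval (\<lambda>(p, v). \<phi> (e p) v)"
  note eD = rmodule_homD[OF e]
  have R: "\<Phi> c = 0" if "c \<in> rels 0" for c
    using that
  proof (induction rule: K.rels_induct)
    case (gen g)
    then show ?case
      by (elim UnE; unfold mem_Collect_eq; elim exE conjE)
        (simp_all add: \<Phi>_def frag_eval_diff frag_eval_of eD add_left add_right balanced)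
  next
    case (minus x)
    then show ?case using frag_eval_diff[of _ 0 x] by (simp add: \<Phi>_def frag_eval_0)
  qed (simp_all add: \<Phi>_def frag_eval_0 frag_eval_add)
  have 0: "\<phi> 0 v = 0" if "v \<in> carrier N" for v
    using add_left[of 0 0 v] that right_moduleD(1)[OF M] by simp
  have ed: "e (d 0 p) = 0" if "p \<in> carrier (F (Suc 0))" for p
  proof -
    have "d 0 p \<in> {p \<in> carrier (F 0). e p = 0}" using res that unfolding free_resolution_def by blast
    then show ?thesis by simp
  qed
  have bd: "\<Phi> (map_left (d 0) b) = 0" if "Poly_Mapping.keys b \<subseteq> carrier (F (Suc 0)) \<times> carrier N" for b
    using that
    by (induction b rule: frag_induction)
      (auto simp: \<Phi>_def frag_eval_0 frag_extend_diff frag_eval_diff frag_eval_of ed 0)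
  have "e ` carrier (F 0) = carrier M" using res by (simp add: free_resolution_def)
  then obtain p where p: "p \<in> carrier (F 0)" "e p = m" using nz(1) by (metis imageE)
  have "frag_of (p, n) \<in> cycles 0" using p nz(2) by (simp add: cycles_def)
  then obtain b where b: "b \<in> chain_frags (Suc 0)" "frag_of (p, n) - map_left (d 0) b \<in> rels 0" using * by blast
  then have "\<Phi> (frag_of (p, n)) = \<Phi> (map_left (d 0) b)" using R[OF b(2)] by (simp add: \<Phi>_def frag_eval_diff)
  also have "\<dots> = 0" using bd b(1) by simp
  finally show False using p nz(3) by (simp add: \<Phi>_def frag_eval_of)
qed

end

section \<open>The Taylor spectrum\<close>

lemma Tor_resolution:
  fixes M :: "('a::ring_1, 'm::ab_group_add) rmodule" and N :: "('a, 'n::ab_group_add) lmodule"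
  assumes M: "right_module M" and N: "left_closed N"
  obtains I d e where "tensored_resolution M N (I :: nat \<Rightarrow> ('m \<times> 'a) list set) d e"
    "\<And>k. Tor M N k = tensor_homology I d N k"
proof -
  let ?r = "SOME (I :: nat \<Rightarrow> ('m \<times> 'a) list set, d). \<exists>e. free_resolution M I d e"
  obtain I d where r: "?r = (I, d)" by (cases ?r)
  have "\<exists>r. case r of (I :: nat \<Rightarrow> ('m \<times> 'a) list set, d) \<Rightarrow> \<exists>e. free_resolution M I d e"
    using free_resolution_exists[OF M] by auto
  from someI_ex[OF this] obtain e where "free_resolution M I d e" unfolding r by auto
  then have "tensored_resolution M N I d e" by (intro tensored_resolution.intro M N)
  moreover have "Tor M N k = tensor_homology I d N k" for k
    unfolding Tor_def r by simp
  ultimately show ?thesis using that by blast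
qed

lemma left_closed_uea_lmodule: "lie_module V \<Longrightarrow> left_closed (uea_lmodule V)"
  using lie_mod.uact_closed[of V] lie_mod.sub[of V]
  by (auto simp: left_closed_def lie_mod_def complex_vs.subspace_add)

lemma Tor_vanishes:
  fixes S :: "('g::lie_algebra, 's::complex_vs) lmodule" and V :: "('g, 'v::complex_vs) lmodule"
  assumes ss: "semisimple_lie_algebra TYPE('g)"
    and S: "lie_module S" "fin_dim (carrier S)" and V: "lie_module V" "fin_dim (carrier V)"
    and hom: "\<And>f s. lie_hom f S V \<Longrightarrow> s \<in> carrier S \<Longrightarrow> f s = 0"
  shows "carrier (Tor (uea_rmodule (dual_module S)) (uea_lmodule V) k) =
    {\<one>\<^bsub>Tor (uea_rmodule (dual_module S)) (uea_lmodule V) k\<^esub>}"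
proof -
  interpret S: lie_mod S by unfold_locales (rule S)
  obtain z where z: "\<And>u. u * z = z * u" "\<And>s. s \<in> carrier S \<Longrightarrow> act (uea_lmodule S) z s = 0"
    "\<And>v. v \<in> carrier V \<Longrightarrow> act (uea_lmodule V) z v = v"
    by (rule central_separation[OF ss S V]) (use hom in \<open>blast+\<close>)
  obtain I d e where res: "tensored_resolution (uea_rmodule (dual_module S)) (uea_lmodule V) I d e"
    and Tor: "\<And>k. Tor (uea_rmodule (dual_module S)) (uea_lmodule V) k = tensor_homology I d (uea_lmodule V) k"
    by (rule Tor_resolution[OF S.right_module_dual left_closed_uea_lmodule[OF V(1)]]) (rule that)
  have "ract (uea_rmodule (dual_module S)) f z = 0" if f: "f \<in> carrier (uea_rmodule (dual_module S))" for f
  proof -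
    have "lin_on (carrier S) f" using f by (simp add: carrier_dual)
    from lin_on_0[OF this S.sub] show ?thesis using f z(2) by (auto simp: S.dual_ract fun_eq_iff)
  qed
  then show ?thesis
    unfolding Tor using tensored_resolution.homology_vanishes[OF res z(1)] z(3) by simp
qed

text \<open>The pairing sends a functional \<open>m\<close> on \<open>S\<close> and a vector
  \<open>w\<close> to \<open>m (g w)\<close>; equivariance of \<open>g\<close> makes it balanced
  over the enveloping algebra.\<close>

lemma Tor_0_nonzero:
  fixes S :: "('g::lie_algebra, 's::complex_vs) lmodule" and V :: "('g, 'v::complex_vs) lmodule"
  assumes S: "lie_module S" and V: "lie_module V" and g: "lie_hom g V S" and v: "v \<in> carrier V" "g v \<noteq> 0"
  shows "carrier (Tor (uea_rmodule (dual_module S)) (uea_lmodule V) 0) \<noteq>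
    {\<one>\<^bsub>Tor (uea_rmodule (dual_module S)) (uea_lmodule V) 0\<^esub>}"
proof -
  interpret S: lie_mod S by unfold_locales (rule S)
  interpret V: lie_mod V by unfold_locales (rule V)
  let ?D = "uea_rmodule (dual_module S)"
  obtain I d e where res: "tensored_resolution ?D (uea_lmodule V) I d e"
    and Tor: "\<And>k. Tor ?D (uea_lmodule V) k = tensor_homology I d (uea_lmodule V) k"
    by (rule Tor_resolution[OF S.right_module_dual left_closed_uea_lmodule[OF V]]) (rule that)
  have gS: "g w \<in> carrier S" if "w \<in> carrier V" for w using g that by (auto simp: lie_hom_def)
  have gl: "lin_on (carrier V) g" using g by (simp add: lie_hom_def)
  have "complex_vs.independent {g v}" using v(2) by simp
  \<comment> \<open>A functional with value 1 at \<open>g v\<close>; cut off outside the carrier, it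
    becomes an element of the dual module that pairs nontrivially with \<open>v\<close>.\<close>
  then obtain L :: "'s \<Rightarrow> complex" where L: "clinear L" "L (g v) = 1"
    using cvs_pair.linear_independent_extend[of "{g v}" "\<lambda>_. 1"] by auto
  define f where "f s = (if s \<in> carrier S then L s else 0)" for s
  have f: "f \<in> carrier ?D"
    by (auto simp: carrier_dual f_def lin_on_def csubspace_simps[OF S.sub] clinear_add[OF L(1)] clinear_scale[OF L(1)])
  have lin: "lin_on (carrier S) m" if "m \<in> carrier ?D" for m using that by (simp add: carrier_dual)
  show ?thesis
    unfolding Tor
  proof (rule tensored_resolution.homology_0_nontrivial[OF res, of "\<lambda>m w. m (g w)" f v])
    fix m w w' assume m: "m \<in> carrier ?D" and w: "w \<in> carrier (uea_lmodule V)" "w' \<in> carrier (uea_lmodule V)"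
    show "m (g (w + w')) = m (g w) + m (g w')"
      using w by (simp add: lin_on_add[OF gl] lin_on_add[OF lin[OF m]] gS)
  next
    fix m a w assume m: "m \<in> carrier ?D" and w: "w \<in> carrier (uea_lmodule V)"
    show "ract ?D m a (g w) = m (g (act (uea_lmodule V) a w))"
      using m w uact_lie_hom[OF V S g, of w a] by (simp add: S.dual_ract gS)
  qed (use f v gS L in \<open>simp_all add: f_def\<close>)
qed

text \<open>The kernel is a submodule of the simple module \<open>S\<close> and misses
  \<open>s\<close>, so it is zero and \<open>f\<close> is an isomorphism onto its image.\<close>

lemma simple_hom_submodule:
  assumes S: "lie_simple S" and V: "lie_module V" and f: "lie_hom f S V" and s: "s \<in> carrier S" "f s \<noteq> 0"
  shows "lie_submodule (f ` carrier S) V \<and> S \<simeq> V\<lparr>carrier := f ` carrier S\<rparr>"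
proof -
  have "lie_module S" using S by (simp add: lie_simple_def)
  then interpret S: lie_mod S by unfold_locales
  have fl: "lin_on (carrier S) f" and fV: "f ` carrier S \<subseteq> carrier V"
    and fa: "\<And>x s. s \<in> carrier S \<Longrightarrow> f (act S x s) = act V x (f s)"
    using f by (auto simp: lie_hom_def)
  let ?K = "{s \<in> carrier S. f s = 0}"
  have "f 0 = 0" by (rule lin_on_0[OF fl S.sub])
  then have "csubspace ?K"
    by (intro complex_vs.subspaceI) (auto simp: csubspace_simps[OF S.sub] lin_on_add[OF fl] lin_on_scale[OF fl])
  moreover have "f (act S x s) = 0" if "s \<in> carrier S" "f s = 0" for x s
  proof -
    interpret V: lie_mod V by unfold_locales (rule V)
    show ?thesis using fa that lin_on_0[OF V.act_lin V.sub] by simp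
  qed
  ultimately have "lie_submodule ?K S" by (auto simp: lie_submodule_def S.closed)
  then have "?K = {0} \<or> ?K = carrier S" using S unfolding lie_simple_def by blast
  then have K: "?K = {0}" using s by blast
  have "inj_on f (carrier S)"
  proof (rule inj_onI)
    fix a b assume ab: "a \<in> carrier S" "b \<in> carrier S" "f a = f b"
    then have "a - b \<in> ?K" by (simp add: csubspace_simps[OF S.sub] lin_on_diff[OF fl S.sub])
    then show "a = b" unfolding K by simp
  qed
  then have "S \<simeq> V\<lparr>carrier := f ` carrier S\<rparr>"
    unfolding lie_isomorphic_def using fa fl
    by (intro exI[of _ f]) (simp add: bij_betw_def lin_on_add lin_on_scale lin_on_def)
  moreover have "lie_submodule (f ` carrier S) V"
    using fV lin_on_image_subspace[OF fl S.sub] S.closed by (auto simp: lie_submodule_def fa[symmetric])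
  ultimately show ?thesis by blast
qed

text \<open>The homomorphism is the equivariant projection onto \<open>W\<close> followed by the
  inverse of the isomorphism; it does not vanish at the image of a nonzero \<open>s\<close>.\<close>

lemma submodule_hom:
  assumes ss: "semisimple_lie_algebra TYPE('g::lie_algebra)" and V: "lie_module V" "fin_dim (carrier V)"
    and W: "lie_submodule W V" and S: "lie_module (S :: ('g, 's::complex_vs) lmodule)" and iso: "S \<simeq> V\<lparr>carrier := W\<rparr>"
    and ne: "carrier S \<noteq> {0}"
  obtains g v where "lie_hom g V S" "v \<in> carrier V" "g v \<noteq> 0"
proof -
  interpret S: lie_mod S by unfold_locales (rule S)
  interpret V: lie_mod V by unfold_locales (rule V)
  obtain f where bij: "bij_betw f (carrier S) W" and f: "lin_on (carrier S) f"
    and fa: "\<And>x s. s \<in> carrier S \<Longrightarrow> f (act S x s) = act V x (f s)"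
    using iso by (auto simp: lie_isomorphic_def lin_on_def)
  obtain \<pi> where \<pi>: "lie_hom \<pi> V V" "\<pi> ` carrier V \<subseteq> W" "\<And>w. w \<in> W \<Longrightarrow> \<pi> w = w"
    by (rule V.complete_reducibility[OF ss V(2) W]) (rule that)
  define q where "q = the_inv_into (carrier S) f"
  have inj: "inj_on f (carrier S)" and img: "f ` carrier S = W" using bij by (auto simp: bij_betw_def)
  have q: "q w \<in> carrier S" "f (q w) = w" if "w \<in> W" for w
    using that img inj by (auto simp: q_def f_the_inv_into_f the_inv_into_into)
  have qf: "q (f s) = s" if "s \<in> carrier S" for s using that inj by (simp add: q_def the_inv_into_f_f)
  have \<pi>W: "\<pi> v \<in> W" if "v \<in> carrier V" for v using \<pi>(2) that by blast
  have \<pi>l: "lin_on (carrier V) \<pi>" and \<pi>a: "\<And>x v. v \<in> carrier V \<Longrightarrow> \<pi> (act V x v) = act V x (\<pi> v)"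
    using \<pi>(1) by (auto simp: lie_hom_def)
  \<comment> \<open>Linearity is transferred to the inverse by applying \<open>f\<close> to the
    right-hand side and cancelling with \<open>qf\<close>; the next two facts are obtained in the
    same way.\<close>
  have "q (\<pi> (v + w)) = q (\<pi> v) + q (\<pi> w)" if "v \<in> carrier V" "w \<in> carrier V" for v w
    using qf[of "q (\<pi> v) + q (\<pi> w)"] that q[OF \<pi>W] by (simp add: lin_on_add[OF \<pi>l] lin_on_add[OF f] csubspace_simps[OF S.sub])
  moreover have "q (\<pi> (c *\<^sub>C v)) = c *\<^sub>C q (\<pi> v)" if "v \<in> carrier V" for c v
    using qf[of "c *\<^sub>C q (\<pi> v)"] that q[OF \<pi>W] by (simp add: lin_on_scale[OF \<pi>l] lin_on_scale[OF f] csubspace_simps[OF S.sub])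
  moreover have "q (\<pi> (act V x v)) = act S x (q (\<pi> v))" if "v \<in> carrier V" for x v
    using qf[of "act S x (q (\<pi> v))"] that q[OF \<pi>W] by (simp add: \<pi>a fa S.closed)
  ultimately have "lie_hom (\<lambda>v. q (\<pi> v)) V S"
    using q(1)[OF \<pi>W] by (auto simp: lie_hom_def lin_on_def)
  moreover obtain s where s: "s \<in> carrier S" "s \<noteq> 0" using ne complex_vs.subspace_0[OF S.sub] by blast
  moreover have "f s \<in> W" using s img by blast
  then have "f s \<in> carrier V" "q (\<pi> (f s)) = s" using W \<pi>(3) qf s by (auto simp: lie_submodule_def)
  ultimately show ?thesis using that[of "\<lambda>v. q (\<pi> v)" "f s"] by simp
qed

theorem theorem3p5:
  fixes V :: "('g::lie_algebra, 'v::complex_vs) lmodule"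
  assumes "semisimple_lie_algebra TYPE('g)"
    and "lie_module V"
    and "fin_dim (carrier V)"
  shows "(taylor_spectrum V :: ('g, 's::complex_vs) lmodule set set) =
    {\<xi> \<in> simple_classes. \<exists>S\<in>\<xi>. \<exists>W. lie_submodule W V \<and> S \<simeq> V\<lparr>carrier := W\<rparr>}"
proof -
  \<comment> \<open>The equivalence holds for each representative of each class, so the two sets are
    compared representative by representative. For an embedded \<open>S\<close> the nonzero degree
    is 0.\<close>
  have "(\<exists>k. carrier (Tor (uea_rmodule (dual_module S)) (uea_lmodule V) k) \<noteq>
        {\<one>\<^bsub>Tor (uea_rmodule (dual_module S)) (uea_lmodule V) k\<^esub>}) \<longleftrightarrow>
      (\<exists>W. lie_submodule W V \<and> S \<simeq> V\<lparr>carrier := W\<rparr>)" (is "?L \<longleftrightarrow> ?R")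
    if "\<xi> \<in> simple_classes" "S \<in> \<xi>" for \<xi> and S :: "('g, 's) lmodule"
  proof -
    have "S \<in> simple_fd_modules" using that by (auto simp: simple_classes_def quotient_def)
    then have S: "lie_simple S" "lie_module S" "fin_dim (carrier S)" "carrier S \<noteq> {0}"
      by (auto simp: simple_fd_modules_def lie_simple_def)
    show ?thesis
    proof
      assume ?L
      then obtain f s where "lie_hom f S V" "s \<in> carrier S" "f s \<noteq> 0"
        using Tor_vanishes[OF assms(1) S(2,3) assms(2,3)] by blast
      then show ?R using simple_hom_submodule[OF S(1) assms(2)] by blast
    next
      assume ?R
      then obtain W where W: "lie_submodule W V" "S \<simeq> V\<lparr>carrier := W\<rparr>" by blast
      obtain g v where g: "lie_hom g V S" "v \<in> carrier V" "g v \<noteq> 0"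
        by (rule submodule_hom[OF assms W(1) S(2) W(2) S(4)]) (rule that)
      show ?L by (rule exI, rule Tor_0_nonzero[OF S(2) assms(2) g])
    qed
  qed
  then show ?thesis
    unfolding taylor_spectrum_def by (intro Collect_cong conj_cong bex_cong refl)
qed

end
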